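(* Let $V$ be a complex vector space of dimension $n+1$ and let $d\ge 0$ be an integer. Then $$\dim\mathrm{SOS}_k\le k\binom{n+d}{n}-\binom{k}{2},$$ and equality holds for $k\le n$ and a general $f\in\mathrm{SOS}_k$.
   Context: $\mathrm{Sym}^mV$ denotes the space of homogeneous polynomials of degree $m$ in $x_0,\dots,x_n$ over $\mathbb{C}$, where $x_0,\dots,x_n$ is a basis of $V$. The variety $\mathrm{SOS}_k\subset \mathrm{Sym}^{2d}V$ is the Zariski closure of $\{f_1^2+\dots+f_k^2 : f_i\in \mathrm{Sym}^dV\}$. The dimension is that of $\mathrm{SOS}_k$ as an affine variety in the vector space $\mathrm{Sym}^{2d}V$ (not of its projectivization). The general $f\in\mathrm{SOS}_k$ enters through the dominant map $\prod_{i=1}^k\mathrm{Sym}^dV\to\mathrm{SOS}_k$, $(f_1,\dots,f_k)\mapsto\sum_{i=1}^k f_i^2$, whose fiber over $f$ is the variety $\{(f_1,\dots,f_k)\in\prod_{i=1}^k\mathrm{Sym}^dV : \sum_{i=1}^k f_i^2=f\}$ of decompositions of $f$ as a sum of $k$ squares.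
   Formalization: Assumes k ≤ C(n+d,n)+1, since for larger k the bound can fail (d=0, k=3: dim SOS_3 = 1 > 0); for such k, SOS_k is all of Sym^{2d}V and nothing is claimed, though the bound still holds for some. Equality for general f also states that the fibre has dimension C(k,2). *)

theory Defs
  imports "HOL-Analysis.Analysis" "HOL-Library.Poly_Mapping"
begin

section \<open>Forms over the complex numbers\<close>

text \<open>
  A polynomial is a finitely supported map from monomials to complex coefficients; a monomial
  \<open>a\<close> is a finitely supported exponent vector, \<open>Poly_Mapping.lookup a i\<close> being the exponent of \<open>x\<^sub>i\<close>.
  The ring structure is that of \<^theory>\<open>HOL-Library.Poly_Mapping\<close> (convolution).
\<close>

type_synonym cpoly = "(nat \<Rightarrow>\<^sub>0 nat) \<Rightarrow>\<^sub>0 complex"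

text \<open>\<open>Sym n m\<close> is \<open>Sym\<^sup>m V\<close> for the space \<open>V\<close> with basis \<open>x\<^sub>0, \<dots>, x\<^sub>n\<close>, so \<open>dim V = n + 1\<close>.\<close>

definition Sym :: "nat \<Rightarrow> nat \<Rightarrow> cpoly set" where
  "Sym n m = {p. \<forall>a \<in> Poly_Mapping.keys p. Poly_Mapping.keys a \<subseteq> {0..n} \<and>
                 (\<Sum>i=0..n. Poly_Mapping.lookup a i) = m}"

section \<open>Zariski topology, dimension, general points\<close>

text \<open>Polynomial functions in a given set \<open>C\<close> of coordinate functions.\<close>

inductive_set poly_functions :: "('a \<Rightarrow> complex) set \<Rightarrow> ('a \<Rightarrow> complex) set"
  for C :: "('a \<Rightarrow> complex) set" where
  const: "(\<lambda>_. c) \<in> poly_functions C"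
| coord: "u \<in> C \<Longrightarrow> u \<in> poly_functions C"
| add: "u \<in> poly_functions C \<Longrightarrow> v \<in> poly_functions C \<Longrightarrow> (\<lambda>p. u p + v p) \<in> poly_functions C"
| mult: "u \<in> poly_functions C \<Longrightarrow> v \<in> poly_functions C \<Longrightarrow> (\<lambda>p. u p * v p) \<in> poly_functions C"

text \<open>
  The Zariski topology on the affine space \<open>W\<close> with coordinates \<open>C\<close>: the closed sets are
  the common zero sets in \<open>W\<close> of families of polynomial functions.
\<close>

definition zariski :: "('a \<Rightarrow> complex) set \<Rightarrow> 'a set \<Rightarrow> 'a topology" where
  "zariski C W =
     topology (\<lambda>U. \<exists>E \<subseteq> poly_functions C. U = {p \<in> W. \<exists>u \<in> E. u p \<noteq> 0})"

lemma istopology_zariski: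
  "istopology (\<lambda>U. \<exists>E \<subseteq> poly_functions C. U = {p \<in> W. \<exists>u \<in> E. u p \<noteq> 0})"
  (is "istopology ?open")
  unfolding istopology_def
proof (intro conjI allI impI)
  fix S T
  assume "?open S" "?open T"
  then obtain E F where E: "E \<subseteq> poly_functions C" "S = {p \<in> W. \<exists>u \<in> E. u p \<noteq> 0}"
    and F: "F \<subseteq> poly_functions C" "T = {p \<in> W. \<exists>u \<in> F. u p \<noteq> 0}" by blast
  define G where "G = (\<lambda>(u, v) p. u p * v p) ` (E \<times> F)"
  have "G \<subseteq> poly_functions C" using E(1) F(1) by (auto simp: G_def intro!: poly_functions.mult)
  moreover have "S \<inter> T = {p \<in> W. \<exists>u \<in> G. u p \<noteq> 0}"
    unfolding E(2) F(2) G_def by (simp add: bex_simps split_beta) blast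
  ultimately show "?open (S \<inter> T)" by blast
next
  fix K
  assume K: "\<forall>S \<in> K. ?open S"
  define E where "E = {u \<in> poly_functions C. {p \<in> W. u p \<noteq> 0} \<subseteq> \<Union>K}"
  have "\<exists>u \<in> E. u p \<noteq> 0" if "p \<in> S" "S \<in> K" for p S
  proof -
    from K \<open>S \<in> K\<close> obtain F where F: "F \<subseteq> poly_functions C" "S = {p \<in> W. \<exists>u \<in> F. u p \<noteq> 0}"
      by blast
    with \<open>p \<in> S\<close> obtain u where u: "u \<in> F" "u p \<noteq> 0" by blast
    have "{p \<in> W. u p \<noteq> 0} \<subseteq> S" using F u(1) by blast
    with F u \<open>S \<in> K\<close> show ?thesis unfolding E_def by blast
  qed
  moreover have "p \<in> W" if "p \<in> S" "S \<in> K" for p S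
    using K that by blast
  ultimately have "\<Union>K = {p \<in> W. \<exists>u \<in> E. u p \<noteq> 0}" unfolding E_def by blast
  moreover have "E \<subseteq> poly_functions C" by (auto simp: E_def)
  ultimately show "?open (\<Union>K)" by blast
qed

lemma openin_zariski:
  "openin (zariski C W) U \<longleftrightarrow> (\<exists>E \<subseteq> poly_functions C. U = {p \<in> W. \<exists>u \<in> E. u p \<noteq> 0})"
  unfolding zariski_def by (simp add: topology_inverse' istopology_zariski)

lemma topspace_zariski [simp]: "topspace (zariski C W) = W"
proof
  show "topspace (zariski C W) \<subseteq> W" by (auto simp: topspace_def openin_zariski)
  have "openin (zariski C W) W"
    unfolding openin_zariski by (rule exI[of _ "{\<lambda>_. 1}"]) (auto intro: poly_functions.const)
  then show "W \<subseteq> topspace (zariski C W)" by (rule openin_subset)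
qed

lemma closedin_zariski:
  "closedin (zariski C W) X \<longleftrightarrow> (\<exists>E \<subseteq> poly_functions C. X = {p \<in> W. \<forall>u \<in> E. u p = 0})"
proof
  assume "closedin (zariski C W) X"
  then obtain E where "X \<subseteq> W" "E \<subseteq> poly_functions C" "W - X = {p \<in> W. \<exists>u \<in> E. u p \<noteq> 0}"
    by (auto simp: closedin_def openin_zariski)
  then have "X = {p \<in> W. \<forall>u \<in> E. u p = 0}" by blast
  with \<open>E \<subseteq> _\<close> show "\<exists>E \<subseteq> poly_functions C. X = {p \<in> W. \<forall>u \<in> E. u p = 0}" by blast
next
  assume "\<exists>E \<subseteq> poly_functions C. X = {p \<in> W. \<forall>u \<in> E. u p = 0}"
  then obtain E where "E \<subseteq> poly_functions C" "X = {p \<in> W. \<forall>u \<in> E. u p = 0}" by blast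
  moreover from this have "W - X = {p \<in> W. \<exists>u \<in> E. u p \<noteq> 0}" by blast
  ultimately show "closedin (zariski C W) X" by (auto simp: closedin_def openin_zariski)
qed

definition irreducible_closed :: "'a topology \<Rightarrow> 'a set \<Rightarrow> bool" where
  "irreducible_closed X Z \<longleftrightarrow> closedin X Z \<and> Z \<noteq> {} \<and>
     (\<forall>A B. closedin X A \<and> closedin X B \<and> Z = A \<union> B \<longrightarrow> Z = A \<or> Z = B)"

text \<open>
  Krull dimension: the supremum of the lengths \<open>r\<close> of chains
  \<open>Z\<^sub>0 \<subset> Z\<^sub>1 \<subset> \<dots> \<subset> Z\<^sub>r\<close> of irreducible closed sets. The empty space has dimension \<open>- \<infinity>\<close>.
\<close>

definition krull_dim :: "'a topology \<Rightarrow> ereal" where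
  "krull_dim X = Sup {ereal (real r) | r. \<exists>Z :: nat \<Rightarrow> 'a set.
     (\<forall>i\<le>r. irreducible_closed X (Z i)) \<and> (\<forall>i<r. Z i \<subset> Z (Suc i))}"

text \<open>A property holds for a general point if it holds on a dense open subset.\<close>

definition holds_generally :: "'a topology \<Rightarrow> ('a \<Rightarrow> bool) \<Rightarrow> bool" where
  "holds_generally X P \<longleftrightarrow>
     (\<exists>U. openin X U \<and> X closure_of U = topspace X \<and> (\<forall>p \<in> U. P p))"

section \<open>Sums of squares\<close>

definition Sym_top :: "nat \<Rightarrow> nat \<Rightarrow> cpoly topology" where
  "Sym_top n m = zariski {\<lambda>p. Poly_Mapping.lookup p a | a. True} (Sym n m)"

text \<open>The \<open>k\<close>-fold product of \<open>Sym\<^sup>d V\<close>, with factors indexed by \<open>1, \<dots>, k\<close>.\<close>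

definition Sym_tuples :: "nat \<Rightarrow> nat \<Rightarrow> nat \<Rightarrow> (nat \<Rightarrow> cpoly) set" where
  "Sym_tuples n d k = {1..k} \<rightarrow>\<^sub>E Sym n d"

definition Sym_tuples_top :: "nat \<Rightarrow> nat \<Rightarrow> nat \<Rightarrow> (nat \<Rightarrow> cpoly) topology" where
  "Sym_tuples_top n d k =
     zariski {\<lambda>f. Poly_Mapping.lookup (f i) a | i a. i \<in> {1..k}} (Sym_tuples n d k)"

definition SOS :: "nat \<Rightarrow> nat \<Rightarrow> nat \<Rightarrow> cpoly set" where
  "SOS n d k = Sym_top n (2 * d) closure_of {(\<Sum>i=1..k. (f i)\<^sup>2) | f. f \<in> Sym_tuples n d k}"

definition SOS_top :: "nat \<Rightarrow> nat \<Rightarrow> nat \<Rightarrow> cpoly topology" where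
  "SOS_top n d k = subtopology (Sym_top n (2 * d)) (SOS n d k)"

definition SOS_decompositions :: "nat \<Rightarrow> nat \<Rightarrow> nat \<Rightarrow> cpoly \<Rightarrow> (nat \<Rightarrow> cpoly) set" where
  "SOS_decompositions n d k g = {f \<in> Sym_tuples n d k. (\<Sum>i=1..k. (f i)\<^sup>2) = g}"

definition SOS_decompositions_top :: "nat \<Rightarrow> nat \<Rightarrow> nat \<Rightarrow> cpoly \<Rightarrow> (nat \<Rightarrow> cpoly) topology" where
  "SOS_decompositions_top n d k g =
     subtopology (Sym_tuples_top n d k) (SOS_decompositions n d k g)"

text \<open>
  Let \<open>N = (n + d) choose n\<close> be the dimension of \<open>Sym n d\<close>. The bound \<open>k * N - (k choose 2)\<close> for
  the dimension of \<open>SOS n d k\<close> comes from the action of the orthogonal group \<open>O(k)\<close> on the fibres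
  \<open>SOS_decompositions n d k g\<close>; its stabilisers are generically finite exactly for \<open>k \<le> N + 1\<close>.
  Beyond that range the bound can fail: \<open>SOS n d k\<close> is all of \<open>Sym n (2 * d)\<close> from \<open>k = N\<close> on,
  while \<open>k * N - (k choose 2)\<close> decreases and eventually becomes negative.
\<close>

end

theory Submission
  imports Defs "HOL-Complex_Analysis.Conformal_Mappings"
begin

text \<open>
  Dimensions are measured by growth: \<open>growth_le b S C\<close> says that the polynomial functions of degree at
  most \<open>D\<close> in finitely many of the coordinates \<open>C\<close> span a space of dimension \<open>O(D\<^sup>b)\<close> on \<open>S\<close>.
  If \<open>Z \<subset> Z'\<close> are irreducible and \<open>u\<close> vanishes on \<open>Z\<close> but not on \<open>Z'\<close>, then the products \<open>u\<^sup>j f\<^sub>i\<close> of powers of \<open>u\<close>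
  with functions \<open>f\<^sub>i\<close> independent on \<open>Z\<close> are independent on \<open>Z'\<close>, so growth drops and bounds the
  Krull dimension. Conversely, a map from \<open>s\<close>-space whose differential at one point is injective
  produces a chain of length \<open>s\<close>, the closures of the images of a coordinate flag.

  By Householder reflections every sum of squares of a real tuple comes from a triangular tuple; real
  tuples are Zariski dense, and the triangular tuples form a linear space of dimension
  \<open>k N - (k choose 2)\<close>. At \<open>(x\<^sub>1\<^sup>d, \<dots>, x\<^sub>k\<^sup>d)\<close> the differential of the sum of squares is injective on
  this space. A general point lifts to a triangular tuple with nonzero diagonal, whose orbit under
  products of plane rotations has dimension \<open>k choose 2\<close>; the opposite bound for the general fibre
  comes from specialising algebraic relations among the coefficients of a tuple over the functions
  of its sum of squares.
\<close>

section \<open>Polynomial functions filtered by degree\<close>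

text \<open>\<open>SOS\<close> is a closure, so its general point is only known to be a limit of
  sums of squares until a decomposition is produced; this is why lifting points is treated apart
  from dimension. A Householder reflection needs \<open>\<beta> \<noteq> 0\<close>, which can fail
  over the complex numbers for nonzero isotropic vectors; hence the detour through real tuples,
  after which only Zariski closures are compared. The triangular form needs \<open>k - 1\<close>
  distinct monomials, and \<open>k \<le> ((n + d) choose n) + 1\<close> says that so many exist.
  Sine and cosine serve both parametrizations: rotations have such entries, sine maps the complex
  numbers onto themselves with derivative 1 at 0, and the identity theorem on complex lines makes
  the images irreducible. The bounds fit together by one count: a tuple has
  \<open>k * ((n + d) choose n)\<close> coefficients, the functions of its sum of squares contain
  \<open>card J\<close> algebraically independent ones, so at most \<open>k choose 2\<close>
  coefficients stay independent on a general fibre.\<close>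

inductive pdeg :: "('a \<Rightarrow> complex) set \<Rightarrow> nat \<Rightarrow> ('a \<Rightarrow> complex) \<Rightarrow> bool"
  for C :: "('a \<Rightarrow> complex) set" where
  const: "pdeg C D (\<lambda>_. c)"
| coord: "u \<in> C \<Longrightarrow> pdeg C (Suc D) u"
| add: "pdeg C D u \<Longrightarrow> pdeg C D v \<Longrightarrow> pdeg C D (\<lambda>p. u p + v p)"
| mult: "pdeg C D u \<Longrightarrow> pdeg C E v \<Longrightarrow> D + E \<le> F \<Longrightarrow> pdeg C F (\<lambda>p. u p * v p)"

text \<open>The number \<open>D\<close> only bounds the degree of some expression for the function;
  it is not an invariant of the function. The slack \<open>D + E \<le> F\<close> in
  \<open>mult\<close> makes weakening admissible.\<close>

lemma pdeg_mono: "pdeg C D u \<Longrightarrow> D \<le> E \<Longrightarrow> pdeg C E u"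
proof (induction arbitrary: E rule: pdeg.induct)
  case (coord u D)
  then show ?case by (cases E) (auto intro: pdeg.coord)
qed (auto intro: pdeg.intros order_trans)

lemma pdeg_mono_coords: "pdeg C D u \<Longrightarrow> C \<subseteq> C' \<Longrightarrow> pdeg C' D u"
  by (induction rule: pdeg.induct) (auto intro: pdeg.intros)

lemma pdeg_imp_poly_functions: "pdeg C D u \<Longrightarrow> u \<in> poly_functions C"
  by (induction rule: pdeg.induct) (auto intro: poly_functions.intros)

lemma pdeg_uminus: "pdeg C D u \<Longrightarrow> pdeg C D (\<lambda>p. - u p)"
  using pdeg.mult[of C 0 "\<lambda>_. -1" D u D] by (simp add: pdeg.const)

lemma pdeg_diff: "pdeg C D u \<Longrightarrow> pdeg C D v \<Longrightarrow> pdeg C D (\<lambda>p. u p - v p)"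
  using pdeg.add[of C D u "\<lambda>p. - v p"] by (simp add: pdeg_uminus)

lemma pdeg_sum: "(\<And>i. i \<in> I \<Longrightarrow> pdeg C D (f i)) \<Longrightarrow> pdeg C D (\<lambda>p. \<Sum>i\<in>I. f i p)"
  by (induction I rule: infinite_finite_induct) (auto intro: pdeg.intros)

lemma pdeg_power: "pdeg C D u \<Longrightarrow> pdeg C (n * D) (\<lambda>p. u p ^ n)"
  by (induction n) (auto intro: pdeg.intros)

lemma pdeg_prod:
  "finite I \<Longrightarrow> (\<And>i. i \<in> I \<Longrightarrow> pdeg C D (f i)) \<Longrightarrow> pdeg C (card I * D) (\<lambda>p. \<Prod>i\<in>I. f i p)"
proof (induction I rule: finite_induct)
  case (insert i I)
  then show ?case using pdeg.mult[of C D "f i" "card I * D"] by simp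
qed (auto intro: pdeg.const)

text \<open>The coordinate sets of interest are infinite, one coordinate per monomial, so every
  degree count takes place in a finite part \<open>G\<close>.\<close>

lemma poly_functions_imp_pdeg:
  "u \<in> poly_functions C \<Longrightarrow> \<exists>G D. finite G \<and> G \<subseteq> C \<and> pdeg G D u"
proof (induction rule: poly_functions.induct)
  case (const c)
  then show ?case by (intro exI[of _ "{}"] exI[of _ 0]) (auto intro: pdeg.const)
next
  case (coord u)
  then show ?case by (intro exI[of _ "{u}"] exI[of _ 1]) (auto intro: pdeg.coord)
next
  case (add u v)
  then obtain G D H E where "finite G" "G \<subseteq> C" "pdeg G D u" "finite H" "H \<subseteq> C" "pdeg H E v"
    by blast
  then have "finite (G \<union> H) \<and> G \<union> H \<subseteq> C \<and> pdeg (G \<union> H) (D + E) (\<lambda>p. u p + v p)"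
    by (auto intro!: pdeg.add intro: pdeg_mono[OF pdeg_mono_coords])
  then show ?case by blast
next
  case (mult u v)
  then obtain G D H E where "finite G" "G \<subseteq> C" "pdeg G D u" "finite H" "H \<subseteq> C" "pdeg H E v"
    by blast
  then have "finite (G \<union> H) \<and> G \<union> H \<subseteq> C \<and> pdeg (G \<union> H) (D + E) (\<lambda>p. u p * v p)"
    by (auto intro!: pdeg.mult[of _ D u E v] intro: pdeg_mono_coords)
  then show ?case by blast
qed

lemma poly_functions_imp_pdeg_common:
  assumes "finite I" "\<And>i. i \<in> I \<Longrightarrow> f i \<in> poly_functions C"
  shows "\<exists>G D. finite G \<and> G \<subseteq> C \<and> (\<forall>i\<in>I. pdeg G D (f i))"
  using assms
proof (induction I rule: finite_induct)
  case (insert i I)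
  then obtain G D where G: "finite G" "G \<subseteq> C" "\<forall>i\<in>I. pdeg G D (f i)" by auto
  obtain H E where H: "finite H" "H \<subseteq> C" "pdeg H E (f i)"
    using poly_functions_imp_pdeg[of "f i" C] insert.prems by auto
  have "pdeg (G \<union> H) (D + E) (f j)" if "j \<in> insert i I" for j
    using that G H by (auto intro: pdeg_mono[OF pdeg_mono_coords])
  then show ?case using G H by (intro exI[of _ "G \<union> H"] exI[of _ "D + E"]) auto
qed (use pdeg.const in blast)

lemma poly_functions_mono: "u \<in> poly_functions C \<Longrightarrow> C \<subseteq> C' \<Longrightarrow> u \<in> poly_functions C'"
  by (induction rule: poly_functions.induct) (auto intro: poly_functions.intros)

lemma poly_functions_idem: "u \<in> poly_functions (poly_functions C) \<Longrightarrow> u \<in> poly_functions C"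
  by (induction rule: poly_functions.induct) (auto intro: poly_functions.intros)

lemma poly_functions_trans: "u \<in> poly_functions C \<Longrightarrow> C \<subseteq> poly_functions C' \<Longrightarrow> u \<in> poly_functions C'"
  by (rule poly_functions_idem) (rule poly_functions_mono)

lemma poly_functions_compose:
  assumes "u \<in> poly_functions C" "\<And>w. w \<in> C \<Longrightarrow> (\<lambda>x. w (h x)) \<in> poly_functions C'"
  shows "(\<lambda>x. u (h x)) \<in> poly_functions C'"
  using assms(1) by induction (auto intro: assms(2) poly_functions.intros)

lemma poly_functions_scale: "u \<in> poly_functions C \<Longrightarrow> (\<lambda>p. c * u p) \<in> poly_functions C"
  using poly_functions.mult[OF poly_functions.const] by blast

lemma poly_functions_uminus: "u \<in> poly_functions C \<Longrightarrow> (\<lambda>p. - u p) \<in> poly_functions C"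
  using poly_functions_scale[of u C "-1"] by simp

lemma poly_functions_diff:
  "u \<in> poly_functions C \<Longrightarrow> v \<in> poly_functions C \<Longrightarrow> (\<lambda>p. u p - v p) \<in> poly_functions C"
  using poly_functions.add[of u C "\<lambda>p. - v p"] by (simp add: poly_functions_uminus)

lemma poly_functions_sum:
  "(\<And>i. i \<in> I \<Longrightarrow> f i \<in> poly_functions C) \<Longrightarrow> (\<lambda>p. \<Sum>i\<in>I. f i p) \<in> poly_functions C"
  by (induction I rule: infinite_finite_induct) (auto intro: poly_functions.intros)

lemma poly_functions_prod:
  "(\<And>i. i \<in> I \<Longrightarrow> f i \<in> poly_functions C) \<Longrightarrow> (\<lambda>p. \<Prod>i\<in>I. f i p) \<in> poly_functions C"
  by (induction I rule: infinite_finite_induct) (auto intro: poly_functions.intros)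

lemma poly_functions_power: "u \<in> poly_functions C \<Longrightarrow> (\<lambda>p. u p ^ n) \<in> poly_functions C"
  by (induction n) (auto intro: poly_functions.intros)

text \<open>Collecting powers of \<open>y\<close> loses nothing in degree: each coefficient still
  has the bound \<open>D\<close>. This drives all inductions on the number of coordinates.\<close>

lemma pdeg_insert:
  assumes "pdeg (insert y C) D u"
  shows "\<exists>q. (\<forall>j. pdeg C D (q j)) \<and> u = (\<lambda>p. \<Sum>j\<le>D. q j p * y p ^ j)"
  using assms
proof (induction rule: pdeg.induct)
  case (const D c)
  have "(\<Sum>j\<le>D. (if j = 0 then c else 0) * y p ^ j) = c" for p
    by (simp add: if_distrib[of "\<lambda>x. x * _"] sum.delta cong: if_cong)
  then show ?case
    by (intro exI[of _ "\<lambda>j _. if j = 0 then c else 0"]) (auto intro: pdeg.const)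
next
  case (coord u D)
  show ?case
  proof (cases "u = y")
    case True
    have "(\<Sum>j\<le>Suc D. (if j = 1 then 1 else 0) * y p ^ j) = y p" for p
      by (subst sum.mono_neutral_right[of _ "{1}"]) auto
    then show ?thesis using True
      by (intro exI[of _ "\<lambda>j _. if j =
        1 then 1 else 0"]) (auto intro: pdeg.const simp del: sum.atMost_Suc)
  next
    case False
    have "(\<Sum>j\<le>Suc D. (if j = 0 then u p else 0) * y p ^ j) = u p" for p
      by (subst sum.mono_neutral_right[of _ "{0}"]) auto
    moreover have "pdeg C (Suc D) (\<lambda>p. if j = 0 then u p else 0)" for j
      using False coord by (cases "j = 0") (auto intro: pdeg.const pdeg.coord)
    ultimately show ?thesis
      by (intro exI[of _ "\<lambda>j p. if j = 0 then u p else 0"]) (auto simp del: sum.atMost_Suc)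
  qed
next
  case (add D u v)
  then obtain q r where "\<forall>j. pdeg C D (q j)" "u = (\<lambda>p. \<Sum>j\<le>D. q j p * y p ^ j)"
    "\<forall>j. pdeg C D (r j)" "v = (\<lambda>p. \<Sum>j\<le>D. r j p * y p ^ j)" by blast
  then show ?case
    by (intro exI[of _ "\<lambda>j p. q j p + r j p"])
      (auto intro: pdeg.add simp: distrib_right sum.distrib)
next
  case (mult D u E v F)
  then obtain q r where q: "\<forall>j. pdeg C D (q j)" "u = (\<lambda>p. \<Sum>j\<le>D. q j p * y p ^ j)"
    and r: "\<forall>j. pdeg C E (r j)" "v = (\<lambda>p. \<Sum>j\<le>E. r j p * y p ^ j)" by blast
  \<comment> \<open>The coefficients are cut off beyond the degrees, as the Cauchy product formula
    requires.\<close>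
  define q' where "q' = (\<lambda>j p. if j \<le> D then q j p else 0)"
  define r' where "r' = (\<lambda>j p. if j \<le> E then r j p else 0)"
  define s where "s = (\<lambda>k p. \<Sum>i\<le>k. q' i p * r' (k - i) p)"
  have "pdeg C D (q' j)" "pdeg C E (r' j)" for j
    using q(1) r(1) pdeg.const[of C D 0] pdeg.const[of C E 0]
    by (cases "j \<le> D"; cases "j \<le> E"; simp add: q'_def r'_def)+
  then have "pdeg C F (s j)" for j
    unfolding s_def by (intro pdeg_sum pdeg.mult[OF _ _ mult.hyps(3)]) auto
  moreover have "u p * v p = (\<Sum>k\<le>F. s k p * y p ^ k)" for p
  proof -
    have u: "u p = (\<Sum>j\<le>D. q' j p * y p ^ j)" and v: "v p = (\<Sum>j\<le>E. r' j p * y p ^ j)"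
      by (auto simp: q(2) r(2) q'_def r'_def)
    have "u p * v p = (\<Sum>k\<le>D + E. s k p * y p ^ k)"
      unfolding u v s_def by (rule polynomial_product) (auto simp: q'_def r'_def)
    also have "\<dots> = (\<Sum>k\<le>F. s k p * y p ^ k)"
    proof (rule sum.mono_neutral_left)
      show "\<forall>k\<in>{..F} - {..D + E}. s k p * y p ^ k = 0"
        by (auto simp: s_def q'_def r'_def intro!: sum.neutral)
    qed (use mult.hyps(3) in auto)
    finally show ?thesis .
  qed
  ultimately show ?case by (intro exI[of _ s]) auto
qed

lemma poly_functions_insert:
  assumes "u \<in> poly_functions (insert y C)"
  obtains n q where "\<And>j. q j \<in> poly_functions C" "u = (\<lambda>p. \<Sum>j\<le>n. q j p * y p ^ j)"
proof -
  obtain G D where G: "finite G" "G \<subseteq> insert y C" "pdeg G D u"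
    using poly_functions_imp_pdeg[OF assms] by blast
  then have "pdeg (insert y C) D u" using pdeg_mono_coords by blast
  from pdeg_insert[OF this] that show ?thesis using pdeg_imp_poly_functions by metis
qed

lemma sum_PiE_insert:
  assumes "i \<notin> I" "finite I"
  shows "(\<Sum>\<alpha>\<in>PiE (insert i I) (\<lambda>_. A). g \<alpha>) = (\<Sum>e\<in>A. \<Sum>\<alpha>\<in>PiE I (\<lambda>_. A). g (\<alpha>(i := e)))"
proof -
  have inj: "inj_on (\<lambda>(y, f). f(i := y)) (A \<times> PiE I (\<lambda>_. A))"
    using inj_combinator[OF assms(1), of "\<lambda>_. A"] by simp
  show ?thesis
    unfolding PiE_insert_eq by (subst sum.reindex[OF inj]) (auto simp: sum.cartesian_product intro!:
      sum.cong)
qed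

section \<open>Linear independence of functions on a set\<close>

text \<open>The family is indexed, so a repeated function counts as a dependence. Evaluation on
  \<open>S\<close> only means independence modulo the functions that vanish on
  \<open>S\<close>.\<close>

definition indep_on :: "'a set \<Rightarrow> 'i set \<Rightarrow> ('i \<Rightarrow> 'a \<Rightarrow> complex) \<Rightarrow> bool" where
  "indep_on S I f \<longleftrightarrow> (\<forall>c. (\<forall>x\<in>S. (\<Sum>i\<in>I. c i * f i x) = 0) \<longrightarrow> (\<forall>i\<in>I. c i = 0))"

lemma indep_onD: "indep_on S I f \<Longrightarrow> (\<And>x. x \<in> S \<Longrightarrow> (\<Sum>i\<in>I. c i * f i x) = 0) \<Longrightarrow> i \<in> I \<Longrightarrow> c i = 0"
  unfolding indep_on_def by blast

lemma indep_on_mono: "indep_on S I f \<Longrightarrow> S \<subseteq> S' \<Longrightarrow> indep_on S' I f"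
  unfolding indep_on_def by blast

lemma indep_on_reindex:
  assumes "bij_betw h J I" "indep_on S I f"
  shows "indep_on S J (\<lambda>j. f (h j))"
  unfolding indep_on_def
proof (intro allI impI ballI)
  fix c j
  assume c: "\<forall>x\<in>S. (\<Sum>j\<in>J. c j * f (h j) x) = 0" and "j \<in> J"
  let ?g = "the_inv_into J h"
  have g: "?g (h j) = j" if "j \<in> J" for j
    using assms(1) that by (simp add: bij_betw_def the_inv_into_f_f)
  have "(\<Sum>i\<in>I. c (?g i) * f i x) = (\<Sum>j\<in>J. c j * f (h j) x)" for x
    by (subst sum.reindex_bij_betw[OF assms(1), symmetric]) (simp add: g)
  then have "c (?g (h j)) = 0"
    using indep_onD[OF assms(2), of "\<lambda>i. c (?g i)" "h j"] c \<open>j \<in> J\<close> bij_betwE[OF assms(1)] by auto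
  then show "c j = 0" using g \<open>j \<in> J\<close> by simp
qed

lemma homogeneous_system:
  fixes a :: "'i \<Rightarrow> nat \<Rightarrow> complex"
  assumes "finite I" "M < card I"
  shows "\<exists>c. (\<exists>i\<in>I. c i \<noteq> 0) \<and> (\<forall>k<M. (\<Sum>i\<in>I. c i * a i k) = 0)"
  using assms
proof (induction M arbitrary: I a)
  case 0
  then obtain i where "i \<in> I" by fastforce
  then show ?case by (intro exI[of _ "\<lambda>_. 1"]) auto
next
  case (Suc M)
  show ?case
  proof (cases "\<forall>i\<in>I. a i M = 0")
    case True
    from Suc.IH[of I a] Suc.prems obtain c where
      "\<exists>i\<in>I. c i \<noteq> 0" "\<forall>k<M. (\<Sum>i\<in>I. c i * a i k) = 0" by auto
    with True show ?thesis by (intro exI[of _ c]) (auto simp: less_Suc_eq)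
  next
    case False
    then obtain j where j: "j \<in> I" "a j M \<noteq> 0" by blast
    let ?J = "I - {j}"
    define b where "b = (\<lambda>i k. a i k - a i M / a j M * a j k)"
    have "M < card ?J" using Suc.prems j by simp
    with Suc.IH[of ?J b] Suc.prems obtain c where c: "\<exists>i\<in>?J. c i \<noteq> 0"
      "\<And>k. k < M \<Longrightarrow> (\<Sum>i\<in>?J. c i * b i k) = 0" by auto
    \<comment> \<open>The pivot coefficient is solved from equation \<open>M\<close>; substituting
      it turns the remaining equations into those with matrix \<open>b\<close>.\<close>
    define c' where "c' = c(j := - (\<Sum>i\<in>?J. c i * (a i M / a j M)))"
    have eq: "(\<Sum>i\<in>I. c' i * a i k) = (\<Sum>i\<in>?J. c i * b i k)" for k
    proof -
      have "(\<Sum>i\<in>I. c' i * a i k) = c' j * a j k + (\<Sum>i\<in>?J. c' i * a i k)"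
        using Suc.prems(1) j(1) by (rule sum.remove)
      also have "(\<Sum>i\<in>?J. c' i * a i k) = (\<Sum>i\<in>?J. c i * a i k)"
        by (intro sum.cong) (auto simp: c'_def)
      finally show ?thesis
        by (simp add: c'_def b_def right_diff_distrib sum_subtractf sum_distrib_right mult.assoc)
    qed
    have "(\<Sum>i\<in>I. c' i * a i k) = 0" if "k < Suc M" for k
      using that c(2) j(2) unfolding eq by (cases "k = M") (auto simp: b_def)
    moreover have "\<exists>i\<in>I. c' i \<noteq> 0" using c(1) by (auto simp: c'_def)
    ultimately show ?thesis by blast
  qed
qed

lemma indep_on_card_le:
  assumes "finite I" "indep_on S I f" and sp: "\<And>i. i \<in> I \<Longrightarrow> \<exists>c. \<forall>x\<in>S. f i x = (\<Sum>k<M. c k * g k x)"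
  shows "card I \<le> M"
proof (rule ccontr)
  assume "\<not> card I \<le> M"
  obtain a where a: "\<And>i x. i \<in> I \<Longrightarrow> x \<in> S \<Longrightarrow> f i x = (\<Sum>k<M. a i k * g k x)"
    using sp by metis
  obtain c where c: "\<exists>i\<in>I. c i \<noteq> 0" "\<And>k. k < M \<Longrightarrow> (\<Sum>i\<in>I. c i * a i k) = 0"
    using homogeneous_system[of I M a] assms(1) \<open>\<not> card I \<le> M\<close> by auto
  have "(\<Sum>i\<in>I. c i * f i x) = 0" if "x \<in> S" for x
  proof -
    have "(\<Sum>i\<in>I. c i * f i x) = (\<Sum>i\<in>I. \<Sum>k<M. c i * a i k * g k x)"
      by (intro sum.cong) (auto simp: a that sum_distrib_left mult.assoc)
    also have "\<dots> = (\<Sum>k<M. (\<Sum>i\<in>I. c i * a i k) * g k x)"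
      by (subst sum.swap) (simp add: sum_distrib_right)
    also have "\<dots> = 0" by (intro sum.neutral) (auto simp: c)
    finally show ?thesis .
  qed
  with assms(2) c(1) show False unfolding indep_on_def by blast
qed

lemma indep_on_card_le_set:
  assumes "finite I" "indep_on S I f" "finite K"
    and sp: "\<And>i. i \<in> I \<Longrightarrow> \<exists>c. \<forall>x\<in>S. f i x = (\<Sum>k\<in>K. c k * g k x)"
  shows "card I \<le> card K"
proof -
  obtain h where h: "bij_betw h {..<card K} K"
    using assms(3) bij_betw_from_nat_into_finite by blast
  show ?thesis
  proof (rule indep_on_card_le[OF assms(1,2), where g = "\<lambda>k. g (h k)"])
    fix i assume "i \<in> I"
    then obtain c where c: "\<forall>x\<in>S. f i x = (\<Sum>k\<in>K. c k * g k x)" using sp by blast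
    have "(\<Sum>k\<in>K. c k * g k x) = (\<Sum>k<card K. c (h k) * g (h k) x)" for x
      using sum.reindex_bij_betw[OF h, of "\<lambda>k. c k * g k x"] by simp
    with c show "\<exists>c. \<forall>x\<in>S. f i x = (\<Sum>k<card K. c k * g (h k) x)" by auto
  qed
qed

text \<open>An independent family of greatest length in \<open>V\<close> spans \<open>V\<close> on
  \<open>S\<close>: one more function forces a relation, and its last coefficient cannot
  vanish.\<close>

lemma bounded_indep_spans:
  fixes N :: nat
  assumes "\<And>n f. (\<forall>i<n. f i \<in> V) \<Longrightarrow> indep_on S {..<n} f \<Longrightarrow> n \<le> N"
  shows "\<exists>m g. m \<le> N \<and> (\<forall>f\<in>V. \<exists>c. \<forall>x\<in>S. f x = (\<Sum>k<m. c k * g k x))"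
proof -
  define P where "P = (\<lambda>n::nat. \<exists>f. (\<forall>i<n. f i \<in> V) \<and> indep_on S {..<n} f)"
  have "P 0" unfolding P_def indep_on_def by auto
  moreover have "\<forall>n. P n \<longrightarrow> n \<le> N" using assms unfolding P_def by blast
  ultimately obtain m where m: "P m" "\<And>n. P n \<Longrightarrow> n \<le> m"
    by (metis Nat.ex_has_greatest_nat)
  then obtain g where g: "\<forall>i<m. g i \<in> V" "indep_on S {..<m} g" unfolding P_def by blast
  have "\<exists>c. \<forall>x\<in>S. f x = (\<Sum>k<m. c k * g k x)" if "f \<in> V" for f
  proof -
    have "\<not> indep_on S {..<Suc m} (g(m := f))"
    proof
      assume "indep_on S {..<Suc m} (g(m := f))"
      then have "P (Suc m)" unfolding P_def using g(1) that
        by (intro exI[of _ "g(m := f)"]) (auto simp: less_Suc_eq)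
      then show False using m(2) by fastforce
    qed
    then obtain c where c: "\<And>x. x \<in> S \<Longrightarrow> (\<Sum>i<Suc m. c i * (g(m := f)) i x) = 0"
      "\<exists>i<Suc m. c i \<noteq> 0" unfolding indep_on_def by auto
    have c': "(\<Sum>i<m. c i * g i x) + c m * f x = 0" if "x \<in> S" for x
      using c(1)[OF that] by simp
    have "c m \<noteq> 0"
    proof
      assume "c m = 0"
      then have "\<forall>i<m. c i = 0" using c' g(2) unfolding indep_on_def by auto
      with \<open>c m = 0\<close> c(2) show False by (auto simp: less_Suc_eq)
    qed
    then have "f x = (\<Sum>k<m. (- c k / c m) * g k x)" if "x \<in> S" for x
      using c'[OF that] by (simp add: sum_negf sum_divide_distrib[symmetric] field_simps add_eq_0_iff2)
    then show ?thesis by (intro exI[of _ "\<lambda>k. - c k / c m"]) auto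
  qed
  moreover have "m \<le> N" using assms g by blast
  ultimately show ?thesis by blast
qed

section \<open>Irreducible closed sets and growth\<close>

text \<open>For a ring \<open>F\<close> this says that the functions vanishing on \<open>S\<close>
  form a prime ideal. Unlike irreducibility of a closed set it applies directly to images of
  parametrizations, which need not be closed.\<close>

definition prime_on :: "('a \<Rightarrow> complex) set \<Rightarrow> 'a set \<Rightarrow> bool" where
  "prime_on F S \<longleftrightarrow> S \<noteq> {} \<and> (\<forall>u\<in>F. \<forall>v\<in>F. (\<forall>x\<in>S. u x * v x = 0) \<longrightarrow> (\<forall>x\<in>S. u x = 0) \<or> (\<forall>x\<in>S. v x = 0))"

lemma prime_onD:
  "prime_on F S \<Longrightarrow> u \<in> F \<Longrightarrow> v \<in> F \<Longrightarrow> (\<And>x. x \<in> S \<Longrightarrow> u x * v x = 0) \<Longrightarrow> \<exists>x\<in>S. u x \<noteq> 0 \<Longrightarrow> x \<in> S \<Longrightarrow> v x = 0"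
  unfolding prime_on_def by blast

lemma prime_on_mono: "prime_on F S \<Longrightarrow> F' \<subseteq> F \<Longrightarrow> prime_on F' S"
  unfolding prime_on_def by blast

lemma prime_on_power:
  assumes "prime_on (poly_functions C) S" "u \<in> poly_functions C" "v \<in> poly_functions C"
    "\<And>x. x \<in> S \<Longrightarrow> u x ^ n * v x = 0" "\<exists>x\<in>S. u x \<noteq> 0" "x \<in> S"
  shows "v x = 0"
  using assms(4,6)
proof (induction n arbitrary: x)
  case (Suc n)
  have "u x ^ n * v x = 0" if "x \<in> S" for x
  proof (rule prime_onD[OF assms(1,2) _ _ assms(5) that])
    show "(\<lambda>x. u x ^ n * v x) \<in> poly_functions C"
      by (intro poly_functions.mult poly_functions_power assms)
    show "u x * (u x ^ n * v x) = 0" if "x \<in> S" for x using Suc.prems(1)[OF that] by simp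
  qed
  then show ?case using Suc.IH Suc.prems by blast
qed auto

lemma prime_on_prod:
  assumes "prime_on (poly_functions C) S" "finite I"
    "\<And>i. i \<in> I \<Longrightarrow> f i \<in> poly_functions C" "\<And>i. i \<in> I \<Longrightarrow> \<exists>x\<in>S. f i x \<noteq> 0"
  shows "\<exists>x\<in>S. (\<Prod>i\<in>I. f i x) \<noteq> 0"
  using assms(2,3,4)
proof (induction I rule: finite_induct)
  case empty
  then show ?case using assms(1) by (auto simp: prime_on_def)
next
  case (insert i I)
  show ?case
  proof (rule ccontr)
    assume "\<not> ?case"
    then have "f i x * (\<Prod>i\<in>I. f i x) = 0" if "x \<in> S" for x using insert.hyps that by auto
    then have "\<forall>x\<in>S. (\<Prod>i\<in>I. f i x) = 0"
      using prime_onD[OF assms(1), of "f i" "\<lambda>x. \<Prod>i\<in>I. f i x"] insert.prems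
      by (auto intro: poly_functions_prod)
    with insert show False by auto
  qed
qed

lemma closedin_zariski_add:
  assumes "closedin (zariski C W) Z" "u \<in> poly_functions C"
  shows "closedin (zariski C W) {p \<in> Z. u p = 0}"
proof -
  obtain E where "E \<subseteq> poly_functions C" "Z = {p \<in> W. \<forall>u\<in>E. u p = 0}"
    using assms(1) by (auto simp: closedin_zariski)
  then show ?thesis unfolding closedin_zariski using assms(2)
    by (intro exI[of _ "insert u E"]) auto
qed

lemma irreducible_closed_imp_prime_on:
  assumes "irreducible_closed (zariski C W) Z"
  shows "prime_on (poly_functions C) Z"
  unfolding prime_on_def
proof (intro conjI ballI impI)
  show "Z \<noteq> {}" using assms by (simp add: irreducible_closed_def)
  fix u v assume u: "u \<in> poly_functions C" and v: "v \<in> poly_functions C"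
    and uv: "\<forall>x\<in>Z. u x * v x = 0"
  let ?A = "{p \<in> Z. u p = 0}" and ?B = "{p \<in> Z. v p = 0}"
  have "closedin (zariski C W) ?A" "closedin (zariski C W) ?B"
    using assms u v by (auto simp: irreducible_closed_def intro: closedin_zariski_add)
  moreover have "Z = ?A \<union> ?B" using uv by auto
  ultimately have "Z = ?A \<or> Z = ?B" using assms unfolding irreducible_closed_def by blast
  then show "(\<forall>x\<in>Z. u x = 0) \<or> (\<forall>x\<in>Z. v x = 0)" by blast
qed

lemma prime_on_imp_irreducible_closed:
  assumes "closedin (zariski C W) Z" "prime_on (poly_functions C) Z"
  shows "irreducible_closed (zariski C W) Z"
  unfolding irreducible_closed_def
proof (intro conjI allI impI)
  show "closedin (zariski C W) Z" "Z \<noteq> {}" using assms by (auto simp: prime_on_def)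
  fix A B assume AB: "closedin (zariski C W) A \<and> closedin (zariski C W) B \<and> Z = A \<union> B"
  then obtain E F where E: "E \<subseteq> poly_functions C" "A = {p \<in> W. \<forall>u\<in>E. u p = 0}"
    and F: "F \<subseteq> poly_functions C" "B = {p \<in> W. \<forall>u\<in>F. u p = 0}"
    by (auto simp: closedin_zariski)
  show "Z = A \<or> Z = B"
  proof (rule ccontr)
    assume *: "\<not> (Z = A \<or> Z = B)"
    have "Z \<subseteq> W" using AB E F by auto
    obtain u x where u: "u \<in> E" "x \<in> Z" "u x \<noteq> 0" using * AB E \<open>Z \<subseteq> W\<close> by blast
    obtain v y where v: "v \<in> F" "y \<in> Z" "v y \<noteq> 0" using * AB F \<open>Z \<subseteq> W\<close> by blast
    have "u z * v z = 0" if "z \<in> Z" for z using that AB E F u v by auto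
    then show False using prime_onD[OF assms(2), of u v y] u v E F by blast
  qed
qed

definition zariski_closure :: "('a \<Rightarrow> complex) set \<Rightarrow> 'a set \<Rightarrow> 'a set \<Rightarrow> 'a set" where
  "zariski_closure C W S = {p \<in> W. \<forall>u\<in>poly_functions C. (\<forall>x\<in>S. u x = 0) \<longrightarrow> u p = 0}"

lemma closedin_zariski_closure: "closedin (zariski C W) (zariski_closure C W S)"
  unfolding closedin_zariski zariski_closure_def
  by (intro exI[of _ "{u \<in> poly_functions C. \<forall>x\<in>S. u x = 0}"]) auto

lemma subset_zariski_closure: "S \<subseteq> W \<Longrightarrow> S \<subseteq> zariski_closure C W S"
  unfolding zariski_closure_def by blast

lemma zariski_closure_mono: "S \<subseteq> T \<Longrightarrow> zariski_closure C W S \<subseteq> zariski_closure C W T"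
  unfolding zariski_closure_def by blast

lemma zariski_closure_zero:
  "u \<in> poly_functions C \<Longrightarrow> (\<And>x. x \<in> S \<Longrightarrow> u x = 0) \<Longrightarrow> p \<in> zariski_closure C W S \<Longrightarrow> u p = 0"
  unfolding zariski_closure_def by blast

lemma closure_of_zariski:
  assumes "S \<subseteq> W"
  shows "zariski C W closure_of S = zariski_closure C W S"
proof (rule closure_of_unique)
  show "S \<subseteq> zariski_closure C W S" by (rule subset_zariski_closure[OF assms])
  show "closedin (zariski C W) (zariski_closure C W S)" by (rule closedin_zariski_closure)
  fix T assume "S \<subseteq> T" "closedin (zariski C W) T"
  then obtain E where "E \<subseteq> poly_functions C" "T = {p \<in> W. \<forall>u\<in>E. u p = 0}"
    by (auto simp: closedin_zariski)
  with \<open>S \<subseteq> T\<close> show "zariski_closure C W S \<subseteq> T"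
    unfolding zariski_closure_def by blast
qed

lemma subtopology_zariski: "subtopology (zariski C W) Y = zariski C (W \<inter> Y)"
proof -
  have "openin (subtopology (zariski C W) Y) U \<longleftrightarrow> openin (zariski C (W \<inter> Y)) U" for U
  proof
    assume "openin (subtopology (zariski C W) Y) U"
    then obtain E where "E \<subseteq> poly_functions C" "U = {p \<in> W. \<exists>u\<in>E. u p \<noteq> 0} \<inter> Y"
      by (auto simp: openin_subtopology openin_zariski)
    then show "openin (zariski C (W \<inter> Y)) U" unfolding openin_zariski by (intro exI[of _ E]) auto
  next
    assume "openin (zariski C (W \<inter> Y)) U"
    then obtain E where E: "E \<subseteq> poly_functions C" "U = {p \<in> W \<inter> Y. \<exists>u\<in>E. u p \<noteq> 0}"
      by (auto simp: openin_zariski)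
    then have "U = {p \<in> W. \<exists>u\<in>E. u p \<noteq> 0} \<inter> Y" by auto
    moreover have "openin (zariski C W) {p \<in> W. \<exists>u\<in>E. u p \<noteq> 0}"
      using E(1) unfolding openin_zariski by blast
    ultimately show "openin (subtopology (zariski C W) Y) U" by (auto simp: openin_subtopology)
  qed
  then show ?thesis by (simp add: topology_eq)
qed

lemma prime_on_closure:
  assumes "prime_on (poly_functions C) S" "S \<subseteq> W"
  shows "prime_on (poly_functions C) (zariski_closure C W S)"
  unfolding prime_on_def
proof (intro conjI ballI impI)
  show "zariski_closure C W S \<noteq> {}"
    using assms(1) subset_zariski_closure[OF assms(2), of C] unfolding prime_on_def by blast
  fix u v assume u: "u \<in> poly_functions C" and v: "v \<in> poly_functions C"
    and uv: "\<forall>x\<in>zariski_closure C W S. u x * v x = 0"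
  have "u x * v x = 0" if "x \<in> S" for x
    using subset_zariski_closure[OF assms(2)] uv that by blast
  then consider "\<And>x. x \<in> S \<Longrightarrow> u x = 0" | "\<And>x. x \<in> S \<Longrightarrow> v x = 0"
    using prime_onD[OF assms(1) u v] by metis
  then show "(\<forall>x\<in>zariski_closure C W S. u x = 0) \<or> (\<forall>x\<in>zariski_closure C W S. v x = 0)"
  proof cases
    case 1
    then show ?thesis using zariski_closure_zero[OF u] by metis
  next
    case 2
    then show ?thesis using zariski_closure_zero[OF v] by metis
  qed
qed

section \<open>Growth of the functions on a set\<close>

text \<open>A polynomial bound for the affine Hilbert function of \<open>S\<close> in the
  coordinates \<open>G\<close>, phrased by the length of independent families.\<close>

definition growth_bound :: "nat \<Rightarrow> nat \<Rightarrow> 'a set \<Rightarrow> ('a \<Rightarrow> complex) set \<Rightarrow> bool" where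
  "growth_bound K b S G \<longleftrightarrow>
     (\<forall>D n f. (\<forall>i<n. pdeg G D (f i)) \<longrightarrow> indep_on S {..<n} f \<longrightarrow> n \<le> K * (D + 1) ^ b)"

text \<open>The constant \<open>K\<close> may depend on the finite part \<open>G\<close>, the
  exponent may not. The least such exponent is the Gelfand-Kirillov dimension of the ring of
  functions on \<open>S\<close>.\<close>

definition growth_le :: "nat \<Rightarrow> 'a set \<Rightarrow> ('a \<Rightarrow> complex) set \<Rightarrow> bool" where
  "growth_le b S C \<longleftrightarrow> (\<forall>G. finite G \<longrightarrow> G \<subseteq> C \<longrightarrow> (\<exists>K. growth_bound K b S G))"

lemma growth_boundD:
  assumes "growth_bound K b S G" "finite I" "\<And>i. i \<in> I \<Longrightarrow> pdeg G D (f i)" "indep_on S I f"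
  shows "card I \<le> K * (D + 1) ^ b"
proof -
  obtain h where h: "bij_betw h {..<card I} I" using assms(2) bij_betw_from_nat_into_finite by blast
  have "indep_on S {..<card I} (\<lambda>j. f (h j))" by (rule indep_on_reindex[OF h assms(4)])
  moreover have "\<forall>i<card I. pdeg G D (f (h i))" using assms(3) bij_betwE[OF h] by auto
  ultimately show ?thesis
    using assms(1)[unfolded growth_bound_def, rule_format, of "card I" D "\<lambda>j. f (h j)"] by simp
qed

lemma growth_leD: "growth_le b S C \<Longrightarrow> finite G \<Longrightarrow> G \<subseteq> C \<Longrightarrow> \<exists>K. growth_bound K b S G"
  unfolding growth_le_def by simp

lemma growth_bound_subset: "growth_bound K b S G \<Longrightarrow> S' \<subseteq> S \<Longrightarrow> growth_bound K b S' G"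
  unfolding growth_bound_def by (simp add: indep_on_mono)

lemma growth_le_subset: "growth_le b S C \<Longrightarrow> S' \<subseteq> S \<Longrightarrow> C' \<subseteq> C \<Longrightarrow> growth_le b S' C'"
  unfolding growth_le_def by (meson growth_bound_subset subset_trans)

text \<open>A linear relation that holds on \<open>S\<close> holds on its closure, so independence
  on the closure already shows on \<open>S\<close>.\<close>

lemma growth_le_closure:
  assumes "growth_le b S C" shows "growth_le b (zariski_closure C W S) C"
  unfolding growth_le_def
proof (intro allI impI)
  fix G assume G: "finite G" "G \<subseteq> C"
  obtain K where K: "growth_bound K b S G" using growth_leD[OF assms G] by blast
  have "growth_bound K b (zariski_closure C W S) G" unfolding growth_bound_def
  proof (intro allI impI)
    fix D and n :: nat and f
    assume f: "\<forall>i<n. pdeg G D (f i)" "indep_on (zariski_closure C W S) {..<n} f"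
    have "indep_on S {..<n} f" unfolding indep_on_def
    proof (intro allI impI)
      fix c assume c: "\<forall>x\<in>S. (\<Sum>i<n. c i * f i x) = 0"
      have "(\<lambda>x. \<Sum>i<n. c i * f i x) \<in> poly_functions C"
        using f(1) G by (intro poly_functions_sum poly_functions_scale)
          (auto intro: pdeg_imp_poly_functions pdeg_mono_coords)
      from zariski_closure_zero[OF this] c
      have "(\<Sum>i<n. c i * f i x) = 0" if "x \<in> zariski_closure C W S" for x
        using that by blast
      from indep_onD[OF f(2) this] show "\<forall>i\<in>{..<n}. c i = 0" by blast
    qed
    then show "n \<le> K * (D + 1) ^ b"
      using growth_boundD[OF K, of "{..<n}" D f] f(1) by simp
  qed
  then show "\<exists>K. growth_bound K b (zariski_closure C W S) G" by blast
qed

text \<open>Pulling back along \<open>\<Psi>\<close> multiplies degrees by at most a fixed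
  \<open>M\<close>, which changes the constant but not the exponent.\<close>

lemma growth_le_compose:
  assumes g: "growth_le b X P" and uP: "\<And>u. u \<in> C \<Longrightarrow> (\<lambda>x. u (\<Psi> x)) \<in> poly_functions P"
  shows "growth_le b (\<Psi> ` X) C"
  unfolding growth_le_def
proof (intro allI impI)
  fix G assume G: "finite G" "G \<subseteq> C"
  obtain H M where H: "finite H" "H \<subseteq> P" "\<forall>u\<in>G. pdeg H M (\<lambda>x. u (\<Psi> x))"
    using poly_functions_imp_pdeg_common[of G "\<lambda>u x. u (\<Psi> x)" P] G uP by blast
  have pd: "pdeg H (M * D) (\<lambda>x. f (\<Psi> x))" if "pdeg G D f" for D f
    using that
  proof (induction rule: pdeg.induct)
    case (coord u D)
    then show ?case using H(3) by (auto intro: pdeg_mono)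
  next
    case (mult D u E v F)
    show ?case
    proof (rule pdeg.mult[OF mult.IH])
      show "M * D + M * E \<le> M * F"
        using mult_le_mono2[OF mult.hyps(3), of M] by (simp add: add_mult_distrib2)
    qed
  qed (auto intro: pdeg.intros)
  obtain K where K: "growth_bound K b X H" using growth_leD[OF g H(1,2)] by blast
  have "growth_bound (K * (M + 1) ^ b) b (\<Psi> ` X) G" unfolding growth_bound_def
  proof (intro allI impI)
    fix D and n :: nat and f assume f: "\<forall>i<n. pdeg G D (f i)" "indep_on (\<Psi> ` X) {..<n} f"
    have "indep_on X {..<n} (\<lambda>i x. f i (\<Psi> x))" using f(2) unfolding indep_on_def by simp
    then have "n \<le> K * (M * D + 1) ^ b"
      using growth_boundD[OF K, of "{..<n}" "M * D" "\<lambda>i x. f i (\<Psi> x)"] f(1) pd by simp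
    also have "\<dots> \<le> K * ((M + 1) * (D + 1)) ^ b"
      by (intro mult_le_mono2 power_mono) simp_all
    also have "\<dots> = K * (M + 1) ^ b * (D + 1) ^ b"
      by (simp only: power_mult_distrib mult.assoc)
    finally show "n \<le> K * (M + 1) ^ b * (D + 1) ^ b" .
  qed
  then show "\<exists>K. growth_bound K b (\<Psi> ` X) G" by blast
qed

lemma growth_le_contra:
  fixes I :: "nat \<Rightarrow> 'i set"
  assumes "growth_le b S C" "finite G" "G \<subseteq> C" "b < b'"
    and I: "\<And>D. finite (I D)" "\<And>D i. i \<in> I D \<Longrightarrow> pdeg G (M * D) (f D i)"
    "\<And>D. indep_on S (I D) (f D)" "\<And>D. card (I D) \<ge> (D + 1) ^ b'"
  shows False
proof -
  obtain K where K: "growth_bound K b S G" using growth_leD[OF assms(1-3)] by blast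
  \<comment> \<open>With this value the estimates below end in
    \<open>(D + 1) * (D + 1) ^ b \<le> D * (D + 1) ^ b\<close>.\<close>
  define D where "D = K * (M + 1) ^ b"
  have "(D + 1) * (D + 1) ^ b \<le> (D + 1) ^ b'"
    using assms(4) power_increasing[of "Suc b" b' "D + 1"] by simp
  also have "\<dots> \<le> card (I D)" by (rule I)
  also have "\<dots> \<le> K * (M * D + 1) ^ b" by (rule growth_boundD[OF K I(1) I(2) I(3)])
  also have "\<dots> \<le> K * ((M + 1) * (D + 1)) ^ b"
    by (intro mult_le_mono2 power_mono) simp_all
  also have "\<dots> = D * (D + 1) ^ b" by (simp only: power_mult_distrib D_def mult.assoc)
  finally show False by simp
qed

text \<open>On \<open>Z\<close> only the layer \<open>j = 0\<close> survives, so its coefficients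
  vanish by independence there. Primality on \<open>Z'\<close> then allows division by
  \<open>u\<close>, and the next layer takes its place.\<close>

lemma indep_on_powers:
  assumes Z: "prime_on (poly_functions C) Z'" "Z \<subseteq> Z'"
    and u: "u \<in> poly_functions C" "\<And>x. x \<in> Z \<Longrightarrow> u x = 0" "\<exists>x\<in>Z'. u x \<noteq> 0"
    and f: "\<And>i. i \<in> I \<Longrightarrow> f i \<in> poly_functions C" "indep_on Z I f"
    and eq: "\<And>x. x \<in> Z' \<Longrightarrow> (\<Sum>j\<le>D. u x ^ j * (\<Sum>i\<in>I. c j i * f i x)) = 0"
    and "j \<le> D" "i \<in> I"
  shows "c j i = 0"
  using eq \<open>j \<le> D\<close>
proof (induction D arbitrary: c j)
  case 0
  then show ?case using indep_onD[OF f(2), of "c 0" i] Z(2) \<open>i \<in> I\<close> by auto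
next
  case (Suc D)
  have eq: "(\<Sum>i\<in>I. c 0 i * f i x) + u x * (\<Sum>j\<le>D. u x ^ j * (\<Sum>i\<in>I. c (Suc j) i * f i x)) = 0"
    if "x \<in> Z'" for x
    using Suc.prems(1)[OF that] by (simp add: sum.atMost_Suc_shift sum_distrib_left mult.assoc del:
      sum.atMost_Suc)
  have "(\<Sum>i\<in>I. c 0 i * f i x) = 0" if "x \<in> Z" for x
    using eq[of x] u(2)[OF that] that Z(2) by auto
  then have c0: "c 0 i = 0" if "i \<in> I" for i
    using indep_onD[OF f(2), of "c 0"] that by blast
  have "(\<Sum>j\<le>D. u x ^ j * (\<Sum>i\<in>I. c (Suc j) i * f i x)) = 0" if "x \<in> Z'" for x
  proof (rule prime_onD[OF Z(1) u(1) _ _ u(3) that])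
    show "(\<lambda>x. \<Sum>j\<le>D. u x ^ j * (\<Sum>i\<in>I. c (Suc j) i * f i x)) \<in> poly_functions C"
      by (intro poly_functions_sum poly_functions.mult[OF poly_functions_power] poly_functions_scale u
        f)
    show "u x * (\<Sum>j\<le>D. u x ^ j * (\<Sum>i\<in>I. c (Suc j) i * f i x)) = 0" if "x \<in> Z'" for x
      using eq[OF that] c0 by simp
  qed
  then have "c (Suc j) i = 0" if "j \<le> D" for j using Suc.IH[of "\<lambda>j. c (Suc j)"] that by blast
  then show ?case using c0 \<open>i \<in> I\<close> Suc.prems(2) by (cases j) auto
qed

text \<open>A family of \<open>n\<close> functions independent on \<open>Z\<close> yields
  \<open>(D + 1) * n\<close> functions independent on \<open>Z'\<close> whose degree is still linear
  in \<open>D\<close>; this extra factor \<open>D + 1\<close> costs one exponent.\<close>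

lemma growth_le_proper_subset:
  assumes Z: "prime_on (poly_functions C) Z'" "Z \<subseteq> Z'" "Z \<noteq> {}"
    and u: "u \<in> poly_functions C" "\<And>x. x \<in> Z \<Longrightarrow> u x = 0" "\<exists>x\<in>Z'. u x \<noteq> 0"
    and g: "growth_le b Z' C"
  shows "\<exists>b'. b = Suc b' \<and> growth_le b' Z C"
proof -
  have key: "\<exists>K. \<forall>D n f. (\<forall>i<n. pdeg G D (f i)) \<longrightarrow> indep_on Z {..<n} f \<longrightarrow> (D + 1) * n \<le> K * (D + 1) ^ b"
    if G: "finite G" "G \<subseteq> C" for G
  proof -
    obtain H e where H: "finite H" "H \<subseteq> C" "pdeg H e u" using poly_functions_imp_pdeg[OF u(1)] by blast
    obtain K where K: "growth_bound K b Z' (G \<union> H)"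
      using growth_leD[OF g, of "G \<union> H"] G H by blast
    have "(D + 1) * n \<le> K * (e + 1) ^ b * (D + 1) ^ b"
      if f: "\<forall>i<n. pdeg G D (f i)" "indep_on Z {..<n} f" for D n f
    proof -
      let ?I = "{..D} \<times> {..<n}"
      have "card ?I \<le> K * ((D * e + D) + 1) ^ b"
      proof (rule growth_boundD[OF K])
        show "pdeg (G \<union> H) (D * e + D) ((\<lambda>(j, i) x. u x ^ j * f i x) ji)" if "ji \<in> ?I" for ji
        proof -
          from that obtain j i where ji: "ji = (j, i)" "j \<le> D" "i < n" by auto
          have "pdeg (G \<union> H) (j * e) (\<lambda>x. u x ^ j)" "pdeg (G \<union> H) D (f i)"
            using f(1) H(3) ji by (auto intro: pdeg_power pdeg_mono_coords)
          then show ?thesis using ji by (auto intro!: pdeg.mult)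
        qed
        show "indep_on Z' ?I (\<lambda>(j, i) x. u x ^ j * f i x)" unfolding indep_on_def
        proof (intro allI impI ballI)
          fix c ji assume c: "\<forall>x\<in>Z'. (\<Sum>k\<in>?I. c k * (\<lambda>(j, i) x. u x ^ j * f i x) k x) = 0" and ji:
            "ji \<in> ?I"
          have fC: "f i \<in> poly_functions C" if "i \<in> {..<n}" for i
            using f(1) that G(2) pdeg_imp_poly_functions poly_functions_mono by blast
          have "(\<Sum>j\<le>D. u x ^ j * (\<Sum>i<n. c (j, i) * f i x)) = 0" if "x \<in> Z'" for x
          proof -
            have "(\<Sum>j\<le>D. u x ^ j * (\<Sum>i<n. c (j, i) * f i x)) =
                (\<Sum>j\<le>D. \<Sum>i<n. c (j, i) * (u x ^ j * f i x))"
              by (simp add: sum_distrib_left mult_ac)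
            also have "\<dots> = (\<Sum>k\<in>?I. c k * (\<lambda>(j, i) x. u x ^ j * f i x) k x)"
              unfolding sum.cartesian_product by (intro sum.cong) auto
            finally show ?thesis using c[rule_format, OF that] by simp
          qed
          from indep_on_powers[OF Z(1,2) u fC f(2) this] ji show "c ji = 0" by auto
        qed
      qed auto
      also have "\<dots> \<le> K * ((e + 1) * (D + 1)) ^ b" by (intro mult_le_mono2 power_mono) simp_all
      also have "\<dots> = K * (e + 1) ^ b * (D + 1) ^ b" by (simp only: power_mult_distrib mult.assoc)
      finally show ?thesis by simp
    qed
    then show ?thesis by blast
  qed
  show ?thesis
  proof (cases b)
    case 0
    obtain K where K: "\<forall>D n f. (\<forall>i<n. pdeg {} D (f i)) \<longrightarrow> indep_on Z {..<n} f \<longrightarrow>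
      (D + 1) * n \<le> K * (D + 1) ^ b"
      using key[of "{}"] by auto
    \<comment> \<open>Exponent 0 is impossible: the constant 1 alone, taken with
      \<open>D = K\<close>, would give \<open>K + 1 \<le> K\<close>.\<close>
    have "indep_on Z {..<Suc 0} (\<lambda>_ _. 1)" using Z(3) by (auto simp: indep_on_def)
    then have "(K + 1) * Suc 0 \<le> K * (K + 1) ^ b"
      using K[rule_format, of "Suc 0" K "\<lambda>_ _. 1"] by (auto intro: pdeg.const)
    then show ?thesis using 0 by simp
  next
    case (Suc b')
    have "growth_le b' Z C" unfolding growth_le_def
    proof (intro allI impI)
      fix G assume "finite G" "G \<subseteq> C"
      from key[OF this] obtain K where
        K: "\<forall>D n f. (\<forall>i<n. pdeg G D (f i)) \<longrightarrow> indep_on Z {..<n} f \<longrightarrow> (D + 1) * n \<le> K * (D + 1) ^ b" ..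
      have "growth_bound K b' Z G" unfolding growth_bound_def
      proof (intro allI impI)
        fix D and n :: nat and f assume "\<forall>i<n. pdeg G D (f i)" "indep_on Z {..<n} f"
        then have "(D + 1) * n \<le> (D + 1) * (K * (D + 1) ^ b')"
          using K[rule_format, of n D f] by (simp add: Suc algebra_simps)
        then show "n \<le> K * (D + 1) ^ b'" by (simp del: add_mult_distrib mult_Suc)
      qed
      then show "\<exists>K. growth_bound K b' Z G" by blast
    qed
    with Suc show ?thesis by blast
  qed
qed

lemma irreducible_closed_subset: "irreducible_closed (zariski C W) Z \<Longrightarrow> Z \<subseteq> W"
  using closedin_subset[of "zariski C W" Z] by (simp add: irreducible_closed_def)

text \<open>Going down from the top of the chain, every proper inclusion lowers the growth exponent
  by one.\<close>

lemma irreducible_chain_length_le: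
  assumes "\<And>i. i \<le> r \<Longrightarrow> irreducible_closed (zariski C W) (Z i)" "\<And>i. i < r \<Longrightarrow> Z i \<subset> Z (Suc i)"
    "growth_le b (Z r) C"
  shows "r \<le> b"
  using assms
proof (induction r arbitrary: b)
  case (Suc r)
  have irr: "irreducible_closed (zariski C W) (Z r)" "irreducible_closed (zariski C W) (Z (Suc r))"
    using Suc.prems(1) by auto
  obtain E where E: "E \<subseteq> poly_functions C" "Z r = {p \<in> W. \<forall>u\<in>E. u p = 0}"
    using irr(1) by (auto simp: irreducible_closed_def closedin_zariski)
  have "Z (Suc r) \<subseteq> W" using irr(2) by (auto simp: irreducible_closed_def closedin_zariski)
  moreover obtain x where x: "x \<in> Z (Suc r)" "x \<notin> Z r" using Suc.prems(2)[of r] by auto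
  ultimately obtain u where u: "u \<in> E" "u x \<noteq> 0" using E by blast
  have "Z r \<noteq> {}" "Z r \<subseteq> Z (Suc r)" using irr(1) Suc.prems(2)[of r]
    by (auto simp: irreducible_closed_def)
  then obtain b' where "b = Suc b'" "growth_le b' (Z r) C"
    using growth_le_proper_subset[OF irreducible_closed_imp_prime_on[OF irr(2)], of "Z r" u b]
      u x E Suc.prems(3) by auto
  then show ?case using Suc.IH[of b'] Suc.prems(1,2) by simp
qed simp

lemma krull_dim_leI:
  assumes "\<And>r Z. (\<And>i. i \<le> r \<Longrightarrow> irreducible_closed X (Z i)) \<Longrightarrow> (\<And>i. i < r \<Longrightarrow> Z i \<subset> Z (Suc i)) \<Longrightarrow> r \<le> b"
  shows "krull_dim X \<le> ereal (real b)"
  unfolding krull_dim_def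
proof (rule Sup_least, elim CollectE exE conjE)
  fix d r Z assume "d = ereal (real r)" "\<forall>i\<le>r. irreducible_closed X (Z i)" "\<forall>i<r. Z i \<subset> Z (Suc i)"
  with assms[of r Z] show "d \<le> ereal (real b)" by simp
qed

lemma krull_dim_zariski_le:
  assumes "growth_le b W C"
  shows "krull_dim (zariski C W) \<le> ereal (real b)"
proof (rule krull_dim_leI)
  fix r Z assume Z: "\<And>i. i \<le> r \<Longrightarrow> irreducible_closed (zariski C W) (Z i)" "\<And>i. i < r \<Longrightarrow> Z i \<subset> Z (Suc i)"
  have "Z r \<subseteq> W" by (rule irreducible_closed_subset[OF Z(1)]) simp
  then have "growth_le b (Z r) C" using growth_le_subset[OF assms] by blast
  with irreducible_chain_length_le[of r C W Z b] Z show "r \<le> b" by simp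
qed

section \<open>Adjoining an algebraic function\<close>

text \<open>The relation is not monic, so \<open>y ^ j\<close> can be reduced below degree
  \<open>E\<close> only after multiplication by \<open>q E ^ j\<close>. A function of degree
  \<open>D\<close> is therefore multiplied by \<open>q E ^ D\<close>, which preserves independence
  since \<open>Z\<close> is prime and \<open>q E\<close> does not vanish on it. The result lies in
  the span of \<open>E\<close> copies of a space of functions in \<open>F\<close> of degree linear
  in \<open>D\<close>.\<close>

lemma growth_le_insert_algebraic:
  assumes g: "growth_le b Z F" and pr: "prime_on (poly_functions (insert y F)) Z"
    and q: "\<And>e. e \<le> E \<Longrightarrow> q e \<in> poly_functions F" "\<And>x. x \<in> Z \<Longrightarrow> (\<Sum>e\<le>E. q e x * y x ^ e) = 0"
      "\<exists>x\<in>Z. q E x \<noteq> 0"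
  shows "growth_le b Z (insert y F)"
proof -
  obtain E' where E': "E = Suc E'" using q(2,3) by (cases E) auto
  have top: "q E x * y x ^ E = - (\<Sum>e<E. q e x * y x ^ e)" if "x \<in> Z" for x
    using q(2)[OF that] by (simp add: E' lessThan_Suc_atMost eq_neg_iff_add_eq_0 add.commute)
  have "\<exists>K. growth_bound K b Z G" if G: "finite G" "G \<subseteq> insert y F" for G
  proof -
    obtain H M where H: "finite H" "H \<subseteq> F" "\<forall>e\<in>{..E}. pdeg H M (q e)"
      using poly_functions_imp_pdeg_common[of "{..E}" q F] q(1) by auto
    define F1 where "F1 = G - {y} \<union> H"
    have F1: "finite F1" "F1 \<subseteq> F" "G \<subseteq> insert y F1" "H \<subseteq> F1" using G H by (auto simp: F1_def)
    have qd: "pdeg F1 M (q e)" if "e \<le> E" for e using H(3) F1(4) pdeg_mono_coords that by blast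
    have red: "\<exists>r. (\<forall>e. pdeg F1 (j * M) (r e)) \<and> (\<forall>x\<in>Z. q E x ^ j * y x ^ j =
      (\<Sum>e<E. r e x * y x ^ e))" for j
    proof (induction j)
      case 0
      have "(\<Sum>e<E. (if e = 0 then 1 else 0) * y x ^ e) = 1" for x
        by (subst sum.mono_neutral_right[of _ "{0}"]) (auto simp: E')
      then show ?case by (intro exI[of _ "\<lambda>e _. if e = 0 then 1 else 0"]) (auto intro: pdeg.const)
    next
      case (Suc j)
      then obtain r where r: "\<And>e. pdeg F1 (j * M) (r e)"
        "\<And>x. x \<in> Z \<Longrightarrow> q E x ^ j * y x ^ j = (\<Sum>e<E. r e x * y x ^ e)" by blast
      \<comment> \<open>Multiplying the reduced form of \<open>y ^ j\<close> by
        \<open>q E * y\<close> shifts its coefficients up by one; the overflow at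
        \<open>y ^ E\<close> is replaced by lower powers through the relation.\<close>
      define s where "s = (\<lambda>e x. (case e of 0 \<Rightarrow> 0 | Suc e' \<Rightarrow> q E x * r e' x)
        - (if e \<le> E then q e x * r E' x else 0))"
      have "pdeg F1 (Suc j * M) (s e)" for e
        unfolding s_def by (intro pdeg_diff; cases e; cases "e \<le> E")
          (auto intro!: pdeg.const pdeg.mult[OF qd r(1)])
      moreover have "q E x ^ Suc j * y x ^ Suc j = (\<Sum>e<E. s e x * y x ^ e)" if x: "x \<in> Z" for x
      proof -
        have "q E x ^ Suc j * y x ^ Suc j = q E x * y x * (\<Sum>e<E. r e x * y x ^ e)"
          using r(2)[OF x] by (simp add: mult_ac)
        also have "\<dots> = (\<Sum>e<E'. q E x * r e x * y x ^ Suc e) + r E' x * (q E x * y x ^ E)"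
          by (simp add: E' sum_distrib_left algebra_simps)
        also have "\<dots> = (\<Sum>e<E'. q E x * r e x * y x ^ Suc e) - (\<Sum>e<E. q e x * r E' x * y x ^ e)"
          by (simp add: top[OF x] sum_distrib_left mult_ac)
        also have "(\<Sum>e<E'. q E x * r e x * y x ^ Suc e) =
          (\<Sum>e<E. (case e of 0 \<Rightarrow> 0 | Suc e' \<Rightarrow> q E x * r e' x) * y x ^ e)"
          unfolding E' by (subst sum.lessThan_Suc_shift) simp
        finally show ?thesis by (simp add: s_def sum_subtractf left_diff_distrib)
      qed
      ultimately show ?case by blast
    qed
    then obtain r where r: "\<And>j e. pdeg F1 (j * M) (r j e)"
      "\<And>j x. x \<in> Z \<Longrightarrow> q E x ^ j * y x ^ j = (\<Sum>e<E. r j e x * y x ^ e)" by metis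
    obtain K where K: "growth_bound K b Z F1" using growth_leD[OF g F1(1,2)] by blast
    have "growth_bound (E * K * (M + 1) ^ b) b Z G" unfolding growth_bound_def
    proof (intro allI impI)
      fix D and n :: nat and f assume f: "\<forall>i<n. pdeg G D (f i)" "indep_on Z {..<n} f"
      let ?M = "(M + 1) * D"
      have "\<exists>m g. m \<le> K * (?M + 1) ^ b \<and> (\<forall>f\<in>{u. pdeg F1 ?M u}. \<exists>c. \<forall>x\<in>Z. f x = (\<Sum>k<m. c k * g k x))"
      proof (rule bounded_indep_spans)
        fix n :: nat and f assume "\<forall>i<n. f i \<in> {u. pdeg F1 ?M u}" "indep_on Z {..<n} f"
        then show "n \<le> K * (?M + 1) ^ b" using K unfolding growth_bound_def mem_Collect_eq by blast
      qed
      then obtain m g where m: "m \<le> K * (?M + 1) ^ b"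
        and g: "\<forall>f\<in>{u. pdeg F1 ?M u}. \<exists>c. \<forall>x\<in>Z. f x = (\<Sum>k<m. c k * g k x)"
        by blast
      have fC: "f i \<in> poly_functions (insert y F)" if "i < n" for i
        using f(1) that G(2) pdeg_imp_poly_functions poly_functions_mono by blast
      have qC: "q E \<in> poly_functions (insert y F)" using q(1)[of E] poly_functions_mono by blast
      have "card {..<n} \<le> card ({..<m} \<times> {..<E})"
      proof (rule indep_on_card_le_set)
        show "indep_on Z {..<n} (\<lambda>i x. q E x ^ D * f i x)" unfolding indep_on_def
        proof (intro allI impI)
          fix c assume c: "\<forall>x\<in>Z. (\<Sum>i<n. c i * (q E x ^ D * f i x)) = 0"
          have "(\<Sum>i<n. c i * f i x) = 0" if "x \<in> Z" for x
          proof (rule prime_on_power[OF pr qC _ _ q(3) that])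
            show "(\<lambda>x. \<Sum>i<n. c i * f i x) \<in> poly_functions (insert y F)"
              by (intro poly_functions_sum poly_functions_scale fC) simp
            show "q E x ^ D * (\<Sum>i<n. c i * f i x) = 0" if "x \<in> Z" for x
              using c that by (simp add: sum_distrib_left mult_ac)
          qed
          from indep_onD[OF f(2) this] show "\<forall>i\<in>{..<n}. c i = 0" by blast
        qed
        fix i assume "i \<in> {..<n}"
        then have "pdeg (insert y F1) D (f i)" using f(1) F1(3) pdeg_mono_coords by blast
        then obtain p where p: "\<And>j. pdeg F1 D (p j)" "f i = (\<lambda>x. \<Sum>j\<le>D. p j x * y x ^ j)"
          using pdeg_insert by blast
        \<comment> \<open>\<open>w e\<close> is the coefficient of \<open>y ^ e\<close> in
          \<open>q E ^ D * f i\<close> after reduction: of the \<open>D\<close> factors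
          \<open>q E\<close>, the term with \<open>y ^ j\<close> uses up \<open>j\<close> and keeps
          \<open>D - j\<close>.\<close>
        define w where "w = (\<lambda>e x. \<Sum>j\<le>D. (p j x * q E x ^ (D - j)) * r j e x)"
        have "pdeg F1 ?M (w e)" for e unfolding w_def
        proof (intro pdeg_sum)
          fix j assume "j \<in> {..D}"
          then have j: "j \<le> D" by simp
          have "pdeg F1 (D + (D - j) * M) (\<lambda>x. p j x * q E x ^ (D - j))"
            by (rule pdeg.mult[OF p(1) pdeg_power[OF qd]]) simp_all
          then show "pdeg F1 ?M (\<lambda>x. (p j x * q E x ^ (D - j)) * r j e x)"
          proof (rule pdeg.mult[OF _ r(1)])
            have "(D - j) * M + j * M = D * M" using j by (simp add: add_mult_distrib[symmetric])
            then show "D + (D - j) * M + j * M \<le> ?M" by simp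
          qed
        qed
        then have "\<exists>c. \<forall>x\<in>Z. w e x = (\<Sum>k<m. c k * g k x)" for e using g by simp
        then obtain c where c: "\<And>e x. x \<in> Z \<Longrightarrow> w e x = (\<Sum>k<m. c e k * g k x)" by metis
        have "q E x ^ D * f i x = (\<Sum>ke\<in>{..<m} \<times> {..<E}. c (snd ke) (fst ke) * (g (fst ke) x * y x ^
          snd ke))"
          if x: "x \<in> Z" for x
        proof -
          have "q E x ^ D * f i x = (\<Sum>j\<le>D. p j x * q E x ^ (D - j) * (q E x ^ j * y x ^ j))"
            unfolding p(2) sum_distrib_left
            by (intro sum.cong) (auto simp: mult_ac power_add[symmetric])
          also have "\<dots> = (\<Sum>j\<le>D. \<Sum>e<E. p j x * q E x ^ (D - j) * r j e x * y x ^ e)"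
            by (simp only: r(2)[OF x] sum_distrib_left mult.assoc)
          also have "\<dots> = (\<Sum>e<E. w e x * y x ^ e)"
            by (subst sum.swap) (simp add: w_def sum_distrib_right)
          also have "\<dots> = (\<Sum>e<E. \<Sum>k<m. c e k * (g k x * y x ^ e))"
            by (simp only: c[OF x] sum_distrib_right mult.assoc)
          also have "\<dots> = (\<Sum>ke\<in>{..<m} \<times> {..<E}. c (snd ke) (fst ke) * (g (fst ke) x * y x ^ snd ke))"
            by (subst sum.swap) (simp add: sum.cartesian_product split_def)
          finally show ?thesis .
        qed
        then show "\<exists>c. \<forall>x\<in>Z. q E x ^ D * f i x =
          (\<Sum>ke\<in>{..<m} \<times> {..<E}. c ke * (g (fst ke) x * y x ^ snd ke))"
          by (intro exI[of _ "\<lambda>ke. c (snd ke) (fst ke)"]) simp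
      qed auto
      then have "n \<le> E * m" by (simp add: mult.commute)
      also have "\<dots> \<le> E * (K * ((M + 1) * D + 1) ^ b)" using m by (rule mult_le_mono2)
      also have "\<dots> \<le> E * (K * ((M + 1) * (D + 1)) ^ b)"
        by (intro mult_le_mono2 power_mono) simp_all
      also have "\<dots> = E * K * (M + 1) ^ b * (D + 1) ^ b" by (simp only: power_mult_distrib mult.assoc)
      finally show "n \<le> E * K * (M + 1) ^ b * (D + 1) ^ b" .
    qed
    then show ?thesis by blast
  qed
  then show ?thesis unfolding growth_le_def by blast
qed

section \<open>Algebraic dependence\<close>

definition mon :: "'i set \<Rightarrow> ('i \<Rightarrow> 'a \<Rightarrow> complex) \<Rightarrow> ('i \<Rightarrow> nat) \<Rightarrow> 'a \<Rightarrow> complex" where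
  "mon I u \<alpha> x = (\<Prod>i\<in>I. u i x ^ \<alpha> i)"

text \<open>Exponents range over boxes instead of a bounded total degree: boxes split off one
  variable at a time and have exactly \<open>(D + 1) ^ card I\<close> elements. The extensional
  functions in \<open>PiE\<close> count every monomial once.\<close>

definition algindep :: "'a set \<Rightarrow> 'i set \<Rightarrow> ('i \<Rightarrow> 'a \<Rightarrow> complex) \<Rightarrow> bool" where
  "algindep S I u \<longleftrightarrow> (\<forall>D. indep_on S (PiE I (\<lambda>_. {..D})) (mon I u))"

lemma algindepD:
  assumes "algindep S I u" "\<And>x. x \<in> S \<Longrightarrow> (\<Sum>\<alpha>\<in>PiE I (\<lambda>_. {..D}). c \<alpha> * mon I u \<alpha> x) = 0"
    "\<beta> \<in> PiE I (\<lambda>_. {..D})"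
  shows "c \<beta> = 0"
  using assms unfolding algindep_def indep_on_def by blast

lemma mon_insert_upd:
  assumes "i \<notin> I" "finite I"
  shows "mon (insert i I) u (\<alpha>(i := e)) x = u i x ^ e * mon I u \<alpha> x"
proof -
  have "(\<Prod>j\<in>I. u j x ^ (\<alpha>(i := e)) j) = (\<Prod>j\<in>I. u j x ^ \<alpha> j)"
    using assms by (intro prod.cong) auto
  then show ?thesis using assms by (simp add: mon_def)
qed

lemma mon_poly_functions: "(\<And>i. i \<in> I \<Longrightarrow> u i \<in> poly_functions C) \<Longrightarrow> mon I u \<alpha> \<in> poly_functions C"
  unfolding mon_def[abs_def] by (intro poly_functions_prod poly_functions_power)

lemma pdeg_mon:
  assumes "finite I" "\<And>i. i \<in> I \<Longrightarrow> pdeg G M (u i)" "\<alpha> \<in> PiE I (\<lambda>_. {..D})"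
  shows "pdeg G (card I * (D * M)) (mon I u \<alpha>)"
  unfolding mon_def[abs_def]
proof (rule pdeg_prod[OF assms(1)])
  fix i assume "i \<in> I"
  then show "pdeg G (D * M) (\<lambda>x. u i x ^ \<alpha> i)"
    using assms by (intro pdeg_mono[OF pdeg_power[of G M "u i" "\<alpha> i"]]) (auto simp: PiE_iff)
qed

lemma algindep_mono: "algindep S I u \<Longrightarrow> S \<subseteq> S' \<Longrightarrow> algindep S' I u"
  unfolding algindep_def using indep_on_mono by blast

lemma algindep_empty: "S \<noteq> {} \<Longrightarrow> algindep S {} u"
  by (auto simp: algindep_def indep_on_def mon_def)

lemma algindep_image: "algindep (h ` S) I u \<longleftrightarrow> algindep S I (\<lambda>i x. u i (h x))"
  by (simp add: algindep_def indep_on_def mon_def)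

lemma card_box: "finite I \<Longrightarrow> card (PiE I (\<lambda>_. {..D::nat})) = (D + 1) ^ card I"
  by (simp add: card_PiE)

lemma finite_box: "finite I \<Longrightarrow> finite (PiE I (\<lambda>_. {..D::nat}))"
  by (rule finite_PiE) auto

lemma pdeg_span_mon:
  assumes "finite B" "pdeg B D u"
  shows "\<exists>c. \<forall>x. u x = (\<Sum>\<alpha>\<in>PiE B (\<lambda>_. {..D}). c \<alpha> * mon B (\<lambda>b. b) \<alpha> x)"
  using assms
proof (induction B arbitrary: u rule: finite_induct)
  case empty
  have "\<exists>c. \<forall>x. u x = c" using empty by (induction rule: pdeg.induct) auto
  then obtain c where "\<forall>x. u x = c" by blast
  then show ?case by (intro exI[of _ "\<lambda>_. c"]) (simp add: mon_def)
next
  case (insert y B)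
  obtain q where q: "\<And>j. pdeg B D (q j)" "u = (\<lambda>p. \<Sum>j\<le>D. q j p * y p ^ j)"
    using pdeg_insert[OF insert.prems] by blast
  have "\<forall>j. \<exists>c. \<forall>x. q j x = (\<Sum>\<alpha>\<in>PiE B (\<lambda>_. {..D}). c \<alpha> * mon B (\<lambda>b. b) \<alpha> x)"
    using insert.IH[OF q(1)] by blast
  then obtain c where c: "\<And>j x. q j x = (\<Sum>\<alpha>\<in>PiE B (\<lambda>_. {..D}). c j \<alpha> * mon B (\<lambda>b. b) \<alpha> x)" by metis
  \<comment> \<open>Resetting the exponent at \<open>y\<close> to \<open>undefined\<close> recovers
    the exponent function on \<open>B\<close>, which indexes the coefficients of
    \<open>q j\<close>.\<close>
  have "u x = (\<Sum>\<alpha>\<in>PiE (insert y B) (\<lambda>_. {..D}). c (\<alpha> y) (\<alpha>(y := undefined)) * mon (insert y B) (\<lambda>b. b)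
    \<alpha> x)" for x
  proof -
    have "(\<alpha>(y := j))(y := undefined) = \<alpha>" if "\<alpha> \<in> PiE B (\<lambda>_. {..D})" for \<alpha> j
      using that insert.hyps(2) by (auto simp: PiE_iff extensional_def)
    then show ?thesis
      unfolding sum_PiE_insert[OF insert.hyps(2,1)] mon_insert_upd[OF insert.hyps(2,1)] q(2) c
        sum_distrib_right
      by (intro sum.cong) (auto simp: mult_ac)
  qed
  then show ?case by (intro exI[of _ "\<lambda>\<alpha>. c (\<alpha> y) (\<alpha>(y := undefined))"]) simp
qed

lemma growth_le_card:
  assumes "finite B"
  shows "growth_le (card B) S B"
  unfolding growth_le_def
proof (intro allI impI)
  fix G assume "finite G" "G \<subseteq> B"
  have "growth_bound 1 (card B) S G" unfolding growth_bound_def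
  proof (intro allI impI)
    fix D and n :: nat and f assume f: "\<forall>i<n. pdeg G D (f i)" "indep_on S {..<n} f"
    have "card {..<n} \<le> card (PiE B (\<lambda>_. {..D}))"
    proof (rule indep_on_card_le_set[OF _ f(2) finite_box[OF assms]])
      fix i assume "i \<in> {..<n}"
      then have "pdeg B D (f i)" using f(1) \<open>G \<subseteq> B\<close> pdeg_mono_coords by blast
      from pdeg_span_mon[OF assms this]
      show "\<exists>c. \<forall>x\<in>S. f i x = (\<Sum>\<alpha>\<in>PiE B (\<lambda>_. {..D}). c \<alpha> * mon B (\<lambda>b. b) \<alpha> x)" by blast
    qed simp
    then show "n \<le> 1 * (D + 1) ^ card B" by (simp add: card_box[OF assms])
  qed
  then show "\<exists>K. growth_bound K (card B) S G" by blast
qed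

definition algebraic_over :: "('a \<Rightarrow> complex) set \<Rightarrow> 'a set \<Rightarrow> ('a \<Rightarrow> complex) \<Rightarrow> bool" where
  "algebraic_over F Z y \<longleftrightarrow> (\<exists>E q. (\<forall>e\<le>E. q e \<in> poly_functions F) \<and>
     (\<forall>x\<in>Z. (\<Sum>e\<le>E. q e x * y x ^ e) = 0) \<and> (\<exists>x\<in>Z. q E x \<noteq> 0))"

lemma drop_vanishing_top_coeffs:
  fixes q :: "nat \<Rightarrow> 'a \<Rightarrow> complex"
  assumes "k \<le> E" "\<exists>x\<in>Z. q k x \<noteq> 0"
  shows "\<exists>e\<le>E. (\<exists>x\<in>Z. q e x \<noteq> 0) \<and> (\<forall>x\<in>Z. (\<Sum>i\<le>e. q i x * y x ^ i) = (\<Sum>i\<le>E. q i x * y x ^ i))"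
proof -
  let ?P = "\<lambda>e. e \<le> E \<and> (\<exists>x\<in>Z. q e x \<noteq> 0)"
  obtain e where e: "?P e" "\<And>e'. ?P e' \<Longrightarrow> e' \<le> e"
    using Nat.ex_has_greatest_nat[of ?P k E] assms by blast
  have "(\<Sum>i\<le>e. q i x * y x ^ i) = (\<Sum>i\<le>E. q i x * y x ^ i)" if "x \<in> Z" for x
    using e that by (intro sum.mono_neutral_left) fastforce+
  with e(1) show ?thesis by blast
qed

lemma algebraic_overI:
  assumes "\<And>e. e \<le> E \<Longrightarrow> q e \<in> poly_functions F" "\<And>x. x \<in> Z \<Longrightarrow> (\<Sum>e\<le>E. q e x * y x ^ e) = 0"
    "k \<le> E" "\<exists>x\<in>Z. q k x \<noteq> 0"
  shows "algebraic_over F Z y"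
proof -
  obtain e where "e \<le> E" "\<exists>x\<in>Z. q e x \<noteq> 0"
    "\<forall>x\<in>Z. (\<Sum>i\<le>e. q i x * y x ^ i) = (\<Sum>i\<le>E. q i x * y x ^ i)"
    using drop_vanishing_top_coeffs[of k E Z q y] assms(3,4) by blast
  then show ?thesis unfolding algebraic_over_def using assms(1,2)
    by (intro exI[of _ e] exI[of _ q]) auto
qed

lemma algebraic_over_mono:
  "algebraic_over F Z y \<Longrightarrow> F \<subseteq> F' \<Longrightarrow> algebraic_over F' Z y"
  unfolding algebraic_over_def using poly_functions_mono by blast

lemma growth_le_algebraic:
  assumes pr: "prime_on (poly_functions C) Z" and B: "finite B" "B \<subseteq> C"
    and alg: "\<And>y. y \<in> C \<Longrightarrow> algebraic_over B Z y"
  shows "growth_le (card B) Z C"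
proof -
  have *: "growth_le (card B) Z (B \<union> G)" if "finite G" "G \<subseteq> C" for G
    using that
  proof (induction G rule: finite_induct)
    case empty
    then show ?case using growth_le_card[OF B(1)] by simp
  next
    case (insert y G)
    then have IH: "growth_le (card B) Z (B \<union> G)" by simp
    have "algebraic_over (B \<union> G) Z y"
      by (rule algebraic_over_mono[OF alg]) (use insert.prems in auto)
    then obtain E q where q: "\<And>e. e \<le> E \<Longrightarrow> q e \<in> poly_functions (B \<union> G)"
      "\<And>x. x \<in> Z \<Longrightarrow> (\<Sum>e\<le>E. q e x * y x ^ e) = 0" "\<exists>x\<in>Z. q E x \<noteq> 0"
      unfolding algebraic_over_def by blast
    have "insert y (B \<union> G) \<subseteq> C" using B insert.prems by auto
    then have "prime_on (poly_functions (insert y (B \<union> G))) Z"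
      using prime_on_mono[OF pr] poly_functions_mono by blast
    from growth_le_insert_algebraic[OF IH this q] show ?case by simp
  qed
  show ?thesis unfolding growth_le_def
  proof (intro allI impI)
    fix G assume G: "finite G" "G \<subseteq> C"
    show "\<exists>K. growth_bound K (card B) Z G" by (rule growth_leD[OF *[OF G] G(1)]) simp
  qed
qed

text \<open>A relation among \<open>insert y B\<close> is sorted by powers of \<open>y\<close>. Not
  all coefficients vanish on \<open>Z\<close>, because that would be a relation among
  \<open>B\<close> alone.\<close>

lemma algebraic_over_if_not_algindep:
  assumes B: "finite B" "algindep Z B (\<lambda>b. b)" "y \<notin> B" "\<not> algindep Z (insert y B) (\<lambda>b. b)"
  shows "algebraic_over B Z y"
proof -
  obtain D c where c: "\<And>x. x \<in> Z \<Longrightarrow> (\<Sum>\<alpha>\<in>PiE (insert y B) (\<lambda>_. {..D}). c \<alpha> * mon (insert y B) (\<lambda>b. b) \<alpha>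
    x) = 0"
    and nz: "\<exists>\<alpha>\<in>PiE (insert y B) (\<lambda>_. {..D}). c \<alpha> \<noteq> 0"
    using B(4) unfolding algindep_def indep_on_def by blast
  define q where "q = (\<lambda>e x. \<Sum>\<alpha>\<in>PiE B (\<lambda>_. {..D}). c (\<alpha>(y := e)) * mon B (\<lambda>b. b) \<alpha> x)"
  from nz obtain e \<beta> where e: "e \<le> D" "\<beta> \<in> PiE B (\<lambda>_. {..D})" "c (\<beta>(y := e)) \<noteq> 0"
    by (auto simp: PiE_insert_eq)
  show ?thesis
  proof (rule algebraic_overI[of D q])
    show "q e \<in> poly_functions B" if "e \<le> D" for e
      unfolding q_def by (intro poly_functions_sum poly_functions_scale mon_poly_functions
        poly_functions.coord)
    show "(\<Sum>e\<le>D. q e x * y x ^ e) = 0" if "x \<in> Z" for x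
      using c[OF that] unfolding sum_PiE_insert[OF B(3,1)] mon_insert_upd[OF B(3,1)] q_def
      by (simp add: sum_distrib_left sum_distrib_right mult_ac)
    show "\<exists>x\<in>Z. q e x \<noteq> 0"
    proof (rule ccontr)
      assume "\<not> ?thesis"
      then have "(\<Sum>\<alpha>\<in>PiE B (\<lambda>_. {..D}). c (\<alpha>(y := e)) * mon B (\<lambda>b. b) \<alpha> x) = 0" if "x \<in> Z" for x
        using that by (auto simp: q_def)
      from algindepD[OF B(2), where D = D and c = "\<lambda>\<alpha>. c (\<alpha>(y := e))", OF this e(2)] e(3) show False
        by blast
    qed
  qed (use e in auto)
qed

lemma growth_le_mono:
  assumes gm: "growth_le m Z C" and "m \<le> c"
  shows "growth_le c Z C"
  unfolding growth_le_def
proof (intro allI impI)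
  fix G assume "finite G" "G \<subseteq> C"
  then obtain K where K: "growth_bound K m Z G" using growth_leD[OF gm] by blast
  have "growth_bound K c Z G" unfolding growth_bound_def
  proof (intro allI impI)
    fix D and n :: nat and f assume "\<forall>i<n. pdeg G D (f i)" "indep_on Z {..<n} f"
    then have "n \<le> K * (D + 1) ^ m" using K unfolding growth_bound_def by blast
    also have "\<dots> \<le> K * (D + 1) ^ c" using assms(2) by (intro mult_le_mono2 power_increasing) auto
    finally show "n \<le> K * (D + 1) ^ c" .
  qed
  then show "\<exists>K. growth_bound K c Z G" by blast
qed

lemma algebraic_over_self:
  assumes "Z \<noteq> {}" "y \<in> B"
  shows "algebraic_over B Z y"
  using assms by (intro algebraic_overI[of 1 "\<lambda>e x. if e = 0 then - y x else 1" B Z y 1])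
    (auto simp: le_Suc_eq intro: poly_functions.const poly_functions_uminus[OF poly_functions.coord])

text \<open>A largest algebraically independent subset of \<open>C0\<close> plays the role of a
  transcendence basis: every other coordinate is algebraic over it. The set \<open>C0\<close> stands
  for the coefficients that can be nonzero on tuples of forms.\<close>

lemma growth_le_if_dependent:
  assumes pr: "prime_on (poly_functions C) Z" and C0: "finite C0" "C0 \<subseteq> C"
    and zero: "\<And>y x. y \<in> C - C0 \<Longrightarrow> x \<in> Z \<Longrightarrow> y x = 0"
    and dep: "\<And>T. T \<subseteq> C0 \<Longrightarrow> card T = Suc c \<Longrightarrow> \<not> algindep Z T (\<lambda>b. b)"
  shows "growth_le c Z C"
proof -
  have ne: "Z \<noteq> {}" using pr by (simp add: prime_on_def)
  let ?P = "\<lambda>m. \<exists>B\<subseteq>C0. algindep Z B (\<lambda>b. b) \<and> card B = m \<and> m \<le> c"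
  have "?P 0" using algindep_empty[OF ne] by (intro exI[of _ "{}"]) auto
  then obtain m where m: "?P m" "\<And>m'. ?P m' \<Longrightarrow> m' \<le> m"
    using Nat.ex_has_greatest_nat[of ?P 0 c] by blast
  then obtain B where B: "B \<subseteq> C0" "algindep Z B (\<lambda>b. b)" "card B = m" "m \<le> c" by blast
  have finB: "finite B" using B C0 finite_subset by blast
  have "algebraic_over B Z y" if "y \<in> C" for y
  proof (cases "y \<in> B")
    case True
    show ?thesis by (rule algebraic_over_self[OF ne True])
  next
    case False
    show ?thesis
    proof (cases "y \<in> C0")
      case True
      have "\<not> algindep Z (insert y B) (\<lambda>b. b)"
      proof
        assume a: "algindep Z (insert y B) (\<lambda>b. b)"
        have card: "card (insert y B) = Suc m" "insert y B \<subseteq> C0" using False finB B True by auto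
        show False
        proof (cases "m = c")
          case True
          then show ?thesis using dep[OF card(2)] card(1) a by simp
        next
          case False
          then have "?P (Suc m)" using a card B(4) by (intro exI[of _ "insert y B"]) auto
          then show ?thesis using m(2) by fastforce
        qed
      qed
      then show ?thesis by (rule algebraic_over_if_not_algindep[OF finB B(2) False])
    next
      case False
      \<comment> \<open>A coordinate that vanishes on \<open>Z\<close> satisfies the equation
        \<open>1 * y = 0\<close>.\<close>
      show ?thesis using ne zero[of y] False that
        by (intro algebraic_overI[of 1 "\<lambda>e _. if e = 0 then 0 else 1" B Z y 1])
          (auto simp: le_Suc_eq intro: poly_functions.const)
    qed
  qed
  from growth_le_algebraic[OF pr finB _ this] B C0 have "growth_le m Z C" by auto
  then show ?thesis using growth_le_mono B(4) by blast
qed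

section \<open>Relations forced by growth\<close>

text \<open>If all monomials in the \<open>v i\<close> and \<open>y t\<close> together were
  independent, there would be \<open>(D + 1) ^ (card I + card T)\<close> of them in degree linear in
  \<open>D\<close>, too many for growth \<open>b\<close>. Independence of the \<open>v i\<close>
  keeps some coefficient \<open>p \<beta>\<close> from vanishing. The coefficients involve only the
  \<open>v i\<close>; for functions pulled back along a map they are constant on its fibres.\<close>

lemma algebraic_relation:
  fixes v :: "'i \<Rightarrow> 'a \<Rightarrow> complex" and y :: "'j \<Rightarrow> 'a \<Rightarrow> complex"
  assumes g: "growth_le b S C" and fin: "finite I" "finite T" and b: "b < card I + card T"
    and v: "\<And>i. i \<in> I \<Longrightarrow> v i \<in> poly_functions C" "algindep S I v"
    and y: "\<And>t. t \<in> T \<Longrightarrow> y t \<in> poly_functions C"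
  shows "\<exists>D p. (\<forall>\<beta>. p \<beta> \<in> poly_functions (v ` I)) \<and>
    (\<exists>\<beta>\<in>PiE T (\<lambda>_. {..D}). \<exists>x\<in>S. p \<beta> x \<noteq> 0) \<and>
    (\<forall>x\<in>S. (\<Sum>\<beta>\<in>PiE T (\<lambda>_. {..D}). p \<beta> x * mon T y \<beta> x) = 0)"
proof -
  obtain G M where G: "finite G" "G \<subseteq> C" "\<forall>i\<in>I. pdeg G M (v i)" "\<forall>t\<in>T. pdeg G M (y t)"
  proof -
    obtain G1 M1 where "finite G1" "G1 \<subseteq> C" "\<forall>i\<in>I. pdeg G1 M1 (v i)"
      using poly_functions_imp_pdeg_common[of I v C] fin(1) v(1) by blast
    moreover obtain G2 M2 where "finite G2" "G2 \<subseteq> C" "\<forall>t\<in>T. pdeg G2 M2 (y t)"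
      using poly_functions_imp_pdeg_common[of T y C] fin(2) y by blast
    ultimately show thesis by (intro that[of "G1 \<union> G2"
      "M1 + M2"]) (auto intro: pdeg_mono[OF pdeg_mono_coords])
  qed
  define J where "J = (\<lambda>D::nat. PiE T (\<lambda>_. {..D}) \<times> PiE I (\<lambda>_. {..D}))"
  define f where "f = (\<lambda>(\<beta>, \<alpha>) x. mon T y \<beta> x * mon I v \<alpha> x)"
  have finJ: "finite (J D)" for D unfolding J_def by (intro finite_cartesian_product finite_box fin)
  have "\<exists>D. \<not> indep_on S (J D) f"
  proof (rule ccontr)
    assume "\<not> ?thesis"
    then have ind: "\<And>D. indep_on S (J D) f" by blast
    show False
    proof (rule growth_le_contra[OF g G(1,2) b finJ, where f = "\<lambda>_. f" and M = "(card T + card I) * M"])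
      fix D \<gamma> assume "\<gamma> \<in> J D"
      then obtain \<beta> \<alpha> where \<gamma>: "\<gamma> = (\<beta>, \<alpha>)" "\<beta> \<in> PiE T (\<lambda>_. {..D})" "\<alpha> \<in> PiE I (\<lambda>_. {..D})"
        by (auto simp: J_def)
      have "pdeg G (card T * (D * M)) (mon T y \<beta>)" "pdeg G (card I * (D * M)) (mon I v \<alpha>)"
        using pdeg_mon fin G \<gamma> by blast+
      then show "pdeg G ((card T + card I) * M * D) (f \<gamma>)"
        unfolding f_def \<gamma> prod.case by (rule pdeg.mult) (simp add: algebra_simps)
    next
      fix D show "(D + 1) ^ (card I + card T) \<le> card (J D)"
        using fin by (simp add: J_def card_cartesian_product card_box power_add)
    qed (rule ind)
  qed
  then obtain D c where c: "\<And>x. x \<in> S \<Longrightarrow> (\<Sum>\<gamma>\<in>J D. c \<gamma> * f \<gamma> x) = 0" "\<exists>\<gamma>\<in>J D. c \<gamma> \<noteq> 0"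
    unfolding indep_on_def by blast
  define p where "p = (\<lambda>\<beta> x. \<Sum>\<alpha>\<in>PiE I (\<lambda>_. {..D}). c (\<beta>, \<alpha>) * mon I v \<alpha> x)"
  have "p \<beta> \<in> poly_functions (v ` I)" for \<beta>
    unfolding p_def by (intro poly_functions_sum poly_functions_scale mon_poly_functions
      poly_functions.coord imageI)
  moreover have "\<exists>\<beta>\<in>PiE T (\<lambda>_. {..D}). \<exists>x\<in>S. p \<beta> x \<noteq> 0"
  proof (rule ccontr)
    assume *: "\<not> ?thesis"
    obtain \<beta> \<alpha> where ba: "\<beta> \<in> PiE T (\<lambda>_. {..D})" "\<alpha> \<in> PiE I (\<lambda>_. {..D})" "c (\<beta>, \<alpha>) \<noteq> 0"
      using c(2) by (auto simp: J_def)
    then have "(\<Sum>\<alpha>\<in>PiE I (\<lambda>_. {..D}). c (\<beta>, \<alpha>) * mon I v \<alpha> x) = 0" if "x \<in> S" for x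
      using * that by (auto simp: p_def)
    from algindepD[OF v(2), where D = D and c = "\<lambda>\<alpha>. c (\<beta>, \<alpha>)", OF this ba(2)] ba(3) show False by blast
  qed
  moreover have "(\<Sum>\<beta>\<in>PiE T (\<lambda>_. {..D}). p \<beta> x * mon T y \<beta> x) = 0" if "x \<in> S" for x
  proof -
    have "(\<Sum>\<beta>\<in>PiE T (\<lambda>_. {..D}). p \<beta> x * mon T y \<beta> x) =
        (\<Sum>\<beta>\<in>PiE T (\<lambda>_. {..D}). \<Sum>\<alpha>\<in>PiE I (\<lambda>_. {..D}). c (\<beta>, \<alpha>) * f (\<beta>, \<alpha>) x)"
      by (simp add: p_def f_def sum_distrib_left mult_ac)
    also have "\<dots> = (\<Sum>\<gamma>\<in>J D. c \<gamma> * f \<gamma> x)" by (simp add: J_def sum.cartesian_product)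
    finally show ?thesis using c(1)[OF that] by simp
  qed
  ultimately show ?thesis by blast
qed

lemma algebraic_over_if_growth:
  fixes v :: "'i \<Rightarrow> 'a \<Rightarrow> complex"
  assumes g: "growth_le (card I) S C" and fin: "finite I"
    and v: "\<And>i. i \<in> I \<Longrightarrow> v i \<in> poly_functions C" "algindep S I v"
    and y: "y \<in> poly_functions C"
  shows "algebraic_over (v ` I) S y"
proof -
  obtain D p where p: "\<And>\<beta>. p \<beta> \<in> poly_functions (v ` I)"
    "\<exists>\<beta>\<in>PiE {()} (\<lambda>_. {..D}). \<exists>x\<in>S. p \<beta> x \<noteq> 0"
    "\<And>x. x \<in> S \<Longrightarrow> (\<Sum>\<beta>\<in>PiE {()} (\<lambda>_. {..D}). p \<beta> x * mon {()} (\<lambda>_. y) \<beta> x) = 0"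
    using algebraic_relation[OF g fin, of "{()}" v "\<lambda>_. y"] v y by simp blast
  \<comment> \<open>An exponent function on the one-point index set is a single exponent.\<close>
  define q where "q = (\<lambda>e. p (\<lambda>_. e))"
  obtain e where e: "e \<le> D" "\<exists>x\<in>S. q e x \<noteq> 0"
  proof -
    from p(2) obtain \<beta> x where "\<beta> \<in> PiE {()} (\<lambda>_. {..D})" "x \<in> S" "p \<beta> x \<noteq> 0" by blast
    moreover have "\<beta> = (\<lambda>_. \<beta> ())" by (rule ext) simp
    ultimately show thesis by (intro that[of "\<beta> ()"]) (auto simp: q_def PiE_iff)
  qed
  show ?thesis
  proof (rule algebraic_overI[of D q, OF _ _ e])
    show "q e \<in> poly_functions (v ` I)" for e unfolding q_def by (rule p)
    show "(\<Sum>e\<le>D. q e x * y x ^ e) = 0" if "x \<in> S" for x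
      using p(3)[OF that] by (simp add: sum_PiE_insert mon_def q_def)
  qed
qed

section \<open>Trigonometric parametrizations\<close>

text \<open>The case \<open>T = {}\<close> of \<open>algebraic_relation\<close>: the only monomial
  is 1, so the relation would say that a nonzero coefficient vanishes.\<close>

lemma algindep_card_le:
  assumes "growth_le b S C" "finite I" "\<And>i. i \<in> I \<Longrightarrow> v i \<in> poly_functions C" "algindep S I v"
  shows "card I \<le> b"
proof (rule ccontr)
  assume "\<not> card I \<le> b"
  then obtain D p where "\<exists>\<beta>\<in>PiE {} (\<lambda>_. {..D}). \<exists>x\<in>S. p \<beta> x \<noteq> 0"
    "\<forall>x\<in>S. (\<Sum>\<beta>\<in>PiE {} (\<lambda>_. {..D}). p \<beta> x * mon ({}::nat set) (\<lambda>_ _. 0) \<beta> x) = 0"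
    using algebraic_relation[OF assms(1,2), of "{}::nat set" v "\<lambda>_ _. 0"] assms(3,4) by auto
  then show False by (auto simp: mon_def)
qed

lemma poly_functions_holomorphic:
  assumes "w \<in> poly_functions C" "\<And>u. u \<in> C \<Longrightarrow> (\<lambda>z. u (h z)) holomorphic_on UNIV"
  shows "(\<lambda>z. w (h z)) holomorphic_on UNIV"
  using assms(1)
proof induction
  case (coord u)
  then show ?case by (rule assms(2))
qed (auto intro!: holomorphic_intros)

lemma entire_mult_eq_0:
  assumes "f holomorphic_on UNIV" "g holomorphic_on UNIV" "\<And>z. f z * g z = 0" "f z0 \<noteq> (0::complex)"
  shows "g z = 0"
proof (rule analytic_continuation[OF assms(2), of "{z. f z \<noteq> 0}" z0])
  have "open {z. f z \<noteq> 0}"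
    using holomorphic_on_imp_continuous_on[OF assms(1)]
    by (simp add: open_Collect_neq continuous_on_const)
  then show "z0 islimpt {z. f z \<noteq> 0}" using assms(4) by (simp add: open_imp_islimpt)
qed (use assms(3) in auto)

text \<open>The ring of functions on the parameter space. Sine alone parametrizes affine space, and
  sine with cosine the plane rotations.\<close>

definition trig :: "nat \<Rightarrow> ((nat \<Rightarrow> complex) \<Rightarrow> complex) set" where
  "trig s = (\<lambda>j x. sin (x j)) ` {..<s} \<union> (\<lambda>j x. cos (x j)) ` {..<s}"

lemma sin_trig: "j < s \<Longrightarrow> (\<lambda>x. sin (x j)) \<in> poly_functions (trig s)"
  and cos_trig: "j < s \<Longrightarrow> (\<lambda>x. cos (x j)) \<in> poly_functions (trig s)"
  by (auto simp: trig_def intro!: poly_functions.coord)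

text \<open>Two functions that are nonzero at \<open>x\<close> and \<open>y\<close> are compared on
  the complex line through both points, where they become entire functions of one variable and the
  identity theorem applies.\<close>

lemma prime_on_trig: "prime_on (poly_functions (trig s)) UNIV"
  unfolding prime_on_def
proof (intro conjI ballI impI)
  fix u v assume u: "u \<in> poly_functions (trig s)" and v: "v \<in> poly_functions (trig s)"
    and uv: "\<forall>x\<in>UNIV. u x * v x = 0"
  have hol: "(\<lambda>z. w (\<lambda>j. x j + z * (y j - x j))) holomorphic_on UNIV"
    if "w \<in> poly_functions (trig s)" for w x y
    by (rule poly_functions_holomorphic[OF that]) (auto simp: trig_def intro!: holomorphic_intros)
  show "(\<forall>x\<in>UNIV. u x = 0) \<or> (\<forall>x\<in>UNIV. v x = 0)"
  proof (rule ccontr)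
    assume "\<not> ?thesis"
    then obtain x y where "u x \<noteq> 0" "v y \<noteq> 0" by auto
    with entire_mult_eq_0[OF hol[OF u, of x y] hol[OF v, of x y], of 0 1] uv show False by simp
  qed
qed simp

lemma growth_le_trig: "growth_le s UNIV (trig s)"
proof -
  let ?B = "(\<lambda>j x. sin (x j)) ` {..<s} :: ((nat \<Rightarrow> complex) \<Rightarrow> complex) set"
  have "growth_le (card ?B) UNIV (trig s)"
  proof (rule growth_le_algebraic[OF prime_on_trig])
    fix y assume "y \<in> trig s"
    then consider "y \<in> ?B" | j where "j < s" "y = (\<lambda>x. cos (x j))" by (auto simp: trig_def)
    then show "algebraic_over ?B UNIV y"
    proof cases
      case 1
      then show ?thesis by (rule algebraic_over_self[rotated]) simp
    next
      case 2
      \<comment> \<open>The coefficients of the equation \<open>cos^2 + (sin^2 - 1) = 0\<close> in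
        the cosine, so that \<open>s\<close> sines control all \<open>2 * s\<close>
        functions.\<close>
      let ?q = "\<lambda>e x. if e = 0 then sin (x j) ^ 2 - 1 else if e = 1 then 0 else 1 :: complex"
      have rel: "(\<Sum>e\<le>2. ?q e x * y x ^ e) = 0" for x
        using sin_cos_squared_add[of "x j"] by (simp add: 2 numeral_2_eq_2 algebra_simps)
      have qB: "?q e \<in> poly_functions ?B" for e
      proof (cases "e = 0")
        case True
        have "(\<lambda>x. sin (x j) ^ 2 - 1) \<in> poly_functions ?B"
          by (rule poly_functions_diff[OF poly_functions_power[OF poly_functions.coord]
            poly_functions.const])
            (use 2 in auto)
        then show ?thesis using True by simp
      qed (auto intro: poly_functions.const)
      show ?thesis
        by (rule algebraic_overI[where q = ?q and F = ?B and y = y and E = 2 and k = 2 and Z = UNIV])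
          (simp_all only: qB rel order_refl, simp)
    qed
  qed (auto simp: trig_def)
  moreover have "card ?B \<le> s" using card_image_le[of "{..<s}"] by force
  ultimately show ?thesis by (rule growth_le_mono)
qed

lemma growth_le_range:
  assumes "\<And>u. u \<in> C \<Longrightarrow> (\<lambda>x. u (\<Psi> x)) \<in> poly_functions (trig s)"
  shows "growth_le s (range \<Psi>) C"
  using growth_le_compose[OF growth_le_trig assms] by simp

lemma prime_on_range:
  assumes "\<And>u. u \<in> C \<Longrightarrow> (\<lambda>x. u (\<Psi> x)) \<in> poly_functions (trig s)"
  shows "prime_on (poly_functions C) (range \<Psi>)"
  unfolding prime_on_def
proof (intro conjI ballI impI)
  fix u v assume u: "u \<in> poly_functions C" and v: "v \<in> poly_functions C"
    and uv: "\<forall>x\<in>range \<Psi>. u x * v x = 0"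
  have "(\<lambda>x. u (\<Psi> x)) \<in> poly_functions (trig s)" "(\<lambda>x. v (\<Psi> x)) \<in> poly_functions (trig s)"
    by (rule poly_functions_compose[OF u assms], assumption) (rule poly_functions_compose[OF v assms])
  from prime_onD[OF prime_on_trig this] uv
  show "(\<forall>x\<in>range \<Psi>. u x = 0) \<or> (\<forall>x\<in>range \<Psi>. v x = 0)" by blast
qed simp

section \<open>Algebraic independence from the differential\<close>

lemma algindep_coords:
  assumes "finite I"
  shows "algindep (UNIV :: ('i \<Rightarrow> complex) set) I (\<lambda>i x. x i)"
  using assms
proof (induction I rule: finite_induct)
  case empty
  then show ?case by (rule algindep_empty) simp
next
  case (insert i I)
  show ?case unfolding algindep_def indep_on_def
  proof (intro allI impI ballI)
    fix D c \<beta>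
    assume c: "\<forall>x::'i \<Rightarrow> complex\<in>UNIV. (\<Sum>\<alpha>\<in>PiE (insert i I) (\<lambda>_. {..D}). c \<alpha> * mon (insert i I) (\<lambda>i x.
      x i) \<alpha> x) = 0"
      and \<beta>: "\<beta> \<in> PiE (insert i I) (\<lambda>_. {..D})"
    then obtain e \<gamma> where e: "e \<le> D" "\<gamma> \<in> PiE I (\<lambda>_. {..D})" "\<beta> = \<gamma>(i := e)"
      by (auto simp: PiE_insert_eq)
    have "(\<Sum>\<alpha>\<in>PiE I (\<lambda>_. {..D}). c (\<alpha>(i := e)) * mon I (\<lambda>i x. x i) \<alpha> x) = 0" for x
    proof -
      define q where "q = (\<lambda>e. \<Sum>\<alpha>\<in>PiE I (\<lambda>_. {..D}). c (\<alpha>(i := e)) * mon I (\<lambda>i x. x i) \<alpha> x)"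
      have "(\<Sum>e\<le>D. q e * z ^ e) = 0" for z
      proof -
        have m: "mon I (\<lambda>i x. x i) \<alpha> (x(i := z)) = mon I (\<lambda>i x. x i) \<alpha> x" for \<alpha>
          unfolding mon_def using insert.hyps(2) by (intro prod.cong) auto
        show ?thesis using c[rule_format, of "x(i := z)"]
          unfolding sum_PiE_insert[OF insert.hyps(2,1)] mon_insert_upd[OF insert.hyps(2,1)] m q_def
            sum_distrib_right
          by (simp add: mult_ac)
      qed
      then have "q e = 0" using polyfun_eq_0[of q D] e(1) by blast
      then show ?thesis by (simp add: q_def)
    qed
    with algindepD[OF insert.IH, where D = D and c = "\<lambda>\<alpha>. c (\<alpha>(i := e))", OF _ e(2)] e(3)
    show "c \<beta> = 0" by simp
  qed
qed

text \<open>Along the line through 0 and \<open>x\<close> the functions \<open>w i\<close> agree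
  with \<open>x i\<close> to first order. The lowest homogeneous part of a relation among the
  \<open>w i\<close> is therefore a relation among the coordinates, hence zero.\<close>

lemma algindep_tangent:
  fixes w :: "'i \<Rightarrow> ('i \<Rightarrow> complex) \<Rightarrow> complex"
  assumes "finite I" "\<And>i. i \<in> I \<Longrightarrow> w i (\<lambda>_. 0) = 0"
    "\<And>i x. i \<in> I \<Longrightarrow> ((\<lambda>z. w i (\<lambda>j. z * x j)) has_field_derivative x i) (at 0)"
  shows "algindep UNIV I w"
  unfolding algindep_def indep_on_def
proof (intro allI impI)
  fix D c
  let ?B = "PiE I (\<lambda>_. {..D::nat})"
  assume c: "\<forall>x\<in>UNIV. (\<Sum>\<alpha>\<in>?B. c \<alpha> * mon I w \<alpha> x) = 0"
  define deg where "deg = (\<lambda>\<alpha>::'i \<Rightarrow> nat. \<Sum>i\<in>I. \<alpha> i)"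
  have finB: "finite ?B" using assms(1) by (rule finite_box)
  show "\<forall>\<alpha>\<in>?B. c \<alpha> = 0"
  proof (rule ccontr)
    assume "\<not> ?thesis"
    then have ex: "\<exists>m. \<exists>\<alpha>\<in>?B. c \<alpha> \<noteq> 0 \<and> deg \<alpha> = m" by auto
    \<comment> \<open>The lowest total degree that occurs with a nonzero coefficient.\<close>
    define m where "m = (LEAST m. \<exists>\<alpha>\<in>?B. c \<alpha> \<noteq> 0 \<and> deg \<alpha> = m)"
    obtain \<alpha>0 where \<alpha>0: "\<alpha>0 \<in> ?B" "c \<alpha>0 \<noteq> 0" "deg \<alpha>0 = m"
      using LeastI_ex[OF ex] unfolding m_def by blast
    have low: "m \<le> deg \<alpha>" if "\<alpha> \<in> ?B" "c \<alpha> \<noteq> 0" for \<alpha>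
      unfolding m_def using that by (intro Least_le) auto
    have "(\<Sum>\<alpha>\<in>?B. (if deg \<alpha> = m then c \<alpha> else 0) * mon I (\<lambda>i x. x i) \<alpha> x) = 0" for x :: "'i \<Rightarrow> complex"
    proof -
      define h where "h = (\<lambda>i z. w i (\<lambda>j. z * x j) / z)"
      have h: "(h i \<longlongrightarrow> x i) (at 0)" if "i \<in> I" for i
        using assms(3)[OF that, of x] assms(2)[OF that] unfolding has_field_derivative_iff h_def by simp
      \<comment> \<open>The relation on the line, divided by \<open>z ^ m\<close>. It is 0 for
        \<open>z \<noteq> 0\<close>, and in the limit \<open>0 ^ (deg \<alpha> - m)\<close> keeps
        exactly the terms of degree \<open>m\<close>.\<close>
      define F where "F = (\<lambda>z. \<Sum>\<alpha>\<in>?B. c \<alpha> * (z ^ (deg \<alpha> - m) * (\<Prod>i\<in>I. h i z ^ \<alpha> i)))"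
      have "F z = 0" if "z \<noteq> 0" for z
      proof -
        have "z ^ m * F z = (\<Sum>\<alpha>\<in>?B. c \<alpha> * mon I w \<alpha> (\<lambda>j. z * x j))"
          unfolding F_def sum_distrib_left
        proof (intro sum.cong refl)
          fix \<alpha> assume \<alpha>: "\<alpha> \<in> ?B"
          have "z ^ deg \<alpha> * (\<Prod>i\<in>I. h i z ^ \<alpha> i) = mon I w \<alpha> (\<lambda>j. z * x j)"
            using that by (simp add: deg_def h_def mon_def power_sum prod.distrib[symmetric]
              power_divide)
          moreover have "z ^ deg \<alpha> = z ^ m * z ^ (deg \<alpha> - m)" if "c \<alpha> \<noteq> 0"
            using low[OF \<alpha> that] by (simp add: power_add[symmetric])
          ultimately show "z ^ m * (c \<alpha> * (z ^ (deg \<alpha> - m) * (\<Prod>i\<in>I. h i z ^ \<alpha> i))) =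
            c \<alpha> * mon I w \<alpha> (\<lambda>j. z * x j)"
            by (cases "c \<alpha> = 0") (auto simp: mult_ac)
        qed
        then show ?thesis using c that by simp
      qed
      then have "(F \<longlongrightarrow> 0) (at 0)"
        by (intro tendsto_eventually) (auto simp: eventually_at_filter)
      moreover have "(F \<longlongrightarrow> (\<Sum>\<alpha>\<in>?B. c \<alpha> * (0 ^ (deg \<alpha> - m) * (\<Prod>i\<in>I. x i ^ \<alpha> i)))) (at 0)"
        unfolding F_def by (intro tendsto_intros h)
      ultimately have "(\<Sum>\<alpha>\<in>?B. c \<alpha> * (0 ^ (deg \<alpha> - m) * (\<Prod>i\<in>I. x i ^ \<alpha> i))) = 0"
        using tendsto_unique[of "at (0::complex)" F] by simp
      moreover have "c \<alpha> * (0 ^ (deg \<alpha> - m) * (\<Prod>i\<in>I. x i ^ \<alpha> i)) = (if deg \<alpha> =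
        m then c \<alpha> else 0) * mon I (\<lambda>i x. x i) \<alpha> x"
        if "\<alpha> \<in> ?B" for \<alpha>
        using low[OF that] by (cases "c \<alpha> = 0") (auto simp: mon_def)
      ultimately show ?thesis by simp
    qed
    from algindepD[OF algindep_coords[OF assms(1)] this \<alpha>0(1)] \<alpha>0 show False by simp
  qed
qed

text \<open>The projection to the \<open>l\<close>-th member of the coordinate flag.\<close>

definition trunc :: "nat \<Rightarrow> (nat \<Rightarrow> complex) \<Rightarrow> nat \<Rightarrow> complex" where
  "trunc l x j = (if j < l then x j else 0)"

lemma trunc_trig: "u \<in> poly_functions (trig s) \<Longrightarrow> (\<lambda>x. u (trunc l x)) \<in> poly_functions (trig l)"
proof (erule poly_functions_compose)
  fix w assume "w \<in> trig s"
  then obtain j where "w = (\<lambda>x. sin (x j)) \<or> w = (\<lambda>x. cos (x j))" by (auto simp: trig_def)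
  then show "(\<lambda>x. w (trunc l x)) \<in> poly_functions (trig l)"
    by (cases "j < l") (auto simp: trunc_def intro: sin_trig cos_trig poly_functions.const)
qed

text \<open>Subtracting the values at the image of 0 puts the functions in the form required by
  \<open>algindep_tangent\<close>. One family serves all members of the flag, since truncation does
  not affect the first \<open>l\<close> derivatives.\<close>

lemma exists_algindep:
  fixes \<Psi> :: "(nat \<Rightarrow> complex) \<Rightarrow> 'a"
  assumes "\<And>i. i < s \<Longrightarrow> \<exists>w\<in>poly_functions C. \<forall>x. ((\<lambda>z. w (\<Psi> (\<lambda>j. z * x j))) has_field_derivative x i)
    (at 0)"
  shows "\<exists>w. (\<forall>i<s. w i \<in> poly_functions C) \<and> (\<forall>l\<le>s. algindep (range (\<lambda>x. \<Psi> (trunc l x))) {..<l} w)"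
proof -
  have "\<forall>i. \<exists>w. i < s \<longrightarrow> w \<in> poly_functions C \<and>
    (\<forall>x. ((\<lambda>z. w (\<Psi> (\<lambda>j. z * x j))) has_field_derivative x i) (at 0))"
    using assms by blast
  then obtain w where w: "\<And>i. i < s \<Longrightarrow> w i \<in> poly_functions C"
    "\<And>i x. i < s \<Longrightarrow> ((\<lambda>z. w i (\<Psi> (\<lambda>j. z * x j))) has_field_derivative x i) (at 0)"
    by metis
  define w' where "w' = (\<lambda>i p. w i p - w i (\<Psi> (\<lambda>_. 0)))"
  have "w' i \<in> poly_functions C" if "i < s" for i
    unfolding w'_def using w(1)[OF that] by (intro poly_functions_diff poly_functions.const)
  moreover have "algindep (range (\<lambda>x. \<Psi> (trunc l x))) {..<l} w'" if "l \<le> s" for l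
    unfolding algindep_image
  proof (rule algindep_tangent)
    fix i assume i: "i \<in> {..<l}"
    show "w' i (\<Psi> (trunc l (\<lambda>_. 0))) = 0" by (simp add: w'_def trunc_def[abs_def])
    fix x :: "nat \<Rightarrow> complex"
    have "trunc l (\<lambda>j. z * x j) = (\<lambda>j. z * trunc l x j)" for z by (auto simp: trunc_def)
    moreover have "((\<lambda>z. w' i (\<Psi> (\<lambda>j. z * trunc l x j))) has_field_derivative trunc l x i) (at 0)"
      unfolding w'_def using w(2)[of i "trunc l x"] i that by (auto intro!: derivative_eq_intros)
    ultimately show "((\<lambda>z. w' i (\<Psi> (trunc l (\<lambda>j. z * x j)))) has_field_derivative x i) (at 0)"
      using i by (simp add: trunc_def[of l x i])
  qed simp
  ultimately show ?thesis by blast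
qed

text \<open>The closures are irreducible as images of the parameter space. Inclusions are proper
  because the \<open>l\<close>-th closure has growth \<open>l\<close>, whereas the next one carries
  \<open>Suc l\<close> algebraically independent functions.\<close>

lemma krull_dim_zariski_ge:
  assumes \<Psi>: "\<And>x. \<Psi> x \<in> W" "\<And>u. u \<in> C \<Longrightarrow> (\<lambda>x. u (\<Psi> x)) \<in> poly_functions (trig s)"
    and tangent: "\<And>i. i < s \<Longrightarrow> \<exists>w\<in>poly_functions C. \<forall>x. ((\<lambda>z. w (\<Psi> (\<lambda>j. z * x j))) has_field_derivative
      x i) (at 0)"
  shows "ereal (real s) \<le> krull_dim (zariski C W)"
proof -
  obtain w where w: "\<forall>i<s. w i \<in> poly_functions C"
    "\<forall>l\<le>s. algindep (range (\<lambda>x. \<Psi> (trunc l x))) {..<l} w"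
    using exists_algindep[OF tangent] by blast
  define S where "S = (\<lambda>l. range (\<lambda>x. \<Psi> (trunc l x)))"
  define Z where "Z = (\<lambda>l. zariski_closure C W (S l))"
  have SW: "S l \<subseteq> W" for l using \<Psi>(1) by (auto simp: S_def)
  have tr: "(\<lambda>x. u (\<Psi> (trunc l x))) \<in> poly_functions (trig l)" if "u \<in> C" for u l
    using trunc_trig[OF \<Psi>(2)[OF that]] by simp
  have "irreducible_closed (zariski C W) (Z l)" for l
    unfolding Z_def
  proof (rule prime_on_imp_irreducible_closed[OF closedin_zariski_closure prime_on_closure[OF _ SW]])
    show "prime_on (poly_functions C) (S l)" unfolding S_def by (rule prime_on_range[OF tr])
  qed
  moreover have "Z l \<subset> Z (Suc l)" if l: "l < s" for l
  proof -
    have "\<Psi> (trunc l x) = \<Psi> (trunc (Suc l) (trunc l x))" for x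
      by (rule arg_cong[of _ _ \<Psi>]) (auto simp: trunc_def)
    then have "S l \<subseteq> S (Suc l)" by (auto simp: S_def)
    then have "Z l \<subseteq> Z (Suc l)" unfolding Z_def by (rule zariski_closure_mono)
    moreover have "Z l \<noteq> Z (Suc l)"
    proof
      assume eq: "Z l = Z (Suc l)"
      have "growth_le l (Z l) C"
        unfolding Z_def S_def by (intro growth_le_closure growth_le_range tr)
      moreover have "algindep (Z (Suc l)) {..<Suc l} w"
        unfolding Z_def
        by (rule algindep_mono[OF _ subset_zariski_closure[OF SW]]) (use w(2) l in \<open>simp add: S_def\<close>)
      ultimately show False using algindep_card_le[of l "Z l" C "{..<Suc l}" w] w(1) l eq by auto
    qed
    ultimately show ?thesis by blast
  qed
  ultimately show ?thesis unfolding krull_dim_def by (intro Sup_upper) blast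
qed

section \<open>Lifting general points\<close>

text \<open>Coordinates on pairs of a base point and a parameter, with only the first
  \<open>j\<close> parameters visible. This lets a point be lifted one parameter at a time.\<close>

definition coords_ext :: "('a \<Rightarrow> complex) set \<Rightarrow> nat \<Rightarrow> ('a \<times> (nat \<Rightarrow> complex) \<Rightarrow> complex) set" where
  "coords_ext C j = (\<lambda>u q. u (fst q)) ` C \<union> (\<lambda>i q. snd q i) ` {..<j}"

lemma coords_ext_Suc: "coords_ext C (Suc j) = insert (\<lambda>q. snd q j) (coords_ext C j)"
  by (auto simp: coords_ext_def less_Suc_eq)

lemma coords_ext_mono: "i \<le> j \<Longrightarrow> coords_ext C i \<subseteq> coords_ext C j"
  by (auto simp: coords_ext_def)

lemma coords_ext_fst: "u \<in> poly_functions C \<Longrightarrow> (\<lambda>q. u (fst q)) \<in> poly_functions (coords_ext C j)"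
  by (erule poly_functions_compose) (auto simp: coords_ext_def intro: poly_functions.coord)

lemma coords_ext_cong:
  assumes "w \<in> poly_functions (coords_ext C j)" "\<And>i. i < j \<Longrightarrow> \<tau> i = \<tau>' i"
  shows "w (g, \<tau>) = w (g, \<tau>')"
  using assms(1) by induction (auto simp: coords_ext_def assms(2))

lemma algebraic_over_trans:
  assumes "algebraic_over F Z y" "F \<subseteq> poly_functions F'"
  shows "algebraic_over F' Z y"
proof -
  obtain E q where "\<forall>e\<le>E. q e \<in> poly_functions F"
    "(\<forall>x\<in>Z. (\<Sum>e\<le>E. q e x * y x ^ e) = 0) \<and> (\<exists>x\<in>Z. q E x \<noteq> 0)"
    using assms(1) unfolding algebraic_over_def by blast
  moreover from this(1) have "\<forall>e\<le>E. q e \<in> poly_functions F'"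
    using poly_functions_trans[OF _ assms(2)] by simp
  ultimately show ?thesis unfolding algebraic_over_def by (intro exI[of _ E] exI[of _ q]) simp
qed

text \<open>Membership in the Zariski closure of \<open>S\<close>, free of an ambient set, so that
  \<open>C\<close> can grow while \<open>S\<close> stays fixed.\<close>

definition satisfies_relations :: "('a \<Rightarrow> complex) set \<Rightarrow> 'a set \<Rightarrow> 'a \<Rightarrow> bool" where
  "satisfies_relations C S q \<longleftrightarrow> (\<forall>w\<in>poly_functions C. (\<forall>x\<in>S. w x = 0) \<longrightarrow> w q = 0)"

lemma satisfies_relationsD:
  "satisfies_relations C S q \<Longrightarrow> w \<in> poly_functions C \<Longrightarrow> (\<And>x. x \<in> S \<Longrightarrow> w x = 0) \<Longrightarrow> w q = 0"
  unfolding satisfies_relations_def by blast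

text \<open>Divide an algebraic equation of \<open>w\<close> by the largest possible power of \<open>w\<close>; if its constant term
  does not vanish at a point, then neither does \<open>w\<close>.\<close>

lemma exists_nonvanishing_multiple:
  assumes pr: "prime_on (poly_functions C) S" and w: "w \<in> poly_functions C" "\<exists>x\<in>S. w x \<noteq> 0"
    and alg: "algebraic_over F S w" and F: "F \<subseteq> C"
  shows "\<exists>b\<in>poly_functions F. (\<exists>x\<in>S. b x \<noteq> 0) \<and>
    (\<forall>C' q. F \<subseteq> C' \<longrightarrow> w \<in> poly_functions C' \<longrightarrow> satisfies_relations C' S q \<longrightarrow> b q \<noteq> 0 \<longrightarrow> w q \<noteq> 0)"
proof -
  obtain E p where p: "\<And>e. e \<le> E \<Longrightarrow> p e \<in> poly_functions F"
    "\<And>x. x \<in> S \<Longrightarrow> (\<Sum>e\<le>E. p e x * w x ^ e) = 0" and nz: "\<exists>x\<in>S. p E x \<noteq> 0"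
    using alg unfolding algebraic_over_def by blast
  define k where "k = (LEAST e. \<exists>x\<in>S. p e x \<noteq> 0)"
  have k: "\<exists>x\<in>S. p k x \<noteq> 0" unfolding k_def by (rule LeastI[of _ E]) (rule nz)
  have kE: "k \<le> E" unfolding k_def by (rule Least_le) (rule nz)
  have below: "p e x = 0" if "e < k" "x \<in> S" for e x
    using not_less_Least[of e "\<lambda>e. \<exists>x\<in>S. p e x \<noteq> 0"] that unfolding k_def by blast
  define r where "r = (\<lambda>x. \<Sum>i\<le>E - k. p (i + k) x * w x ^ i)"
  have r0: "r x = 0" if "x \<in> S" for x
  proof (rule prime_on_power[OF pr w(1) _ _ w(2) that])
    show "r \<in> poly_functions C" unfolding r_def
      using kE by (intro poly_functions_sum poly_functions.mult poly_functions_power w(1)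
        poly_functions_mono[OF p(1) F])
        auto
    show "w x ^ k * r x = 0" if "x \<in> S" for x
    proof -
      have "0 = (\<Sum>e\<le>E. p e x * w x ^ e)" using p(2)[OF that] by simp
      also have "\<dots> = (\<Sum>e\<in>{0 + k..E - k + k}. p e x * w x ^ e)"
        using kE below that by (intro sum.mono_neutral_right) auto
      also have "\<dots> = (\<Sum>i\<in>{0..E - k}. p (i + k) x * w x ^ (i + k))"
        by (rule sum.shift_bounds_cl_nat_ivl)
      also have "\<dots> = w x ^ k * r x"
        by (simp add: r_def sum_distrib_left power_add mult_ac atMost_atLeast0)
      finally show ?thesis by simp
    qed
  qed
  show ?thesis
  proof (intro bexI[of _ "p k"] conjI allI impI)
    fix C' q assume C': "F \<subseteq> C'" "w \<in> poly_functions C'" "satisfies_relations C' S q" "p k q \<noteq> 0"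
    have "r \<in> poly_functions C'" unfolding r_def
      using kE by (intro poly_functions_sum poly_functions.mult poly_functions_power C'(2)
        poly_functions_mono[OF p(1) C'(1)])
        auto
    then have "r q = 0" using satisfies_relationsD[OF C'(3)] r0 by blast
    show "w q \<noteq> 0"
    proof
      assume "w q = 0"
      then have "r q = p k q" unfolding r_def by (subst sum.mono_neutral_right[of _ "{0}"]) auto
      with \<open>r q = 0\<close> C'(4) show False by simp
    qed
  qed (use k p kE in auto)
qed

lemma sum_power_shift:
  fixes z :: complex
  shows "(\<Sum>i\<le>E + d. (if d \<le> i then q (i - d) else 0) * z ^ i) = z ^ d * (\<Sum>e\<le>E. q e * z ^ e)"
proof -
  have "(\<Sum>i\<le>E + d. (if d \<le> i then q (i - d) else 0) * z ^ i) = (\<Sum>i\<in>{0 + d..E + d}. q (i - d) * z ^ i)"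
    by (subst sum.mono_neutral_right[of _ "{0 + d..E + d}"]) (auto intro!: sum.cong)
  also have "\<dots> = (\<Sum>e\<in>{0..E}. q (e + d - d) * z ^ (e + d))" by (rule sum.shift_bounds_cl_nat_ivl)
  finally show ?thesis by (simp add: sum_distrib_left power_add mult_ac atMost_atLeast0)
qed

text \<open>Specialising an equation of minimal degree of the new coordinate at \<open>q\<close>, any of its roots extends
  \<open>q\<close>: pseudo-division by the minimal equation reduces every other relation to lower degree.\<close>

lemma extend_point:
  assumes alg: "algebraic_over C S t"
  shows "\<exists>a\<in>poly_functions C. (\<exists>x\<in>S. a x \<noteq> 0) \<and>
    (\<forall>q. satisfies_relations C S q \<longrightarrow> a q \<noteq> 0 \<longrightarrow>
      (\<exists>\<xi>. \<forall>q'. (\<forall>w\<in>poly_functions C. w q' = w q) \<longrightarrow> t q' = \<xi> \<longrightarrow> satisfies_relations (insert t C) S q'))"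
proof -
  define Rel where "Rel = (\<lambda>E p. (\<forall>e\<le>E. p e \<in> poly_functions C) \<and>
     (\<forall>x\<in>S. (\<Sum>e\<le>E. p e x * t x ^ e) = 0) \<and> (\<exists>x\<in>S. p E x \<noteq> 0))"
  define E where "E = (LEAST E. \<exists>p. Rel E p)"
  have "\<exists>E p. Rel E p" using alg unfolding algebraic_over_def Rel_def .
  then have "\<exists>p. Rel E p" unfolding E_def by (rule LeastI_ex)
  then obtain p where p: "Rel E p" by blast
  have min: "E \<le> E'" if "Rel E' p'" for E' p' unfolding E_def using that by (intro Least_le) blast
  have pC: "p e \<in> poly_functions C" if "e \<le> E" for e using p that by (simp add: Rel_def)
  have p0: "(\<Sum>e\<le>E. p e x * t x ^ e) = 0" if "x \<in> S" for x using p that by (simp add: Rel_def)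
  have pE: "\<exists>x\<in>S. p E x \<noteq> 0" using p by (simp add: Rel_def)
  have E: "E \<noteq> 0" using p0 pE by (intro notI) auto
  \<comment> \<open>By minimality of \<open>E\<close>, a relation of smaller degree has only
    coefficients that vanish on all of \<open>S\<close>.\<close>
  have low: "r i x = 0" if r: "\<And>i. r i \<in> poly_functions C" "\<And>x. x \<in> S \<Longrightarrow> (\<Sum>i\<le>n. r i x * t x ^ i) = 0"
    and "n < E" "i \<le> n" "x \<in> S" for r n i x
  proof (rule ccontr)
    assume "r i x \<noteq> 0"
    then obtain e where e: "e \<le> n" "\<exists>x\<in>S. r e x \<noteq> 0"
      "\<forall>x\<in>S. (\<Sum>i\<le>e. r i x * t x ^ i) = (\<Sum>i\<le>n. r i x * t x ^ i)"
      using drop_vanishing_top_coeffs[of i n S r t] \<open>i \<le> n\<close> \<open>x \<in> S\<close> by blast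
    then have "Rel e r" using r by (simp add: Rel_def)
    from min[OF this] e(1) \<open>n < E\<close> show False by simp
  qed
  show ?thesis
  proof (intro bexI[of _ "p E"] conjI allI impI)
    fix q assume q: "satisfies_relations C S q" "p E q \<noteq> 0"
    obtain \<xi> where \<xi>: "(\<Sum>e\<le>E. p e q * \<xi> ^ e) = 0"
      using fundamental_theorem_of_algebra[of "\<lambda>e. p e q" E] q(2) E by fastforce
    have key: "(\<Sum>i\<le>n. r i q * \<xi> ^ i) = 0"
      if "\<And>i. r i \<in> poly_functions C" "\<And>x. x \<in> S \<Longrightarrow> (\<Sum>i\<le>n. r i x * t x ^ i) = 0" for n r
      using that
    proof (induction n arbitrary: r rule: less_induct)
      case (less n)
      show ?case
      proof (cases "n < E")
        case True
        have "r i q = 0" if "i \<le> n" for i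
          using satisfies_relationsD[OF q(1) less.prems(1)] low[OF less.prems True that] by blast
        then show ?thesis by simp
      next
        case False
        define d where "d = n - E"
        have n: "n = E + d" using False by (simp add: d_def)
        obtain n' where n': "n = Suc n'" using E n by (metis add_is_0 not0_implies_Suc)
        \<comment> \<open>The pseudo-remainder step: cross-multiplication by the leading
          coefficients cancels the term of degree \<open>n\<close>.\<close>
        define r' where "r' = (\<lambda>i x. p E x * r i x - r n x * (if d \<le> i then p (i - d) x else 0))"
        have eq: "(\<Sum>i\<le>n'. r' i x * z ^ i) = p E x * (\<Sum>i\<le>n. r i x * z ^ i) - r n x * (z ^ d *
          (\<Sum>e\<le>E. p e x * z ^ e))" for x z
        proof -
          have "r' n x = 0" using n by (simp add: r'_def)
          then have "(\<Sum>i\<le>n'. r' i x * z ^ i) = (\<Sum>i\<le>n. r' i x * z ^ i)" by (simp add: n')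
          also have "\<dots> = p E x * (\<Sum>i\<le>n. r i x * z ^ i) - r n x * (\<Sum>i\<le>n. (if d \<le> i then p (i
            - d) x else 0) * z ^ i)"
            by (simp add: r'_def left_diff_distrib sum_subtractf sum_distrib_left mult.assoc)
          also have "(\<Sum>i\<le>n. (if d \<le> i then p (i - d) x else 0) * z ^ i) = z ^ d * (\<Sum>e\<le>E. p e x * z ^ e)"
            unfolding n by (rule sum_power_shift)
          finally show ?thesis .
        qed
        \<comment> \<open>The induction hypothesis wants polynomial functions at every index, but
          beyond \<open>n'\<close> the entry \<open>p (i - d)\<close> may lie outside the equation;
          those coefficients are set to 0.\<close>
        define r'' where "r'' = (\<lambda>i. if i \<le> n' then r' i else (\<lambda>_. 0))"
        have "(\<Sum>i\<le>n'. r'' i q * \<xi> ^ i) = 0"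
        proof (rule less.IH)
          show "n' < n" by (simp add: n')
          show "r'' i \<in> poly_functions C" for i
          proof (cases "i \<le> n'")
            case True
            then have "i - d \<le> E" using n n' by simp
            then have "(\<lambda>x. if d \<le> i then p (i - d) x else 0) \<in> poly_functions C"
              using pC by (cases "d \<le> i") (auto intro: poly_functions.const)
            then have "r' i \<in> poly_functions C" unfolding r'_def
              by (intro poly_functions_diff poly_functions.mult less.prems(1) pC) auto
            with True show ?thesis by (simp add: r''_def)
          qed (simp add: r''_def poly_functions.const)
          show "(\<Sum>i\<le>n'. r'' i x * t x ^ i) = 0" if "x \<in> S" for x
            using eq[of x "t x"] less.prems(2)[OF that] p0[OF that] by (simp add: r''_def)
        qed
        then have "p E q * (\<Sum>i\<le>n. r i q * \<xi> ^ i) = 0"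
          using eq[of q \<xi>] \<xi> by (simp add: r''_def)
        then show ?thesis using q(2) by simp
      qed
    qed
    show "\<exists>\<xi>. \<forall>q'. (\<forall>w\<in>poly_functions C. w q' = w q) \<longrightarrow> t q' = \<xi> \<longrightarrow> satisfies_relations (insert t C) S q'"
    proof (intro exI[of _ \<xi>] allI impI)
      fix q' assume q': "\<forall>w\<in>poly_functions C. w q' = w q" "t q' = \<xi>"
      show "satisfies_relations (insert t C) S q'" unfolding satisfies_relations_def
      proof (intro ballI impI)
        fix w assume w: "w \<in> poly_functions (insert t C)" "\<forall>x\<in>S. w x = 0"
        obtain n r where r: "\<And>j. r j \<in> poly_functions C" "w = (\<lambda>x. \<Sum>j\<le>n. r j x * t x ^ j)"
          using poly_functions_insert[OF w(1)] by metis
        have "(\<Sum>j\<le>n. r j q * \<xi> ^ j) = 0" by (rule key[OF r(1)]) (use w(2) r(2) in auto)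
        moreover have "r j q' = r j q" for j using r(1) q'(1) by blast
        ultimately show "w q' = 0" using r(2) q'(2) by simp
      qed
    qed
  qed (use pE pC in auto)
qed

text \<open>A generic extension theorem: when the parameters are algebraic over the base, each of
  them can be chosen in turn as long as a leading coefficient does not vanish. All these conditions,
  and \<open>v \<noteq> 0\<close> at the end, are gathered into one nonvanishing condition
  \<open>b\<close> on the base point.\<close>

lemma exists_lift:
  fixes C :: "('a \<Rightarrow> complex) set"
  assumes pr: "prime_on (poly_functions (coords_ext C s)) S"
    and alg: "\<And>w. w \<in> poly_functions (coords_ext C s) \<Longrightarrow> algebraic_over (coords_ext C 0) S w"
    and v: "v \<in> poly_functions (coords_ext C s)" "\<exists>x\<in>S. v x \<noteq> 0"
  shows "\<exists>b\<in>poly_functions C. (\<exists>x\<in>S. b (fst x) \<noteq> 0) \<and>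
    (\<forall>g. satisfies_relations C (fst ` S) g \<longrightarrow> b g \<noteq> 0 \<longrightarrow>
      (\<exists>\<tau>. satisfies_relations (coords_ext C s) S (g, \<tau>) \<and> v (g, \<tau>) \<noteq> 0))"
proof -
  have step: "\<exists>b\<in>poly_functions (coords_ext C 0). (\<exists>x\<in>S. b x \<noteq> 0) \<and>
    (\<forall>g \<tau>. satisfies_relations (coords_ext C 0) S (g, \<tau>) \<longrightarrow> b (g, \<tau>) \<noteq> 0 \<longrightarrow>
      (\<exists>\<tau>'. satisfies_relations (coords_ext C j) S (g, \<tau>')))" if "j \<le> s" for j
    using that
  proof (induction j)
    case 0
    show ?case using pr by (intro bexI[of _
      "\<lambda>_. 1"]) (auto intro: poly_functions.const simp: prime_on_def)
  next
    case (Suc j)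
    then obtain b where b: "b \<in> poly_functions (coords_ext C 0)" "\<exists>x\<in>S. b x \<noteq> 0"
      and lift: "\<And>g \<tau>. satisfies_relations (coords_ext C 0) S (g, \<tau>) \<Longrightarrow> b (g, \<tau>) \<noteq> 0 \<Longrightarrow>
      (\<exists>\<tau>'. satisfies_relations (coords_ext C j) S (g, \<tau>'))" by (auto simp: Suc_le_eq)
    let ?t = "\<lambda>q::'a \<times> (nat \<Rightarrow> complex). snd q j"
    have "?t \<in> poly_functions (coords_ext C s)"
      using Suc.prems by (intro poly_functions.coord) (auto simp: coords_ext_def)
    then have "algebraic_over (coords_ext C j) S ?t"
      by (rule algebraic_over_mono[OF alg]) (simp add: coords_ext_mono)
    from extend_point[OF this] obtain a where a: "a \<in> poly_functions (coords_ext C j)" "\<exists>x\<in>S. a x \<noteq> 0"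
      and ext: "\<And>q. satisfies_relations (coords_ext C j) S q \<Longrightarrow> a q \<noteq> 0 \<Longrightarrow>
      (\<exists>\<xi>. \<forall>q'. (\<forall>w\<in>poly_functions (coords_ext C j). w q' = w q) \<longrightarrow> ?t q' = \<xi> \<longrightarrow>
        satisfies_relations (coords_ext C (Suc j)) S q')"
      unfolding coords_ext_Suc by blast
    have as: "a \<in> poly_functions (coords_ext C s)"
      using a(1) Suc.prems by (auto intro: poly_functions_mono[OF _ coords_ext_mono])
    \<comment> \<open>The leading coefficient \<open>a\<close> may involve parameters already
      chosen; \<open>c\<close> depends on the base point alone and keeps \<open>a\<close> from
      vanishing at every lift.\<close>
    obtain c where c: "c \<in> poly_functions (coords_ext C 0)" "\<exists>x\<in>S. c x \<noteq> 0"
      and nv: "\<And>C' q. coords_ext C 0 \<subseteq> C' \<Longrightarrow> a \<in> poly_functions C' \<Longrightarrow> satisfies_relations C' S q \<Longrightarrow>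
        c q \<noteq> 0 \<Longrightarrow> a q \<noteq> 0"
      using exists_nonvanishing_multiple[OF pr as a(2) alg[OF as] coords_ext_mono[OF le0]] by blast
    have sub: "u \<in> poly_functions (coords_ext C s)" if "u \<in> poly_functions (coords_ext C 0)" for u
      using poly_functions_mono[OF that coords_ext_mono] by simp
    show ?case
    proof (intro bexI[of _ "\<lambda>x. b x * c x"] conjI allI impI)
      show "\<exists>x\<in>S. b x * c x \<noteq> 0"
      proof (rule ccontr)
        assume "\<not> ?thesis"
        then show False using prime_onD[OF pr sub[OF b(1)] sub[OF c(1)]] b(2) c(2) by blast
      qed
      fix g \<tau> assume g: "satisfies_relations (coords_ext C 0) S (g, \<tau>)" "b (g, \<tau>) * c (g, \<tau>) \<noteq> 0"
      then obtain \<tau>' where \<tau>': "satisfies_relations (coords_ext C j) S (g, \<tau>')" using lift by auto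
      have "c (g, \<tau>') \<noteq> 0" using g(2) coords_ext_cong[OF c(1), of \<tau> \<tau>' g] by simp
      then have "a (g, \<tau>') \<noteq> 0" using nv[OF coords_ext_mono a(1) \<tau>'] by simp
      from ext[OF \<tau>' this] obtain \<xi> where \<xi>: "\<And>q'. (\<forall>w\<in>poly_functions (coords_ext C j). w q' =
        w (g, \<tau>')) \<Longrightarrow> ?t q' = \<xi> \<Longrightarrow>
        satisfies_relations (coords_ext C (Suc j)) S q'" by blast
      have "satisfies_relations (coords_ext C (Suc j)) S (g, \<tau>'(j := \<xi>))"
        by (rule \<xi>) (auto intro: coords_ext_cong)
      then show "\<exists>\<tau>'. satisfies_relations (coords_ext C (Suc j)) S (g, \<tau>')" by blast
    qed (intro poly_functions.mult b c)
  qed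
  obtain b where b: "b \<in> poly_functions (coords_ext C 0)" "\<exists>x\<in>S. b x \<noteq> 0"
    and lift: "\<And>g \<tau>. satisfies_relations (coords_ext C 0) S (g, \<tau>) \<Longrightarrow> b (g, \<tau>) \<noteq> 0 \<Longrightarrow>
    (\<exists>\<tau>'. satisfies_relations (coords_ext C s) S (g, \<tau>'))" using step[OF order_refl] by auto
  obtain c where c: "c \<in> poly_functions (coords_ext C 0)" "\<exists>x\<in>S. c x \<noteq> 0"
    and nv: "\<And>C' q. coords_ext C 0 \<subseteq> C' \<Longrightarrow> v \<in> poly_functions C' \<Longrightarrow> satisfies_relations C' S q \<Longrightarrow>
      c q \<noteq> 0 \<Longrightarrow> v q \<noteq> 0"
    using exists_nonvanishing_multiple[OF pr v alg[OF v(1)] coords_ext_mono[OF le0]] by blast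
  have sub: "u \<in> poly_functions (coords_ext C s)" if "u \<in> poly_functions (coords_ext C 0)" for u
    using poly_functions_mono[OF that coords_ext_mono] by simp
  \<comment> \<open>Functions in \<open>coords_ext C 0\<close> ignore the second component, so the
    zero function is a dummy argument.\<close>
  define d where "d = (\<lambda>g. b (g, \<lambda>_. 0) * c (g, \<lambda>_. 0))"
  have base: "(\<lambda>g. u (g, \<lambda>_. 0)) \<in> poly_functions C" if "u \<in> poly_functions (coords_ext C 0)" for u
    by (rule poly_functions_compose[OF that]) (auto simp: coords_ext_def intro: poly_functions.coord)
  have d: "d (fst x) = b x * c x" for x
    using coords_ext_cong[OF b(1), of "snd x" "\<lambda>_. 0" "fst x"] coords_ext_cong[OF c(1), of "snd x"
      "\<lambda>_. 0" "fst x"]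
    by (simp add: d_def)
  show ?thesis
  proof (intro bexI[of _ d] conjI allI impI)
    show "d \<in> poly_functions C" unfolding d_def by (intro poly_functions.mult base b c)
    show "\<exists>x\<in>S. d (fst x) \<noteq> 0"
    proof (rule ccontr)
      assume "\<not> ?thesis"
      then have "b x * c x = 0" if "x \<in> S" for x using that d by metis
      then show False using prime_onD[OF pr sub[OF b(1)] sub[OF c(1)]] b(2) c(2) by blast
    qed
    fix g assume g: "satisfies_relations C (fst ` S) g" "d g \<noteq> 0"
    have "satisfies_relations (coords_ext C 0) S (g, \<lambda>_. 0)" unfolding satisfies_relations_def
    proof (intro ballI impI)
      fix w assume w: "w \<in> poly_functions (coords_ext C 0)" "\<forall>x\<in>S. w x = 0"
      show "w (g, \<lambda>_. 0) = 0"
      proof (rule satisfies_relationsD[OF g(1) base[OF w(1)]])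
        fix x assume "x \<in> fst ` S"
        then obtain \<tau> where "(x, \<tau>) \<in> S" by auto
        then show "w (x, \<lambda>_. 0) = 0" using w(2) coords_ext_cong[OF w(1), of \<tau> "\<lambda>_. 0" x] by auto
      qed
    qed
    moreover have "b (g, \<lambda>_. 0) \<noteq> 0" using g(2) by (simp add: d_def)
    ultimately obtain \<tau> where \<tau>: "satisfies_relations (coords_ext C s) S (g, \<tau>)" using lift by blast
    have "c (g, \<tau>) \<noteq> 0" using g(2) coords_ext_cong[OF c(1), of "\<lambda>_. 0" \<tau> g] by (simp add: d_def)
    then have "v (g, \<tau>) \<noteq> 0" using nv[OF coords_ext_mono v(1) \<tau>] by simp
    with \<tau> show "\<exists>\<tau>. satisfies_relations (coords_ext C s) S (g, \<tau>) \<and> v (g, \<tau>) \<noteq> 0" by blast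
  qed
qed

section \<open>Forms and sums of squares\<close>

definition monoms :: "nat \<Rightarrow> nat \<Rightarrow> (nat \<Rightarrow>\<^sub>0 nat) set" where
  "monoms n d = {a. Poly_Mapping.keys a \<subseteq> {0..n} \<and> (\<Sum>i=0..n. Poly_Mapping.lookup a i) = d}"

lemma monoms_lookup_0:
  assumes "a \<in> monoms n d" "\<not> i \<le> n"
  shows "Poly_Mapping.lookup a i = 0"
proof -
  have "i \<notin> Poly_Mapping.keys a" using assms by (auto simp: monoms_def)
  then show ?thesis by (simp add: in_keys_iff)
qed

text \<open>The exponents form a list of length \<open>Suc n\<close> with sum \<open>d\<close>, for
  which the stars-and-bars count is known.\<close>

lemma bij_monoms:
  "bij_betw (\<lambda>a. map (Poly_Mapping.lookup a) [0..<Suc n]) (monoms n d) {l. length l = Suc n \<and>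
    sum_list l = d}"
proof (rule bij_betw_imageI)
  show "inj_on (\<lambda>a. map (Poly_Mapping.lookup a) [0..<Suc n]) (monoms n d)"
  proof (rule inj_onI, rule poly_mapping_eqI)
    fix a b i assume ab: "a \<in> monoms n d" "b \<in> monoms n d"
      "map (Poly_Mapping.lookup a) [0..<Suc n] = map (Poly_Mapping.lookup b) [0..<Suc n]"
    show "Poly_Mapping.lookup a i = Poly_Mapping.lookup b i"
    proof (cases "i \<le> n")
      case True
      then show ?thesis using ab(3) by (cases "i = n") auto
    next
      case False
      then show ?thesis using monoms_lookup_0 ab(1,2) by simp
    qed
  qed
  show "(\<lambda>a. map (Poly_Mapping.lookup a) [0..<Suc n]) ` monoms n d = {l. length l = Suc n \<and>
    sum_list l = d}"
  proof (intro equalityI subsetI)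
    fix l assume "l \<in> (\<lambda>a. map (Poly_Mapping.lookup a) [0..<Suc n]) ` monoms n d"
    then show "l \<in> {l. length l = Suc n \<and> sum_list l = d}"
      by (auto simp: monoms_def interv_sum_list_conv_sum_set_nat atLeastLessThanSuc_atLeastAtMost simp
        del: upt_Suc)
  next
    fix l :: "nat list" assume l: "l \<in> {l. length l = Suc n \<and> sum_list l = d}"
    define a where "a = Poly_Mapping.Abs_poly_mapping (\<lambda>i. if i \<le> n then l ! i else 0)"
    have "finite {i. (if i \<le> n then l ! i else 0) \<noteq> 0}"
      by (rule finite_subset[of _ "{..n}"]) auto
    then have a: "Poly_Mapping.lookup a i = (if i \<le> n then l ! i else 0)" for i
      unfolding a_def by (simp add: lookup_Abs_poly_mapping)
    have "map (Poly_Mapping.lookup a) [0..<Suc n] = l"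
      using l by (intro nth_equalityI) (auto simp: a simp del: upt_Suc)
    moreover have "a \<in> monoms n d"
      using l by (auto simp: monoms_def a in_keys_iff sum_list_sum_nth
        atLeastLessThanSuc_atLeastAtMost split: if_splits)
    ultimately show "l \<in> (\<lambda>a. map (Poly_Mapping.lookup a) [0..<Suc n]) ` monoms n d" by force
  qed
qed

lemma card_monoms: "card (monoms n d) = (n + d) choose n"
proof -
  have "card (monoms n d) = (d + n) choose d"
    using bij_betw_same_card[OF bij_monoms[of n d]] card_length_sum_list[of "Suc n" d] by simp
  then show ?thesis using binomial_symmetric[of d "d + n"] by (simp add: add.commute)
qed

lemma finite_monoms: "finite (monoms n d)"
proof (rule card_ge_0_finite)
  show "0 < card (monoms n d)" by (simp add: card_monoms)
qed

lemma monoms_add: "a \<in> monoms n d \<Longrightarrow> b \<in> monoms n e \<Longrightarrow> a + b \<in> monoms n (d + e)"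
  using keys_add[of a b] by (auto simp: monoms_def lookup_add sum.distrib)

lemma single_monoms: "j \<le> n \<Longrightarrow> Poly_Mapping.single j d \<in> monoms n d"
  by (auto simp: monoms_def lookup_single when_def)

lemma Sym_iff: "p \<in> Sym n d \<longleftrightarrow> (\<forall>a. a \<notin> monoms n d \<longrightarrow> Poly_Mapping.lookup p a = 0)"
  by (auto simp: Sym_def monoms_def in_keys_iff)

lemma Sym_add: "p \<in> Sym n d \<Longrightarrow> q \<in> Sym n d \<Longrightarrow> p + q \<in> Sym n d"
  by (simp add: Sym_iff lookup_add)

lemma Sym_diff: "p \<in> Sym n d \<Longrightarrow> q \<in> Sym n d \<Longrightarrow> p - q \<in> Sym n d"
  by (simp add: Sym_iff lookup_minus)

lemma Sym_sum: "(\<And>i. i \<in> I \<Longrightarrow> p i \<in> Sym n d) \<Longrightarrow> (\<Sum>i\<in>I. p i) \<in> Sym n d"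
  by (simp add: Sym_iff lookup_sum)

lemma Sym_mult: "p \<in> Sym n d \<Longrightarrow> q \<in> Sym n e \<Longrightarrow> p * q \<in> Sym n (d + e)"
  using keys_mult[of p q] monoms_add unfolding Sym_iff by (force simp: in_keys_iff)

lemma lookup_single_mult: "Poly_Mapping.lookup (Poly_Mapping.single 0 c * p) a =
  (c::complex) * Poly_Mapping.lookup p a"
  unfolding mult_map_scale_conv_mult[symmetric] by (simp add: Poly_Mapping.map.rep_eq when_def)

lemma Sym_single_mult: "p \<in> Sym n d \<Longrightarrow> Poly_Mapping.single 0 c * p \<in> Sym n d"
  by (simp add: Sym_iff lookup_single_mult)

abbreviation coeffs :: "(cpoly \<Rightarrow> complex) set" where
  "coeffs \<equiv> {\<lambda>p. Poly_Mapping.lookup p a | a. True}"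

abbreviation tuple_coeffs :: "nat \<Rightarrow> ((nat \<Rightarrow> cpoly) \<Rightarrow> complex) set" where
  "tuple_coeffs k \<equiv> {\<lambda>f. Poly_Mapping.lookup (f i) a | i a. i \<in> {1..k}}"

definition tuple_of :: "nat \<Rightarrow> nat \<Rightarrow> nat \<Rightarrow> (nat \<times> (nat \<Rightarrow>\<^sub>0 nat) \<Rightarrow> complex) \<Rightarrow> nat \<Rightarrow> cpoly" where
  "tuple_of n d k c = (\<lambda>i\<in>{1..k}. \<Sum>a\<in>monoms n d. Poly_Mapping.single a (c (i, a)))"

definition sum_squares :: "nat \<Rightarrow> (nat \<Rightarrow> cpoly) \<Rightarrow> cpoly" where
  "sum_squares k f = (\<Sum>i=1..k. (f i)\<^sup>2)"

lemma lookup_tuple_of: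
  "i \<in> {1..k} \<Longrightarrow> Poly_Mapping.lookup (tuple_of n d k c i) a = (if a \<in> monoms n d then c (i, a) else 0)"
  by (simp add: tuple_of_def lookup_sum lookup_single when_def finite_monoms)

lemma tuple_of_in: "tuple_of n d k c \<in> Sym_tuples n d k"
  unfolding Sym_tuples_def by (auto simp: Sym_iff lookup_tuple_of) (auto simp: tuple_of_def)

lemma tuple_of_lookup:
  assumes "f \<in> Sym_tuples n d k"
  shows "tuple_of n d k (\<lambda>(i, a). Poly_Mapping.lookup (f i) a) = f"
proof (rule PiE_ext)
  show "f \<in> {1..k} \<rightarrow>\<^sub>E Sym n d" "tuple_of n d k (\<lambda>(i, a). Poly_Mapping.lookup (f i) a) \<in> {1..k} \<rightarrow>\<^sub>E
    Sym n d"
    using assms tuple_of_in by (auto simp: Sym_tuples_def)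
  fix i assume i: "i \<in> {1..k}"
  then have "f i \<in> Sym n d" using assms by (auto simp: Sym_tuples_def)
  then show "tuple_of n d k (\<lambda>(i, a). Poly_Mapping.lookup (f i) a) i = f i"
    by (intro poly_mapping_eqI) (auto simp: lookup_tuple_of[OF i] Sym_iff)
qed

lemma tuple_of_cong:
  "(\<And>i a. i \<in> {1..k} \<Longrightarrow> a \<in> monoms n d \<Longrightarrow> c (i, a) = c' (i, a)) \<Longrightarrow> tuple_of n d k c = tuple_of n d k c'"
  unfolding tuple_of_def by (intro restrict_ext sum.cong) auto

lemma lookup_sum_squares_tuple_of:
  "Poly_Mapping.lookup (sum_squares k (tuple_of n d k c)) b =
    (\<Sum>i=1..k. \<Sum>a\<in>monoms n d. \<Sum>a'\<in>monoms n d. if a + a' = b then c (i, a) * c (i, a') else 0)"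
  by (simp add: sum_squares_def tuple_of_def power2_eq_square sum_product mult_single lookup_sum
    lookup_single when_def)

lemma sum_squares_in: "f \<in> Sym_tuples n d k \<Longrightarrow> sum_squares k f \<in> Sym n (2 * d)"
  unfolding sum_squares_def power2_eq_square mult_2
  by (intro Sym_sum Sym_mult) (auto simp: Sym_tuples_def)

lemma sum_squares_poly_functions:
  assumes "\<And>i a. i \<in> {1..k} \<Longrightarrow> a \<in> monoms n d \<Longrightarrow> (\<lambda>x. c x (i, a)) \<in> poly_functions P"
  shows "(\<lambda>x. Poly_Mapping.lookup (sum_squares k (tuple_of n d k (c x))) b) \<in> poly_functions P"
proof -
  have "(\<lambda>x. if a + a' = b then c x (i, a) * c x (i, a') else 0) \<in> poly_functions P"
    if "i \<in> {1..k}" "a \<in> monoms n d" "a' \<in> monoms n d" for i a a'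
    using assms that by (cases "a + a' = b") (auto intro: poly_functions.mult poly_functions.const)
  then show ?thesis
    unfolding lookup_sum_squares_tuple_of by (intro poly_functions_sum)
qed

lemma SOS_eq: "SOS n d k = zariski_closure coeffs (Sym n (2 * d)) (sum_squares k ` Sym_tuples n d k)"
proof -
  have "{(\<Sum>i=1..k. (f i)\<^sup>2) | f. f \<in> Sym_tuples n d k} = sum_squares k ` Sym_tuples n d k"
    by (auto simp: sum_squares_def)
  then show ?thesis unfolding SOS_def Sym_top_def
    using sum_squares_in by (simp only:) (rule closure_of_zariski, blast)
qed

lemma SOS_top_eq: "SOS_top n d k = zariski coeffs (SOS n d k)"
proof -
  have "SOS n d k \<subseteq> Sym n (2 * d)" by (auto simp: SOS_eq zariski_closure_def)
  then show ?thesis unfolding SOS_top_def Sym_top_def subtopology_zariski by (simp add: Int_absorb1)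
qed

lemma SOS_decompositions_top_eq:
  "SOS_decompositions_top n d k g = zariski (tuple_coeffs k) {f \<in> Sym_tuples n d k. sum_squares k f =
    g}"
proof -
  have "Sym_tuples n d k \<inter> SOS_decompositions n d k g = {f \<in> Sym_tuples n d k. sum_squares k f = g}"
    by (auto simp: SOS_decompositions_def sum_squares_def)
  then show ?thesis
    unfolding SOS_decompositions_top_def Sym_tuples_top_def subtopology_zariski by simp
qed

section \<open>Householder reflections and triangular tuples\<close>

lemma single_0_hom:
  fixes x y :: complex
  shows "Poly_Mapping.single 0 (x + y) = (Poly_Mapping.single 0 x + Poly_Mapping.single 0 y :: cpoly)"
    "Poly_Mapping.single 0 (x * y) = (Poly_Mapping.single 0 x * Poly_Mapping.single 0 y :: cpoly)"
    "Poly_Mapping.single 0 (sum h I) = (\<Sum>i\<in>I. Poly_Mapping.single 0 (h i) :: cpoly)"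
proof -
  show "Poly_Mapping.single 0 (sum h I) = (\<Sum>i\<in>I. Poly_Mapping.single 0 (h i) :: cpoly)"
    by (induction I rule: infinite_finite_induct) (auto simp: single_add)
qed (auto simp: single_add mult_single)

text \<open>The reflection acts on the index of the tuple with scalar coefficients, so it is
  orthogonal for forms as entries just as for numbers; \<open>w\<close> is the scalar product of the
  tuple with \<open>v\<close>.\<close>

lemma householder:
  fixes g :: "nat \<Rightarrow> cpoly" and v :: "nat \<Rightarrow> real"
  assumes "\<beta> = (\<Sum>l\<in>I. (v l)\<^sup>2)" "\<beta> \<noteq> 0"
  defines "w \<equiv> \<Sum>l\<in>I. Poly_Mapping.single 0 (complex_of_real (v l)) * g l"
  shows "(\<Sum>i\<in>I. (g i - Poly_Mapping.single 0 (complex_of_real (2 * v i / \<beta>)) * w)\<^sup>2) = (\<Sum>i\<in>I. (g i)\<^sup>2)"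
proof -
  let ?C = "\<lambda>x::real. Poly_Mapping.single 0 (complex_of_real x) :: cpoly"
  have C: "?C (x * y) = ?C x * ?C y" "?C (sum h I) = (\<Sum>i\<in>I. ?C (h i))" for x y h
    by (simp_all add: single_0_hom)
  have e1: "(\<Sum>i\<in>I. ?C (2 * v i / \<beta>) * g i) = ?C (2 / \<beta>) * w"
  proof -
    have "?C (2 * v i / \<beta>) = ?C (2 / \<beta>) * ?C (v i)" for i
      by (subst C(1)[symmetric]) (simp add: field_simps)
    then show ?thesis by (simp add: w_def sum_distrib_left mult.assoc)
  qed
  have e2: "(\<Sum>i\<in>I. (?C (2 * v i / \<beta>))\<^sup>2) = 2 * ?C (2 / \<beta>)"
  proof -
    have "(\<Sum>i\<in>I. (?C (2 * v i / \<beta>))\<^sup>2) = ?C (\<Sum>i\<in>I. (2 * v i / \<beta>) * (2 * v i / \<beta>))"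
      by (simp only: C power2_eq_square)
    also have "(\<Sum>i\<in>I. (2 * v i / \<beta>) * (2 * v i / \<beta>)) = 4 / \<beta>\<^sup>2 * \<beta>"
      unfolding assms(1) sum_distrib_left by (intro sum.cong) (auto simp: power2_eq_square field_simps)
    also have "\<dots> = 2 / \<beta> + 2 / \<beta>" using assms(2) by (simp add: power2_eq_square field_simps)
    also have "?C \<dots> = ?C (2 / \<beta>) + ?C (2 / \<beta>)" by (simp only: of_real_add single_0_hom)
    finally show ?thesis by simp
  qed
  have "(\<Sum>i\<in>I. (g i - ?C (2 * v i / \<beta>) * w)\<^sup>2) =
      (\<Sum>i\<in>I. (g i)\<^sup>2) - 2 * w * (\<Sum>i\<in>I. ?C (2 * v i / \<beta>) * g i) + w\<^sup>2 * (\<Sum>i\<in>I. (?C (2 * v i / \<beta>))\<^sup>2)"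
    by (simp add: power2_diff power_mult_distrib sum.distrib sum_subtractf sum_distrib_left mult_ac)
  also have "\<dots> = (\<Sum>i\<in>I. (g i)\<^sup>2)" unfolding e1 e2 by (simp add: power2_eq_square algebra_simps)
  finally show ?thesis .
qed

definition real_tuple :: "nat \<Rightarrow> (nat \<Rightarrow> cpoly) \<Rightarrow> bool" where
  "real_tuple k f \<longleftrightarrow> (\<forall>i\<in>{1..k}. \<forall>a. Poly_Mapping.lookup (f i) a \<in> \<real>)"

text \<open>The coefficients of \<open>a (Suc m)\<close> in the rows \<open>Suc m, ..., k\<close>
  form a real vector, which a reflection of these rows moves onto the first axis. Rows before
  \<open>Suc m\<close> stay as they are.\<close>

lemma triangularize_step:
  assumes g: "g \<in> Sym_tuples n d k" "real_tuple k g" "\<And>i j. 1 \<le> j \<Longrightarrow> j < i \<Longrightarrow> i \<le> k \<Longrightarrow> j \<le> m \<Longrightarrow>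
    Poly_Mapping.lookup (g i) (a j) = 0"
    and m: "Suc m \<le> k"
  shows "\<exists>g'\<in>Sym_tuples n d k. real_tuple k g' \<and> sum_squares k g' = sum_squares k g \<and>
    (\<forall>i j. 1 \<le> j \<longrightarrow> j < i \<longrightarrow> i \<le> k \<longrightarrow> j \<le> Suc m \<longrightarrow> Poly_Mapping.lookup (g' i) (a j) = 0)"
proof -
  define I where "I = {Suc m..k}"
  have I: "I \<subseteq> {1..k}" "Suc m \<in> I" "finite I" using m by (auto simp: I_def)
  define c where "c = (\<lambda>i. Re (Poly_Mapping.lookup (g i) (a (Suc m))))"
  have c: "Poly_Mapping.lookup (g i) (a (Suc m)) = complex_of_real (c i)" if "i \<in> I" for i
    using g(2) that I by (auto simp: real_tuple_def c_def complex_is_Real_iff complex_eq_iff)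
  \<comment> \<open>\<open>r\<close> is the length of the vector \<open>c\<close>, and
    \<open>v\<close> is \<open>c\<close> minus \<open>r\<close> times the first unit vector, the
    normal of the mirror that exchanges the two.\<close>
  define r where "r = sqrt (\<Sum>i\<in>I. (c i)\<^sup>2)"
  have r2: "r * r = (\<Sum>i\<in>I. (c i)\<^sup>2)" by (simp add: r_def sum_nonneg)
  define v where "v = (\<lambda>i. c i - (if i = Suc m then r else 0))"
  define \<beta> where "\<beta> = (\<Sum>i\<in>I. (v i)\<^sup>2)"
  show ?thesis
  proof (cases "\<beta> = 0")
    case True
    \<comment> \<open>This is where reality enters: a real vector with \<open>\<beta> = 0\<close> is
      zero, so the column already has the desired form.\<close>
    then have "\<forall>i\<in>I. (v i)\<^sup>2 = 0"
      unfolding \<beta>_def using I(3) by (subst (asm) sum_nonneg_eq_0_iff) auto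
    then have "c i = 0" if "i \<in> I" "i \<noteq> Suc m" for i using that by (auto simp: v_def)
    then have "Poly_Mapping.lookup (g i) (a j) = 0" if "1 \<le> j" "j < i" "i \<le> k" "j \<le> Suc m" for i j
      using that g(3)[of j i] c[of i] by (cases "j = Suc m") (auto simp: I_def)
    then show ?thesis using g by blast
  next
    case False
    define w where "w = (\<Sum>l\<in>I. Poly_Mapping.single 0 (complex_of_real (v l)) * g l)"
    define g' where "g' = (\<lambda>i\<in>{1..k}. if i \<in> I then g i - Poly_Mapping.single 0 (complex_of_real (2 *
      v i / \<beta>)) * w else g i)"
    have gS: "g i \<in> Sym n d" if "i \<in> {1..k}" for i using g(1) that by (auto simp: Sym_tuples_def)
    have wS: "w \<in> Sym n d" unfolding w_def by (intro Sym_sum Sym_single_mult gS) (use I in auto)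
    have lw: "Poly_Mapping.lookup w b = (\<Sum>l\<in>I. complex_of_real (v l) * Poly_Mapping.lookup (g l) b)"
      for b
      by (simp add: w_def lookup_sum lookup_single_mult)
    have lg': "Poly_Mapping.lookup (g' i) b = Poly_Mapping.lookup (g i) b -
        (if i \<in> I then complex_of_real (2 * v i / \<beta>) * Poly_Mapping.lookup w b else 0)" if
          "i \<in> {1..k}" for i b
      using that by (simp add: g'_def lookup_minus lookup_single_mult)
    have "g' \<in> Sym_tuples n d k" unfolding Sym_tuples_def g'_def
      by (auto intro!: gS Sym_diff Sym_single_mult wS)
    moreover have "real_tuple k g'"
    proof -
      have "Poly_Mapping.lookup w b \<in> \<real>" for b
        unfolding lw using g(2) I by (intro sum_in_Reals Reals_mult) (auto simp: real_tuple_def)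
      then show ?thesis using g(2) by (auto simp: real_tuple_def lg' intro!: Reals_diff Reals_mult)
    qed
    moreover have "sum_squares k g' = sum_squares k g"
    proof -
      have split: "sum_squares k h = (\<Sum>i\<in>I. (h i)\<^sup>2) + (\<Sum>i\<in>{1..k} - I. (h i)\<^sup>2)" for h
        unfolding sum_squares_def using sum.subset_diff[OF I(1), of "\<lambda>i. (h i)\<^sup>2"]
          by (simp add: add.commute)
      have "(\<Sum>i\<in>I. (g' i)\<^sup>2) = (\<Sum>i\<in>I. (g i - Poly_Mapping.single 0 (complex_of_real (2 * v i / \<beta>)) *
        w)\<^sup>2)"
        by (rule sum.cong) (use I(1) in \<open>auto simp: g'_def\<close>)
      also have "\<dots> = (\<Sum>i\<in>I. (g i)\<^sup>2)"
        unfolding w_def by (rule householder[OF \<beta>_def False])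
      finally have "(\<Sum>i\<in>I. (g' i)\<^sup>2) = (\<Sum>i\<in>I. (g i)\<^sup>2)" .
      moreover have "(\<Sum>i\<in>{1..k} - I. (g' i)\<^sup>2) = (\<Sum>i\<in>{1..k} - I. (g i)\<^sup>2)"
        by (rule sum.cong) (auto simp: g'_def)
      ultimately show ?thesis by (simp add: split)
    qed
    moreover have "Poly_Mapping.lookup (g' i) (a j) = 0" if ij: "1 \<le> j" "j < i" "i \<le> k" "j \<le> Suc m"
      for i j
    proof (cases "j = Suc m")
      case False
      \<comment> \<open>The columns treated before vanish on all rows of \<open>I\<close>, so the
        reflection leaves their zeros intact.\<close>
      then have "Poly_Mapping.lookup w (a j) = 0"
        unfolding lw using ij g(3) by (intro sum.neutral) (auto simp: I_def)
      then show ?thesis using lg' ij False g(3) by simp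
    next
      case True
      \<comment> \<open>Since \<open>c\<close> and its target have the same length, both sides equal
        \<open>r * r - r * c (Suc m)\<close>. Subtracting \<open>2 / \<beta>\<close> times this
        multiple of \<open>v\<close> then subtracts exactly \<open>v\<close>.\<close>
      have vc: "(\<Sum>l\<in>I. v l * c l) = \<beta> / 2"
      proof -
        have d: "(\<Sum>l\<in>I. (if l = Suc m then r else 0) * h l) = r * h (Suc m)" for h
          using I by (simp add: if_distrib[of "\<lambda>x. x * _"] cong: if_cong)
        have "(\<Sum>l\<in>I. v l * c l) = r * r - r * c (Suc m)"
          unfolding r2 v_def left_diff_distrib sum_subtractf d by (simp add: power2_eq_square)
        moreover have "\<beta> = (\<Sum>l\<in>I. v l * c l) - (\<Sum>l\<in>I. (if l = Suc m then r else 0) * v l)"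
          by (simp add: \<beta>_def v_def power2_eq_square algebra_simps flip: sum_subtractf)
        ultimately show ?thesis unfolding d by (simp add: v_def algebra_simps)
      qed
      have i: "i \<in> I" "i \<noteq> Suc m" using ij True by (auto simp: I_def)
      have w: "Poly_Mapping.lookup w (a j) = complex_of_real (\<Sum>l\<in>I. v l * c l)"
        unfolding lw True by (simp add: c)
      have "i \<in> {1..k}" using i I by blast
      then have "Poly_Mapping.lookup (g' i) (a j) =
          complex_of_real (c i) - complex_of_real (2 * v i / \<beta>) * complex_of_real (\<Sum>l\<in>I. v l * c l)"
        using lg'[of i "a j"] c[OF i(1)] i(1) w True by (simp only: if_True)
      also have "\<dots> = complex_of_real (c i - 2 * v i / \<beta> * (\<beta> / 2))"
        by (simp only: vc of_real_diff of_real_mult)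
      also have "c i - 2 * v i / \<beta> * (\<beta> / 2) = 0" using False i by (simp add: v_def)
      finally show ?thesis by simp
    qed
    ultimately show ?thesis by blast
  qed
qed

lemma triangularize:
  assumes "f \<in> Sym_tuples n d k" "real_tuple k f"
  shows "\<exists>g\<in>Sym_tuples n d k. sum_squares k g = sum_squares k f \<and>
    (\<forall>i j. 1 \<le> j \<longrightarrow> j < i \<longrightarrow> i \<le> k \<longrightarrow> Poly_Mapping.lookup (g i) (a j) = 0)"
proof -
  have "\<exists>g\<in>Sym_tuples n d k. real_tuple k g \<and> sum_squares k g = sum_squares k f \<and>
    (\<forall>i j. 1 \<le> j \<longrightarrow> j < i \<longrightarrow> i \<le> k \<longrightarrow> j \<le> m \<longrightarrow> Poly_Mapping.lookup (g i) (a j) = 0)" if "m \<le> k" for m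
    using that
  proof (induction m)
    case 0
    show ?case using assms by (intro bexI[of _ f]) auto
  next
    case (Suc m)
    then obtain g where g: "g \<in> Sym_tuples n d k" "real_tuple k g" "sum_squares k g = sum_squares k f"
      "\<And>i j. 1 \<le> j \<Longrightarrow> j < i \<Longrightarrow> i \<le> k \<Longrightarrow> j \<le> m \<Longrightarrow> Poly_Mapping.lookup (g i) (a j) = 0" by force
    from triangularize_step[OF g(1,2,4) Suc.prems] g(3) show ?case by simp
  qed
  from this[OF order_refl] obtain g where g: "g \<in> Sym_tuples n d k" "sum_squares k g = sum_squares k f"
    "\<forall>i j. 1 \<le> j \<longrightarrow> j < i \<longrightarrow> i \<le> k \<longrightarrow> j \<le> k \<longrightarrow> Poly_Mapping.lookup (g i) (a j) = 0" by blast
  then have "Poly_Mapping.lookup (g i) (a j) = 0" if "1 \<le> j" "j < i" "i \<le> k" for i j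
    using that by simp
  with g(1,2) show ?thesis by blast
qed

section \<open>The triangular slice\<close>

lemma card_pairs: "card {(j, i). 1 \<le> j \<and> j < i \<and> i \<le> (k::nat)} = k choose 2"
proof (induction k)
  case 0
  have "{(j, i). 1 \<le> j \<and> j < i \<and> i \<le> (0::nat)} = {}" by auto
  then have "card {(j, i). 1 \<le> j \<and> j < i \<and> i \<le> (0::nat)} = 0" by (simp only: card.empty)
  moreover have "(0::nat) choose 2 = 0" by (simp add: numeral_2_eq_2)
  ultimately show ?case by (simp only:)
next
  case (Suc k)
  have fin: "finite {(j, i). 1 \<le> j \<and> j < i \<and> i \<le> k}"
    by (rule finite_subset[of _ "{..k} \<times> {..k}"]) auto
  have U: "{(j, i). 1 \<le> j \<and> j < i \<and> i \<le> Suc k} = {(j, i). 1 \<le> j \<and> j < i \<and> i \<le> k} \<union> {1..k} \<times> {Suc k}"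
    by auto
  have "card {(j, i). 1 \<le> j \<and> j < i \<and> i \<le> Suc k} = card {(j, i). 1 \<le> j \<and> j < i \<and>
    i \<le> k} + card ({1..k} \<times> {Suc k})"
    unfolding U by (rule card_Un_disjoint[OF fin]) auto
  then have "card {(j, i). 1 \<le> j \<and> j < i \<and> i \<le> Suc k} = (k choose 2) + k"
    using Suc by simp
  then show ?case by (simp add: numeral_2_eq_2)
qed

lemma finite_pairs: "finite {(j, i). 1 \<le> j \<and> j < i \<and> i \<le> (k::nat)}"
  by (rule finite_subset[of _ "{..k} \<times> {..k}"]) auto

text \<open>A substitute for the translation by \<open>q\<close>: it is onto, has the identity as
  differential at 0, and its entries lie in the ring generated by \<open>trig\<close>.\<close>

definition shifted_sin :: "(nat \<Rightarrow> complex) \<Rightarrow> (nat \<Rightarrow> complex) \<Rightarrow> nat \<Rightarrow> complex" where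
  "shifted_sin q x m = q m + sin (x m)"

lemma shifted_sin_surj: "\<exists>x. shifted_sin q x = \<tau>"
  by (rule exI[of _ "\<lambda>m. Arcsin (\<tau> m - q m)"]) (auto simp: shifted_sin_def)

lemma range_shifted_sin: "range (\<lambda>x. h (shifted_sin q x)) = range h"
proof -
  have "range (shifted_sin q) = UNIV" using shifted_sin_surj by (metis surj_def)
  then show ?thesis using image_image[of h "shifted_sin q" UNIV] by simp
qed

lemma shifted_sin_trig: "m < s \<Longrightarrow> (\<lambda>x. shifted_sin q x m) \<in> poly_functions (trig s)"
  unfolding shifted_sin_def by (intro poly_functions.add poly_functions.const sin_trig)

text \<open>The coefficient of \<open>a j\<close> is eliminated from all entries after the
  \<open>j\<close>-th. There is nothing to eliminate after the last entry, so \<open>k - 1\<close>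
  monomials suffice.\<close>

locale slice =
  fixes n d k :: nat and a :: "nat \<Rightarrow> (nat \<Rightarrow>\<^sub>0 nat)"
  assumes a_monoms: "\<And>j. 1 \<le> j \<Longrightarrow> j < k \<Longrightarrow> a j \<in> monoms n d" and a_inj: "inj_on a {1..<k}"
begin

text \<open>The positions of the coefficients that remain free in a triangular tuple.\<close>

definition J :: "(nat \<times> (nat \<Rightarrow>\<^sub>0 nat)) set" where
  "J = {(i, b). i \<in> {1..k} \<and> b \<in> monoms n d \<and> (\<forall>j. 1 \<le> j \<longrightarrow> j < i \<longrightarrow> b \<noteq> a j)}"

definition idx :: "nat \<times> (nat \<Rightarrow>\<^sub>0 nat) \<Rightarrow> nat" where
  "idx = (SOME h. bij_betw h J {..<card J})"

definition tri :: "(nat \<Rightarrow> complex) \<Rightarrow> nat \<Rightarrow> cpoly" where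
  "tri \<tau> = tuple_of n d k (\<lambda>ia. if ia \<in> J then \<tau> (idx ia) else 0)"

lemma J_subset: "J \<subseteq> {1..k} \<times> monoms n d"
  by (auto simp: J_def)

lemma finite_J: "finite J"
  using finite_subset[OF J_subset] finite_monoms by simp

lemma bij_idx: "bij_betw idx J {..<card J}"
  unfolding idx_def using ex_bij_betw_finite_nat[OF finite_J]
  by (intro someI_ex[of "\<lambda>h. bij_betw h J {..<card J}"]) (simp add: atLeast0LessThan)

lemma idx_less: "ia \<in> J \<Longrightarrow> idx ia < card J"
  using bij_betwE[OF bij_idx] by auto

text \<open>Injectivity of \<open>a\<close> makes the removed positions \<open>(i, a j)\<close> with
  \<open>j < i\<close> distinct, one for each pair. The additive form avoids truncated
  subtraction.\<close>

lemma card_J: "card J + (k choose 2) = k * ((n + d) choose n)"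
proof -
  let ?P = "{(j, i). 1 \<le> j \<and> j < i \<and> i \<le> k}"
  let ?h = "\<lambda>(j, i). (i, a j)"
  have "inj_on ?h ?P"
    using inj_onD[OF a_inj] by (intro inj_onI) auto
  then have c: "card (?h ` ?P) = k choose 2" using card_image card_pairs by fastforce
  have U: "{1..k} \<times> monoms n d = J \<union> ?h ` ?P"
  proof (intro equalityI subsetI)
    fix x assume "x \<in> {1..k} \<times> monoms n d"
    then show "x \<in> J \<union> ?h ` ?P" by (force simp: J_def image_iff)
  qed (auto simp: J_def a_monoms)
  have D: "J \<inter> ?h ` ?P = {}" by (auto simp: J_def)
  have "card J + card (?h ` ?P) = card ({1..k} \<times> monoms n d)"
    unfolding U using D finite_J finite_pairs by (intro card_Un_disjoint[symmetric]) auto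
  then show ?thesis unfolding c by (simp add: card_cartesian_product card_monoms)
qed

lemma real_card_J: "real (card J) = real k * real ((n + d) choose n) - real (k choose 2)"
  unfolding of_nat_mult[symmetric] card_J[symmetric] by simp

lemma lookup_tri:
  assumes "i \<in> {1..k}"
  shows "Poly_Mapping.lookup (tri \<tau> i) b = (if (i, b) \<in> J then \<tau> (idx (i, b)) else 0)"
  using J_subset assms by (auto simp: tri_def lookup_tuple_of)

lemma tri_in: "tri \<tau> \<in> Sym_tuples n d k"
  unfolding tri_def by (rule tuple_of_in)

lemma tri_surj:
  assumes g: "g \<in> Sym_tuples n d k" "\<And>i j. 1 \<le> j \<Longrightarrow> j < i \<Longrightarrow> i \<le> k \<Longrightarrow> Poly_Mapping.lookup (g i) (a j) = 0"
  shows "\<exists>\<tau>. tri \<tau> = g"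
proof -
  let ?e = "the_inv_into J idx"
  define \<tau> where "\<tau> = (\<lambda>m. Poly_Mapping.lookup (g (fst (?e m))) (snd (?e m)))"
  have "tri \<tau> = tuple_of n d k (\<lambda>(i, b). Poly_Mapping.lookup (g i) b)"
    unfolding tri_def
  proof (rule tuple_of_cong)
    fix i b assume ib: "i \<in> {1..k}" "b \<in> monoms n d"
    have e: "?e (idx (i, b)) = (i, b)" if "(i, b) \<in> J"
      using bij_idx that by (simp add: bij_betw_def the_inv_into_f_f)
    show "(if (i, b) \<in> J then \<tau> (idx (i, b)) else 0) =
      (case (i, b) of (i, b) \<Rightarrow> Poly_Mapping.lookup (g i) b)"
    proof (cases "(i, b) \<in> J")
      case True
      then show ?thesis using e by (simp add: \<tau>_def)
    next
      case False
      then obtain j where "1 \<le> j" "j < i" "b = a j" using ib by (auto simp: J_def)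
      then show ?thesis using False g(2) ib by simp
    qed
  qed
  then show ?thesis using tuple_of_lookup[OF g(1)] by auto
qed

lemma tri_poly_functions:
  assumes "\<And>m. m < card J \<Longrightarrow> (\<lambda>x. T x m) \<in> poly_functions P"
  shows "(\<lambda>x. Poly_Mapping.lookup (sum_squares k (tri (T x))) b) \<in> poly_functions P"
  unfolding tri_def
proof (rule sum_squares_poly_functions)
  fix i b show "(\<lambda>x. if (i, b) \<in> J then T x (idx (i, b)) else 0) \<in> poly_functions P"
    using assms idx_less by (cases "(i, b) \<in> J") (auto intro: poly_functions.const)
qed

text \<open>A polynomial that vanishes on the real points vanishes everywhere, and a real tuple can be
  made triangular by Householder reflections.\<close>

lemma vanishes_on_sum_squares:
  assumes u: "u \<in> poly_functions coeffs" "\<And>\<tau>. u (sum_squares k (tri \<tau>)) = 0"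
    and f: "f \<in> Sym_tuples n d k"
  shows "u (sum_squares k f) = 0"
proof -
  have real: "u (sum_squares k g) = 0" if g: "g \<in> Sym_tuples n d k" "real_tuple k g" for g
  proof -
    obtain g' where g': "g' \<in> Sym_tuples n d k" "sum_squares k g' = sum_squares k g"
      "\<And>i j. 1 \<le> j \<Longrightarrow> j < i \<Longrightarrow> i \<le> k \<Longrightarrow> Poly_Mapping.lookup (g' i) (a j) = 0"
      using triangularize[OF g, of a] by blast
    then obtain \<tau> where "tri \<tau> = g'" using tri_surj by blast
    then show ?thesis using u(2)[of \<tau>] g'(2) by simp
  qed
  \<comment> \<open>A complex line of tuples that is real for real \<open>z\<close> and passes
    through \<open>f\<close> at \<open>z = \<i>\<close>.\<close>
  define c where "c = (\<lambda>z (i, b). complex_of_real (Re (Poly_Mapping.lookup (f i) b))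
    + z * complex_of_real (Im (Poly_Mapping.lookup (f i) b)))"
  define h where "h = (\<lambda>z. u (sum_squares k (tuple_of n d k (c z))))"
  have "(\<lambda>z. c z (i, b)) \<in> poly_functions {\<lambda>z. z}" for i b
    unfolding c_def prod.case
    by (intro poly_functions.add poly_functions.mult poly_functions.const poly_functions.coord) simp
  then have "h \<in> poly_functions {\<lambda>z. z}" unfolding h_def
    by (intro poly_functions_compose[OF u(1)]) (auto intro!: sum_squares_poly_functions)
  then have "(\<lambda>z. h (id z)) holomorphic_on UNIV"
    by (rule poly_functions_holomorphic) (auto intro: holomorphic_intros)
  then have hol: "h holomorphic_on UNIV" by simp
  have "h z = 0" if "z \<in> \<real>" for z
    unfolding h_def
  proof (rule real[OF tuple_of_in])
    show "real_tuple k (tuple_of n d k (c z))"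
      using that by (auto simp: real_tuple_def lookup_tuple_of c_def intro!: Reals_add Reals_mult)
  qed
  \<comment> \<open>The real axis has an accumulation point, so vanishing there spreads to
    \<open>\<i>\<close>.\<close>
  moreover have "0 islimpt (\<real> :: complex set)"
  proof (rule islimpt_approachable[THEN iffD2], intro allI impI)
    fix e :: real assume "e > 0"
    then show "\<exists>x'\<in>\<real>. x' \<noteq> (0::complex) \<and> dist x' 0 < e"
      by (intro bexI[of _ "complex_of_real (e / 2)"]) auto
  qed
  ultimately have "h \<i> = 0" using analytic_continuation[OF hol, of \<real> 0 \<i>] by auto
  moreover have "tuple_of n d k (c \<i>) = f"
  proof -
    have "c \<i> = (\<lambda>(i, b). Poly_Mapping.lookup (f i) b)"
      by (auto simp: c_def complex_eq_iff)
    then show ?thesis using tuple_of_lookup[OF f] by simp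
  qed
  ultimately show ?thesis by (simp add: h_def)
qed

text \<open>No complex tuple is triangularized here: both sets satisfy the same polynomial
  equations, which suffices for their closures.\<close>

lemma SOS_eq_closure_tri:
  "SOS n d k = zariski_closure coeffs (Sym n (2 * d)) (range (\<lambda>\<tau>. sum_squares k (tri \<tau>)))"
proof
  show "zariski_closure coeffs (Sym n (2 * d)) (range (\<lambda>\<tau>. sum_squares k (tri \<tau>))) \<subseteq> SOS n d k"
    unfolding SOS_eq by (rule zariski_closure_mono) (use tri_in in auto)
  show "SOS n d k \<subseteq> zariski_closure coeffs (Sym n (2 * d)) (range (\<lambda>\<tau>. sum_squares k (tri \<tau>)))"
    unfolding SOS_eq
  proof
    fix p assume p: "p \<in> zariski_closure coeffs (Sym n (2 * d)) (sum_squares k ` Sym_tuples n d k)"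
    have "u p = 0" if "u \<in> poly_functions coeffs" "\<forall>x\<in>range (\<lambda>\<tau>. sum_squares k (tri \<tau>)). u x = 0" for u
      using zariski_closure_zero[OF that(1) _ p] vanishes_on_sum_squares[OF that(1)] that(2) by auto
    with p show "p \<in> zariski_closure coeffs (Sym n (2 * d)) (range (\<lambda>\<tau>. sum_squares k (tri \<tau>)))"
      by (simp add: zariski_closure_def)
  qed
qed

lemma tri_trig:
  "u \<in> coeffs \<Longrightarrow> (\<lambda>x. u (sum_squares k (tri (shifted_sin q x)))) \<in> poly_functions (trig (card J))"
  by (auto intro!: tri_poly_functions shifted_sin_trig)

lemma krull_dim_SOS_le: "krull_dim (SOS_top n d k) \<le> ereal (real (card J))"
  unfolding SOS_top_eq
proof (rule krull_dim_zariski_le)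
  have "growth_le (card J) (range (\<lambda>x. sum_squares k (tri (shifted_sin (\<lambda>_. 0) x)))) coeffs"
    by (rule growth_le_range) (rule tri_trig)
  then show "growth_le (card J) (SOS n d k) coeffs"
    unfolding range_shifted_sin[of "\<lambda>\<tau>. sum_squares k (tri \<tau>)"] SOS_eq_closure_tri
    by (rule growth_le_closure)
qed

end

section \<open>The differential at the tuple of powers\<close>

lemma monoms_eq_single:
  assumes "b \<in> monoms n d" "i \<le> n" "d \<le> Poly_Mapping.lookup b i"
  shows "b = Poly_Mapping.single i d"
proof (rule poly_mapping_eqI)
  fix j
  have sum: "(\<Sum>i=0..n. Poly_Mapping.lookup b i) = d" using assms(1) by (simp add: monoms_def)
  have "(\<Sum>i=0..n. Poly_Mapping.lookup b i) = Poly_Mapping.lookup b i + (\<Sum>j\<in>{0..n}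
    - {i}. Poly_Mapping.lookup b j)"
    using assms(2) by (intro sum.remove) auto
  then have "(\<Sum>j\<in>{0..n} - {i}. Poly_Mapping.lookup b j) = 0" and bi: "Poly_Mapping.lookup b i = d"
    using sum assms(3) by auto
  then have "Poly_Mapping.lookup b j = 0" if "j \<noteq> i" "j \<le> n" using that by simp
  with bi show "Poly_Mapping.lookup b j = Poly_Mapping.lookup (Poly_Mapping.single i d) j"
    using monoms_lookup_0[OF assms(1), of j] by (cases "j = i"; cases
      "j \<le> n") (auto simp: lookup_single)
qed

locale power_slice =
  fixes n d k :: nat
  assumes k_le: "k \<le> n" "k \<le> ((n + d) choose n) + 1"
begin

sublocale slice n d k "\<lambda>j. Poly_Mapping.single j d"
proof
  show "Poly_Mapping.single j d \<in> monoms n d" if "1 \<le> j" "j < k" for j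
    using that k_le by (intro single_monoms) simp
  show "inj_on (\<lambda>j. Poly_Mapping.single j d) {1..<k}"
  proof (cases "d = 0")
    case True
    \<comment> \<open>For \<open>d = 0\<close> all powers coincide, but
      \<open>(n + 0) choose n = 1\<close> gives \<open>k \<le> 2\<close>, which leaves a single
      index.\<close>
    then have "{1..<k} \<subseteq> {1}" using k_le by auto
    then show ?thesis by (rule inj_on_subset[rotated]) simp
  next
    case False
    show ?thesis
    proof (rule inj_onI)
      fix i j :: nat assume "Poly_Mapping.single i d = Poly_Mapping.single j d"
      then have "Poly_Mapping.keys (Poly_Mapping.single i d) =
        Poly_Mapping.keys (Poly_Mapping.single j d)" by simp
      then show "i = j" using False by simp
    qed
  qed
qed

text \<open>The base point is the tuple \<open>(x\<^sub>1\<^sup>d, \<dots>, x\<^sub>k\<^sup>d)\<close>, projected to the slice (for \<open>d = 0\<close> and \<open>k = 2\<close>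
  the projection kills the second entry).\<close>

definition base :: "nat \<Rightarrow> complex" where
  "base m = (if \<exists>l. (l, Poly_Mapping.single l d) \<in> J \<and> idx (l, Poly_Mapping.single l d) =
    m then 1 else 0)"

lemma base_idx: "(i, b) \<in> J \<Longrightarrow> base (idx (i, b)) = (if b = Poly_Mapping.single i d then 1 else 0)"
  using bij_idx by (auto simp: base_def bij_betw_def dest: inj_onD)

text \<open>If \<open>l \<noteq> i\<close>, the equation forces \<open>b'\<close> to be the power of
  \<open>x_i\<close> and \<open>b\<close> the power of \<open>x_l\<close>. One of the two then sits
  at a position removed from the slice: the triangular shape cuts exactly this ambiguity.\<close>

lemma J_unique:
  assumes J: "(l, Poly_Mapping.single l d) \<in> J" "(l, b') \<in> J" "(i, b) \<in> J"
    and eq: "Poly_Mapping.single l d + b' = b + Poly_Mapping.single i d"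
  shows "l = i"
proof (rule ccontr)
  assume li: "l \<noteq> i"
  have le: "1 \<le> l" "l \<le> n" "1 \<le> i" "i \<le> n" and mon: "b \<in> monoms n d" "b' \<in> monoms n d"
    using J k_le by (auto simp: J_def)
  have "Poly_Mapping.lookup b' i = Poly_Mapping.lookup b i + d"
    using arg_cong[OF eq, of "\<lambda>p. Poly_Mapping.lookup p i"] li by (simp add: lookup_add lookup_single)
  then have b': "b' = Poly_Mapping.single i d" using monoms_eq_single[OF mon(2) le(4)] by simp
  have "Poly_Mapping.lookup b l = Poly_Mapping.lookup b' l + d"
    using arg_cong[OF eq, of "\<lambda>p. Poly_Mapping.lookup p l"] li by (simp add: lookup_add lookup_single)
  then have b: "b = Poly_Mapping.single l d" using monoms_eq_single[OF mon(1) le(2)] by simp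
  show False
  proof (cases "l < i")
    case True
    then show False using J(3) b le(1) by (auto simp: J_def)
  next
    case False
    then show False using J(2) b' le(3) li by (auto simp: J_def)
  qed
qed

text \<open>Only \<open>d = 0\<close> could cause trouble, where all powers are the monomial 1; but
  then \<open>b\<close> is this monomial as well and would be removed too.\<close>

lemma J_power:
  assumes "(i, b) \<in> J"
  shows "(i, Poly_Mapping.single i d) \<in> J"
proof -
  have i: "1 \<le> i" "i \<le> k" and b: "b \<in> monoms n d"
    and nb: "\<And>j. 1 \<le> j \<Longrightarrow> j < i \<Longrightarrow> b \<noteq> Poly_Mapping.single j d" using assms by (auto simp: J_def)
  have "Poly_Mapping.single i d \<noteq> Poly_Mapping.single j d" if j: "1 \<le> j" "j < i" for j
  proof
    assume eq: "Poly_Mapping.single i d = Poly_Mapping.single j d"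
    have "d = 0"
      using arg_cong[OF eq, of "\<lambda>p. Poly_Mapping.lookup p i"] j by (simp add: lookup_single)
    then have "b = Poly_Mapping.single j d" using monoms_eq_single[OF b, of j] j i k_le by simp
    with nb[OF j] show False by simp
  qed
  then show ?thesis using i k_le by (auto simp: J_def intro: single_monoms)
qed

text \<open>The differential at the base tuple sends a direction to twice the sum of the products of
  \<open>x_l^d\<close> with its entries. By \<open>J_unique\<close> every free coefficient can be
  read off from its own monomial of the result.\<close>

lemma tangent_tri:
  assumes m: "m < card J"
  shows "\<exists>w\<in>poly_functions coeffs. \<forall>x. ((\<lambda>z. w (sum_squares k (tri (shifted_sin base (\<lambda>j. z * x j)))))
    has_field_derivative x m) (at 0)"
proof -
  obtain i b where ib: "(i, b) \<in> J" "idx (i, b) = m"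
    using m bij_idx unfolding bij_betw_def by (metis imageE lessThan_iff surj_pair)
  \<comment> \<open>The monomial in which the free coefficient at \<open>(i, b)\<close> shows up. It
    arises in both orders of the two factors, which the factor \<open>1 / 2\<close> below
    compensates.\<close>
  define B where "B = b + Poly_Mapping.single i d"
  let ?M = "monoms n d"
  have iM: "i \<in> {1..k}" "b \<in> ?M" "Poly_Mapping.single i d \<in> ?M" using ib(1) J_power[OF ib(1)]
    by (auto simp: J_def)
  show ?thesis
  proof (intro bexI[of _ "\<lambda>p. 1 / 2 * Poly_Mapping.lookup p B"] allI)
    show "(\<lambda>p. 1 / 2 * Poly_Mapping.lookup p B) \<in> poly_functions coeffs"
      by (intro poly_functions_scale poly_functions.coord) blast
    fix x
    define c where "c = (\<lambda>z ia. if ia \<in> J then shifted_sin base (\<lambda>j. z * x j) (idx ia) else 0)"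
    define X where "X = (\<lambda>ia. if ia \<in> J then x (idx ia) else 0)"
    define q where "q = (\<lambda>ia. if ia \<in> J \<and> snd ia =
      Poly_Mapping.single (fst ia) d then 1 else 0 :: complex)"
    have dc: "((\<lambda>z. c z ia) has_field_derivative X ia) (at 0)" for ia
      unfolding c_def X_def shifted_sin_def by (cases "ia \<in> J") (auto intro!: derivative_eq_intros)
    have c0: "c 0 ia = q ia" for ia
      by (cases ia) (auto simp: c_def q_def shifted_sin_def base_idx)
    have dprod: "((\<lambda>z. if a + a' = B then c z (l, a) * c z (l, a') else 0) has_field_derivative
        (if a + a' = B then q (l, a) * X (l, a') else 0) + (if a' + a =
          B then q (l, a') * X (l, a) else 0)) (at 0)" for l a a'
      using DERIV_mult[OF dc[of "(l, a)"] dc[of "(l, a')"]] by (auto simp: c0 add.commute mult.commute)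
    have one: "(\<Sum>l=1..k. \<Sum>a\<in>?M. \<Sum>a'\<in>?M. if a + a' = B then q (l, a) * X (l, a') else 0) = x m"
    proof -
      \<comment> \<open>Of all products with monomial \<open>B\<close>, only that of
        \<open>x_i^d\<close> and \<open>b\<close> has both factors present.\<close>
      have "(if a + a' = B then q (l, a) * X (l, a') else 0) =
          (if l = i then if a = Poly_Mapping.single i d then if a' = b then x m else 0 else 0 else 0)"
            for l a a'
      proof (cases "a + a' = B \<and> (l, a) \<in> J \<and> a = Poly_Mapping.single l d \<and> (l, a') \<in> J")
        case True
        then have t: "(l, Poly_Mapping.single l d) \<in> J" "(l, a') \<in> J"
          "Poly_Mapping.single l d + a' = b + Poly_Mapping.single i d" by (auto simp: B_def)
        have "l = i" by (rule J_unique[OF t(1,2) ib(1) t(3)])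
        moreover have "a' = b" using t(3) unfolding \<open>l = i\<close> by (metis add.commute add_left_cancel)
        ultimately show ?thesis using True ib by (auto simp: q_def X_def)
      next
        case False
        have "\<not> (l = i \<and> a = Poly_Mapping.single i d \<and> a' = b)"
          using False ib(1) J_power[OF ib(1)] by (auto simp: B_def add.commute)
        then have "(if l = i then if a = Poly_Mapping.single i d then if a' =
          b then x m else 0 else 0 else 0) = 0"
          by simp
        moreover have "(if a + a' = B then q (l, a) * X (l, a') else 0) = 0"
        proof (cases "a + a' = B \<and> (l, a') \<in> J")
          case True
          then have "q (l, a) = 0" using False unfolding q_def fst_conv snd_conv by meson
          then show ?thesis by simp
        next
          case F: False
          then have "a + a' = B \<Longrightarrow> X (l, a') = 0" by (simp add: X_def)
          then show ?thesis by simp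
        qed
        ultimately show ?thesis by (simp only:)
      qed
      moreover have "(\<Sum>a\<in>?M. if P then g a else 0) = (if P then sum g ?M else 0)" for P and g ::
        "_ \<Rightarrow> complex"
        by (cases P) simp_all
      ultimately show ?thesis using iM finite_monoms by (simp add: sum.delta)
    qed
    have two: "(\<Sum>l=1..k. \<Sum>a\<in>?M. \<Sum>a'\<in>?M. if a' + a = B then q (l, a') * X (l, a) else 0) = x m"
      unfolding one[symmetric] by (intro sum.cong refl sum.swap)
    have "((\<lambda>z. Poly_Mapping.lookup (sum_squares k (tri (shifted_sin base (\<lambda>j. z * x j)))) B)
      has_field_derivative
      (\<Sum>l=1..k. \<Sum>a\<in>?M. \<Sum>a'\<in>?M. (if a + a' = B then q (l, a) * X (l, a') else 0) + (if a' + a =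
        B then q (l, a') * X (l, a) else 0))) (at 0)"
      unfolding tri_def lookup_sum_squares_tuple_of by (intro DERIV_sum dprod[unfolded c_def])
    then have "((\<lambda>z. Poly_Mapping.lookup (sum_squares k (tri (shifted_sin base (\<lambda>j. z * x j)))) B)
      has_field_derivative 2 * x m) (at 0)"
      unfolding sum.distrib one two by simp
    from DERIV_cmult[OF this, of "1 / 2"]
    show "((\<lambda>z. 1 / 2 * Poly_Mapping.lookup (sum_squares k (tri (shifted_sin base (\<lambda>j. z * x j)))) B)
      has_field_derivative x m) (at 0)"
      by simp
  qed
qed

lemma sum_squares_tri_in_SOS: "sum_squares k (tri \<tau>) \<in> SOS n d k"
proof -
  have "range (\<lambda>\<tau>. sum_squares k (tri \<tau>)) \<subseteq> Sym n (2 * d)" using sum_squares_in tri_in by blast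
  from subset_zariski_closure[OF this] show ?thesis unfolding SOS_eq_closure_tri by blast
qed

lemma krull_dim_SOS: "krull_dim (SOS_top n d k) = ereal (real (card J))"
proof (rule antisym[OF krull_dim_SOS_le])
  show "ereal (real (card J)) \<le> krull_dim (SOS_top n d k)"
    unfolding SOS_top_eq
    by (rule krull_dim_zariski_ge[where \<Psi> =
      "\<lambda>x. sum_squares k (tri (shifted_sin base x))", OF sum_squares_tri_in_SOS tri_trig tangent_tri])
qed

section \<open>Decompositions of a general point\<close>

lemma exists_algindep_coeffs:
  "\<exists>w. (\<forall>i<card J. w i \<in> poly_functions coeffs) \<and>
    algindep (range (\<lambda>\<tau>. sum_squares k (tri \<tau>))) {..<card J} w"
proof -
  obtain w where w: "\<forall>i<card J. w i \<in> poly_functions coeffs"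
    "\<forall>l\<le>card J. algindep (range (\<lambda>x. sum_squares k (tri (shifted_sin base (trunc l x))))) {..<l} w"
    using exists_algindep[where \<Psi> = "\<lambda>x. sum_squares k (tri (shifted_sin base x))", OF tangent_tri]
      by blast
  have "algindep (range (\<lambda>x. sum_squares k (tri (shifted_sin base (trunc (card J) x))))) {..<card J} w"
    using w(2) by simp
  then have "algindep (range (\<lambda>\<tau>. sum_squares k (tri \<tau>))) {..<card J} w"
    by (rule algindep_mono) auto
  with w(1) show ?thesis by blast
qed

lemma prime_on_SOS: "prime_on (poly_functions coeffs) (SOS n d k)"
proof -
  have "prime_on (poly_functions coeffs) (range (\<lambda>x. sum_squares k (tri (shifted_sin base x))))"
    by (rule prime_on_range[OF tri_trig])
  moreover have "range (\<lambda>\<tau>. sum_squares k (tri \<tau>)) \<subseteq> Sym n (2 * d)" using sum_squares_in tri_in by blast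
  ultimately show ?thesis
    unfolding range_shifted_sin[of "\<lambda>\<tau>. sum_squares k (tri \<tau>)"] SOS_eq_closure_tri
    by (rule prime_on_closure)
qed

text \<open>\<open>exists_lift\<close> is applied to the graph of the map from parameters to sums of
  squares. Its growth is \<open>card J\<close>, and \<open>card J\<close> independent functions
  already come from the base, so all parameters are algebraic over the base.\<close>

lemma general_triangular_decomposition:
  "\<exists>b\<in>poly_functions coeffs. (\<exists>g\<in>SOS n d k. b g \<noteq> 0) \<and>
    (\<forall>g\<in>SOS n d k. b g \<noteq> 0 \<longrightarrow> (\<exists>\<tau>. sum_squares k (tri \<tau>) = g \<and>
      (\<forall>j. 1 \<le> j \<longrightarrow> j < k \<longrightarrow> Poly_Mapping.lookup (tri \<tau> j) (Poly_Mapping.single j d) \<noteq> 0)))"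
proof -
  let ?s = "card J"
  let ?\<Phi> = "\<lambda>\<tau>. (sum_squares k (tri \<tau>), \<tau>)"
  define S where "S = range (\<lambda>x. ?\<Phi> (shifted_sin base x))"
  have S: "S = range ?\<Phi>" unfolding S_def by (rule range_shifted_sin)
  have fstS: "fst ` S = range (\<lambda>\<tau>. sum_squares k (tri \<tau>))" unfolding S by (simp add: image_image)
  have tr: "(\<lambda>x. u (?\<Phi> (shifted_sin base x))) \<in> poly_functions (trig ?s)" if
    "u \<in> coords_ext coeffs ?s" for u
    using that by (auto simp: coords_ext_def intro!: tri_poly_functions shifted_sin_trig)
  have pr: "prime_on (poly_functions (coords_ext coeffs ?s)) S"
    unfolding S_def by (rule prime_on_range[OF tr])
  have gr: "growth_le ?s S (coords_ext coeffs ?s)"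
    unfolding S_def by (rule growth_le_range[OF tr])
  obtain w where w: "\<forall>i<?s. w i \<in> poly_functions coeffs" "algindep (fst ` S) {..<?s} w"
    using exists_algindep_coeffs unfolding fstS by blast
  define v where "v = (\<lambda>i (q :: cpoly \<times> (nat \<Rightarrow> complex)). w i (fst q))"
  have vC: "v i \<in> poly_functions (coords_ext coeffs j)" if "i < ?s" for i j
    unfolding v_def using w(1) that by (intro coords_ext_fst) simp
  have alg: "algebraic_over (coords_ext coeffs 0) S y" if "y \<in> poly_functions (coords_ext coeffs ?s)"
    for y
  proof (rule algebraic_over_trans)
    show "algebraic_over (v ` {..<?s}) S y"
    proof (rule algebraic_over_if_growth[OF _ _ _ _ that])
      show "growth_le (card {..<?s}) S (coords_ext coeffs ?s)" using gr by simp
      show "algindep S {..<?s} v" using w(2) unfolding algindep_image v_def .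
    qed (use vC in auto)
    show "v ` {..<?s} \<subseteq> poly_functions (coords_ext coeffs 0)" using vC by auto
  qed
  let ?m = "\<lambda>j. idx (j, Poly_Mapping.single j d)"
  have inJ: "(j, Poly_Mapping.single j d) \<in> J" if j: "1 \<le> j" "j < k" for j
    using inj_onD[OF a_inj, of j] j a_monoms by (fastforce simp: J_def)
  \<comment> \<open>The product of the diagonal entries, nonzero at the base tuple; it transfers to
    the lift as one condition.\<close>
  define p where "p = (\<lambda>q :: cpoly \<times> (nat \<Rightarrow> complex). \<Prod>j\<in>{1..<k}. snd q (?m j))"
  have pC: "p \<in> poly_functions (coords_ext coeffs ?s)"
    unfolding p_def using inJ idx_less
    by (intro poly_functions_prod poly_functions.coord) (auto simp: coords_ext_def)
  have "p (?\<Phi> base) \<noteq> 0" using inJ by (simp add: p_def base_idx)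
  then have p0: "\<exists>x\<in>S. p x \<noteq> 0" unfolding S by blast
  obtain b where b: "b \<in> poly_functions coeffs" "\<exists>x\<in>S. b (fst x) \<noteq> 0"
    and lift: "\<And>g. satisfies_relations coeffs (fst ` S) g \<Longrightarrow> b g \<noteq> 0 \<Longrightarrow>
      \<exists>\<tau>. satisfies_relations (coords_ext coeffs ?s) S (g, \<tau>) \<and> p (g, \<tau>) \<noteq> 0"
    using exists_lift[OF pr alg pC p0] by blast
  show ?thesis
  proof (intro bexI[of _ b] conjI ballI impI)
    show "\<exists>g\<in>SOS n d k. b g \<noteq> 0" using b(2) sum_squares_tri_in_SOS unfolding S by auto
    fix g assume g: "g \<in> SOS n d k" "b g \<noteq> 0"
    have "satisfies_relations coeffs (fst ` S) g"
      using g(1) unfolding SOS_eq_closure_tri fstS satisfies_relations_def zariski_closure_def by blast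
    from lift[OF this g(2)] obtain \<tau> where
      \<tau>: "satisfies_relations (coords_ext coeffs ?s) S (g, \<tau>)" "p (g, \<tau>) \<noteq> 0" by blast
    have "Poly_Mapping.lookup (sum_squares k (tri \<tau>)) B = Poly_Mapping.lookup g B" for B
    proof -
      \<comment> \<open>The equations of the graph are relations on \<open>S\<close>. A lift
        satisfies them, so it is a true decomposition of \<open>g\<close> and not merely a
        limit.\<close>
      have "(\<lambda>q. Poly_Mapping.lookup (sum_squares k (tri (snd q))) B - Poly_Mapping.lookup (fst q) B)
          \<in> poly_functions (coords_ext coeffs ?s)"
        by (intro poly_functions_diff tri_poly_functions poly_functions.coord) (auto simp:
          coords_ext_def)
      from satisfies_relationsD[OF \<tau>(1) this]
      have "Poly_Mapping.lookup (sum_squares k (tri (snd (g, \<tau>)))) B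
        - Poly_Mapping.lookup (fst (g, \<tau>)) B = 0"
        by (rule meta_mp) (auto simp: S)
      then show ?thesis by simp
    qed
    then have "sum_squares k (tri \<tau>) = g" by (rule poly_mapping_eqI)
    moreover have "Poly_Mapping.lookup (tri \<tau> j) (Poly_Mapping.single j d) \<noteq> 0" if "1 \<le> j" "j < k" for j
      using \<tau>(2) inJ[OF that] that by (simp add: lookup_tri p_def)
    ultimately show "\<exists>\<tau>. sum_squares k (tri \<tau>) = g \<and>
      (\<forall>j. 1 \<le> j \<longrightarrow> j < k \<longrightarrow> Poly_Mapping.lookup (tri \<tau> j) (Poly_Mapping.single j d) \<noteq> 0)" by blast
  qed (rule b)
qed

end

section \<open>Dimension of the fibres\<close>

definition rot :: "nat \<Rightarrow> nat \<Rightarrow> complex \<Rightarrow> (nat \<Rightarrow> cpoly) \<Rightarrow> nat \<Rightarrow> cpoly" where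
  "rot i j \<theta> f = f(i := Poly_Mapping.single 0 (cos \<theta>) * f i + Poly_Mapping.single 0 (sin \<theta>) * f j,
     j := Poly_Mapping.single 0 (cos \<theta>) * f j - Poly_Mapping.single 0 (sin \<theta>) * f i)"

primrec rots :: "(nat \<Rightarrow> nat \<times> nat) \<Rightarrow> nat \<Rightarrow> (nat \<Rightarrow> complex) \<Rightarrow> (nat \<Rightarrow> cpoly) \<Rightarrow> nat \<Rightarrow> cpoly" where
  "rots e 0 x f = f"
| "rots e (Suc l) x f = rot (fst (e l)) (snd (e l)) (x l) (rots e l x f)"

lemma lookup_rot:
  "i \<noteq> j \<Longrightarrow> Poly_Mapping.lookup (rot i j \<theta> f l) b =
    (if l = i then cos \<theta> * Poly_Mapping.lookup (f i) b + sin \<theta> * Poly_Mapping.lookup (f j) b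
     else if l = j then cos \<theta> * Poly_Mapping.lookup (f j) b - sin \<theta> * Poly_Mapping.lookup (f i) b
     else Poly_Mapping.lookup (f l) b)"
  by (simp add: rot_def lookup_add lookup_minus lookup_single_mult)

lemma rot_in:
  assumes "i \<in> {1..k}" "j \<in> {1..k}" "f \<in> Sym_tuples n d k"
  shows "rot i j \<theta> f \<in> Sym_tuples n d k"
proof -
  have "f i \<in> Sym n d" "f j \<in> Sym n d" using assms by (auto simp: Sym_tuples_def)
  then have "Poly_Mapping.single 0 (cos \<theta>) * f i + Poly_Mapping.single 0 (sin \<theta>) * f j \<in> Sym n d"
    "Poly_Mapping.single 0 (cos \<theta>) * f j - Poly_Mapping.single 0 (sin \<theta>) * f i \<in> Sym n d"
    by (simp_all add: Sym_add Sym_diff Sym_single_mult)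
  then show ?thesis using assms unfolding Sym_tuples_def rot_def by (auto simp: PiE_iff extensional_def)
qed

lemma sum_squares_rot:
  assumes "i \<in> {1..k}" "j \<in> {1..k}" "i \<noteq> j"
  shows "sum_squares k (rot i j \<theta> f) = sum_squares k f"
proof -
  define c s where "c = (Poly_Mapping.single 0 (cos \<theta>) :: cpoly)" and "s =
    (Poly_Mapping.single 0 (sin \<theta>) :: cpoly)"
  have "c * c + s * s = Poly_Mapping.single 0 (cos \<theta> * cos \<theta> + sin \<theta> * sin \<theta>)"
    by (simp only: c_def s_def single_0_hom)
  then have cs: "c * c + s * s = 1" using sin_cos_squared_add[of \<theta>]
    by (simp add: power2_eq_square add.commute)
  have split: "sum_squares k h = (h i)\<^sup>2 + ((h j)\<^sup>2 + (\<Sum>l\<in>{1..k} - {i} - {j}. (h l)\<^sup>2))" for h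
  proof -
    have "sum_squares k h = (h i)\<^sup>2 + (\<Sum>l\<in>{1..k} - {i}. (h l)\<^sup>2)"
      unfolding sum_squares_def using assms by (intro sum.remove) auto
    also have "(\<Sum>l\<in>{1..k} - {i}. (h l)\<^sup>2) = (h j)\<^sup>2 + (\<Sum>l\<in>{1..k} - {i} - {j}. (h l)\<^sup>2)"
      using assms by (intro sum.remove) auto
    finally show ?thesis .
  qed
  have "(\<Sum>l\<in>{1..k} - {i} - {j}. (rot i j \<theta> f l)\<^sup>2) = (\<Sum>l\<in>{1..k} - {i} - {j}. (f l)\<^sup>2)"
    by (rule sum.cong) (auto simp: rot_def)
  moreover have "(rot i j \<theta> f i)\<^sup>2 + (rot i j \<theta> f j)\<^sup>2 = (c * c + s * s) * ((f i)\<^sup>2 + (f j)\<^sup>2)"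
    using assms(3) by (simp add: rot_def power2_eq_square algebra_simps flip: c_def s_def)
  ultimately show ?thesis unfolding split cs by (simp add: algebra_simps)
qed

lemma rots_in:
  assumes "\<And>m. m < l \<Longrightarrow> fst (e m) \<in> {1..k} \<and> snd (e m) \<in> {1..k} \<and> fst (e m) \<noteq> snd (e m)"
    "f \<in> Sym_tuples n d k"
  shows "rots e l x f \<in> Sym_tuples n d k \<and> sum_squares k (rots e l x f) = sum_squares k f"
  using assms(1)
proof (induction l)
  case 0
  then show ?case using assms(2) by simp
next
  case (Suc l)
  then show ?case by (auto intro!: rot_in simp: sum_squares_rot)
qed

lemma rots_trig:
  assumes "\<And>m. m < l \<Longrightarrow> fst (e m) \<noteq> snd (e m)" "l \<le> s"
  shows "(\<lambda>x. Poly_Mapping.lookup (rots e l x f i) b) \<in> poly_functions (trig s)"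
  using assms
proof (induction l arbitrary: i)
  case 0
  then show ?case by (simp add: poly_functions.const)
next
  case (Suc l)
  then have IH: "(\<lambda>x. Poly_Mapping.lookup (rots e l x f i) b) \<in> poly_functions (trig s)" for i by simp
  have ne: "fst (e l) \<noteq> snd (e l)" using Suc.prems by simp
  have tr: "(\<lambda>x. sin (x l)) \<in> poly_functions (trig s)" "(\<lambda>x. cos (x l)) \<in> poly_functions (trig s)"
    using Suc.prems by (auto intro: sin_trig cos_trig)
  show ?case unfolding rots.simps lookup_rot[OF ne]
    by (cases "i = fst (e l)"; cases "i = snd (e l)")
      (auto intro!: poly_functions.add poly_functions_diff poly_functions.mult tr IH)
qed

text \<open>The matrix \<open>E_pq - E_qp\<close> of the Lie algebra of skew-symmetric matrices,
  applied to the tuple.\<close>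

definition so_action :: "nat \<times> nat \<Rightarrow> (nat \<Rightarrow> cpoly) \<Rightarrow> nat \<Rightarrow> (nat \<Rightarrow>\<^sub>0 nat) \<Rightarrow> complex" where
  "so_action pq f l b = (if l = fst pq then Poly_Mapping.lookup (f (snd pq)) b
     else if l = snd pq then - Poly_Mapping.lookup (f (fst pq)) b else 0)"

lemma rots_0:
  assumes "\<And>m. m < l \<Longrightarrow> fst (e m) \<noteq> snd (e m)"
  shows "rots e l (\<lambda>_. 0) f = f"
  using assms
proof (induction l)
  case (Suc l)
  then show ?case by (auto simp: rot_def)
qed simp

text \<open>All factors are the identity at parameter 0, so the product rule adds up the
  infinitesimal rotations.\<close>

lemma rots_derivative:
  assumes "\<And>m. m < l \<Longrightarrow> fst (e m) \<noteq> snd (e m)"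
  shows "((\<lambda>z. Poly_Mapping.lookup (rots e l (\<lambda>m. z * x m) f i) b) has_field_derivative
    (\<Sum>m<l. x m * so_action (e m) f i b)) (at 0)"
  using assms
proof (induction l arbitrary: i)
  case (Suc l)
  then have IH: "((\<lambda>z. Poly_Mapping.lookup (rots e l (\<lambda>m. z * x m) f i) b) has_field_derivative
    (\<Sum>m<l. x m * so_action (e m) f i b)) (at 0)" for i by simp
  have ne: "fst (e l) \<noteq> snd (e l)" using Suc.prems by simp
  have r0: "rots e l (\<lambda>_. 0) f = f" using Suc.prems by (intro rots_0) simp
  have act: "so_action (e l) f i b = (if i = fst (e l) then Poly_Mapping.lookup (f (snd (e l))) b
     else if i = snd (e l) then - Poly_Mapping.lookup (f (fst (e l))) b else 0)"
       by (simp add: so_action_def)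
  show ?case
    unfolding rots.simps lookup_rot[OF ne] sum.lessThan_Suc act
    by (cases "i = fst (e l)"; cases "i = snd (e l)")
      (auto intro!: derivative_eq_intros IH simp: r0 ne ne[symmetric])
qed simp

text \<open>The orbit of \<open>f\<close> under products of plane rotations lies in the fibre. Its
  tangent map is injective: in entry \<open>j\<close> the coefficient of \<open>a i\<close> with
  \<open>i < j\<close> involves only the angles of the pairs \<open>(p, j)\<close> with
  \<open>p \<le> i\<close>, and the angle of \<open>(i, j)\<close> enters with the nonzero diagonal
  coefficient.\<close>

lemma krull_dim_decompositions_ge:
  assumes f: "f \<in> Sym_tuples n d k"
    and low: "\<And>i j. 1 \<le> j \<Longrightarrow> j < i \<Longrightarrow> i \<le> k \<Longrightarrow> Poly_Mapping.lookup (f i) (a j) = 0"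
    and diag: "\<And>j. 1 \<le> j \<Longrightarrow> j < k \<Longrightarrow> Poly_Mapping.lookup (f j) (a j) \<noteq> 0"
  shows "ereal (real (k choose 2)) \<le> krull_dim (SOS_decompositions_top n d k (sum_squares k f))"
proof -
  define P where "P = {(j, i). 1 \<le> j \<and> j < i \<and> i \<le> k}"
  define c where "c = k choose 2"
  have cP: "card P = c" "finite P" unfolding P_def c_def by (rule card_pairs, rule finite_pairs)
  obtain h where "bij_betw h {0..<c} P" using ex_bij_betw_nat_finite[OF cP(2)] cP(1) by auto
  then have h: "bij_betw h {..<c} P" by (simp add: atLeast0LessThan)
  have hP: "h m \<in> P" if "m < c" for m using bij_betwE[OF h] that by auto
  have hk: "fst (h m) \<in> {1..k} \<and> snd (h m) \<in> {1..k} \<and> fst (h m) \<noteq> snd (h m)" if "m < c" for m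
    using hP[OF that] by (auto simp: P_def)
  define y where "y = the_inv_into {..<c} h"
  have y: "y (h m) = m" if "m < c" for m
    using h that by (auto simp: y_def bij_betw_def intro: the_inv_into_f_f)
  let ?\<Psi> = "\<lambda>x. rots h c x f"
  let ?D = "\<lambda>w x v. ((\<lambda>z. w (?\<Psi> (\<lambda>j. z * x j))) has_field_derivative v) (at 0)"
  have der: "?D (\<lambda>f. Poly_Mapping.lookup (f l) b) x (\<Sum>pq\<in>P. x (y pq) * so_action pq f l b)" for x l b
  proof -
    have "(\<Sum>m<c. x m * so_action (h m) f l b) = (\<Sum>m<c. x (y (h m)) * so_action (h m) f l b)"
      by (intro sum.cong) (auto simp: y)
    also have "\<dots> = (\<Sum>pq\<in>P. x (y pq) * so_action pq f l b)"
      by (rule sum.reindex_bij_betw[OF h])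
    finally show ?thesis using rots_derivative[of c h x f l b] hk by simp
  qed
  have tangent: "\<exists>w\<in>poly_functions (tuple_coeffs k). \<forall>x. ?D w x (x (y (i, j)))" if "1 \<le> i" "i < j"
    "j \<le> k" for i j
    using that
  proof (induction i rule: less_induct)
    case (less i)
    define Q where "Q = (\<lambda>p w. w \<in> poly_functions (tuple_coeffs k) \<and> (\<forall>x. ?D w x (x (y (p, j)))))"
    have "\<exists>w. Q p w" if "1 \<le> p" "p < i" for p
      using less.IH[of p] that less.prems unfolding Q_def Bex_def by simp
    then obtain w where "\<And>p. 1 \<le> p \<Longrightarrow> p < i \<Longrightarrow> Q p (w p)" by metis
    then have w: "\<And>p. 1 \<le> p \<Longrightarrow> p < i \<Longrightarrow> w p \<in> poly_functions (tuple_coeffs k)"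
      "\<And>p x. 1 \<le> p \<Longrightarrow> p < i \<Longrightarrow> ?D (w p) x (x (y (p, j)))" unfolding Q_def by blast+
    let ?b = "a i"
    let ?F = "\<lambda>p. Poly_Mapping.lookup (f p) ?b"
    have Fi: "?F i \<noteq> 0" using diag less.prems by simp
    \<comment> \<open>Forward substitution: the angles of \<open>(p, j)\<close> with
      \<open>p < i\<close> are already recovered by \<open>w p\<close>, so the equation at
      \<open>a i\<close> is solved for the angle of \<open>(i, j)\<close>.\<close>
    define v where "v = (\<lambda>g. - (1 / ?F i) * (Poly_Mapping.lookup (g j) ?b
      + (\<Sum>p\<in>{1..<i}. ?F p * w p g)))"
    have "(\<lambda>g. Poly_Mapping.lookup (g j) ?b) \<in> poly_functions (tuple_coeffs k)"
      using less.prems by (intro poly_functions.coord) auto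
    moreover have "(\<lambda>g. \<Sum>p\<in>{1..<i}. ?F p * w p g) \<in> poly_functions (tuple_coeffs k)"
      by (intro poly_functions_sum poly_functions_scale w(1)) auto
    ultimately have "v \<in> poly_functions (tuple_coeffs k)"
      unfolding v_def by (intro poly_functions_scale poly_functions.add)
    moreover have "?D v x (x (y (i, j)))" for x
    proof -
      have S: "(\<Sum>pq\<in>P. x (y pq) * so_action pq f j ?b) = - (\<Sum>p\<in>{1..<i}. ?F p * x (y (p, j)))
        - ?F i * x (y (i, j))"
      proof -
        have "(\<Sum>pq\<in>P. x (y pq) * so_action pq f j ?b) =
          (\<Sum>pq\<in>(\<lambda>p. (p, j)) ` {1..i}. x (y pq) * so_action pq f j ?b)"
        proof (rule sum.mono_neutral_right[OF cP(2)])
          show "(\<lambda>p. (p, j)) ` {1..i} \<subseteq> P" using less.prems by (auto simp: P_def)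
          show "\<forall>pq\<in>P - (\<lambda>p. (p, j)) ` {1..i}. x (y pq) * so_action pq f j ?b = 0"
          proof
            fix pq assume pq: "pq \<in> P - (\<lambda>p. (p, j)) ` {1..i}"
            \<comment> \<open>Every other pair that meets \<open>j\<close> brings in the coefficient
              of \<open>a i\<close> in an entry beyond the \<open>i\<close>-th, which is 0 by
              triangularity.\<close>
            obtain p q where e: "pq = (p, q)" by (cases pq)
            have "so_action pq f j ?b = 0"
              using pq less.prems low[of i p] low[of i q]
                by (auto simp: e so_action_def P_def image_iff)
            then show "x (y pq) * so_action pq f j ?b = 0" by simp
          qed
        qed
        also have "\<dots> = (\<Sum>p\<in>{1..i}. x (y (p, j)) * so_action (p, j) f j ?b)"
          by (subst sum.reindex) (auto simp: inj_on_def)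
        also have "\<dots> = (\<Sum>p\<in>{1..i}. - (?F p * x (y (p, j))))"
          using less.prems by (intro sum.cong) (auto simp: so_action_def)
        also have "\<dots> = - (?F i * x (y (i, j))) + (\<Sum>p\<in>{1..i} - {i}. - (?F p * x (y (p, j))))"
          using less.prems by (intro sum.remove) auto
        also have "{1..i} - {i} = {1..<i}" by auto
        finally show ?thesis by (simp add: sum_negf)
      qed
      have "?D v x (- (1 / ?F i) * ((\<Sum>pq\<in>P. x (y pq) * so_action pq f j ?b)
        + (\<Sum>p\<in>{1..<i}. ?F p * x (y (p, j)))))"
        unfolding v_def using w(2)
        by (intro DERIV_cmult DERIV_add der DERIV_sum) auto
      then show ?thesis unfolding S using Fi by simp
    qed
    ultimately show ?case by blast
  qed
  have "ereal (real c) \<le> krull_dim (zariski (tuple_coeffs k) {f' \<in> Sym_tuples n d k. sum_squares k f'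
    = sum_squares k f})"
  proof (rule krull_dim_zariski_ge[where \<Psi> = ?\<Psi>])
    show "?\<Psi> x \<in> {f' \<in> Sym_tuples n d k. sum_squares k f' = sum_squares k f}" for x
      using rots_in[of c h k f n d x] hk f by simp
    show "(\<lambda>x. u (?\<Psi> x)) \<in> poly_functions (trig c)" if "u \<in> tuple_coeffs k" for u
      using that hk by (auto intro!: rots_trig)
    show "\<exists>w\<in>poly_functions (tuple_coeffs k). \<forall>x. ?D w x (x m)" if "m < c" for m
    proof -
      from hP[OF that] obtain i j where "h m = (i, j)" "1 \<le> i" "i < j" "j \<le> k" by (auto simp: P_def)
      with tangent[of i j] y[OF that] show ?thesis by simp
    qed
  qed
  then show ?thesis by (simp add: SOS_decompositions_top_eq c_def)
qed

section \<open>Upper bound for the dimension of the general fibre\<close>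

text \<open>Makes explicit that a relation with coefficients in the pulled-back \<open>w i\<close>
  has coefficients that depend only on the image point and can be specialised there.\<close>

lemma poly_functions_lift:
  assumes "p \<in> poly_functions ((\<lambda>i x. w i (h x)) ` I)"
  shows "\<exists>q\<in>poly_functions (w ` I). \<forall>x. p x = q (h x)"
  using assms
proof induction
  case (const c)
  show ?case by (intro bexI[of _ "\<lambda>_. c"]) (auto intro: poly_functions.const)
next
  case (coord u)
  then obtain i where "i \<in> I" "u = (\<lambda>x. w i (h x))" by auto
  then show ?case by (intro bexI[of _ "w i"]) (auto intro: poly_functions.coord)
next
  case (add u v)
  then obtain u' v' where "u' \<in> poly_functions (w ` I)" "v' \<in> poly_functions (w ` I)"
    "\<forall>x. u x = u' (h x)" "\<forall>x. v x = v' (h x)" by blast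
  then show ?case by (intro bexI[of _ "\<lambda>g. u' g + v' g"]) (auto intro: poly_functions.add)
next
  case (mult u v)
  then obtain u' v' where "u' \<in> poly_functions (w ` I)" "v' \<in> poly_functions (w ` I)"
    "\<forall>x. u x = u' (h x)" "\<forall>x. v x = v' (h x)" by blast
  then show ?case by (intro bexI[of _ "\<lambda>g. u' g * v' g"]) (auto intro: poly_functions.mult)
qed

lemma growth_le_Sym_tuples:
  "growth_le (k * ((n + d) choose n)) (Sym_tuples n d k) (tuple_coeffs k)"
proof -
  let ?A = "{1..k} \<times> monoms n d"
  have fin: "finite ?A" by (simp add: finite_monoms)
  have card: "card ?A = k * ((n + d) choose n)" by (simp add: card_cartesian_product card_monoms)
  obtain e where "bij_betw e {0..<card ?A} ?A" using ex_bij_betw_nat_finite[OF fin] by blast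
  then have e: "bij_betw e {..<card ?A} ?A" by (simp add: atLeast0LessThan)
  define r where "r = the_inv_into {..<card ?A} e"
  have r: "bij_betw r ?A {..<card ?A}" unfolding r_def by (rule bij_betw_the_inv_into[OF e])
  have er: "e (r x) = x" if "x \<in> ?A" for x
    unfolding r_def using e that by (auto simp: bij_betw_def intro: f_the_inv_into_f)
  define \<Psi> where "\<Psi> = (\<lambda>\<tau>. tuple_of n d k (\<lambda>x. \<tau> (r x)))"
  have "f \<in> range \<Psi>" if f: "f \<in> Sym_tuples n d k" for f
  proof -
    have "\<Psi> (\<lambda>m. Poly_Mapping.lookup (f (fst (e m))) (snd (e m))) =
      tuple_of n d k (\<lambda>(i, a). Poly_Mapping.lookup (f i) a)"
      unfolding \<Psi>_def by (intro tuple_of_cong) (auto simp: er)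
    then show ?thesis unfolding tuple_of_lookup[OF f] by (metis rangeI)
  qed
  then have "Sym_tuples n d k \<subseteq> range (\<lambda>x. \<Psi> (shifted_sin (\<lambda>_. 0) x))"
    unfolding range_shifted_sin[of \<Psi>] by blast
  moreover have "growth_le (card ?A) (range (\<lambda>x. \<Psi> (shifted_sin (\<lambda>_. 0) x))) (tuple_coeffs k)"
  proof (rule growth_le_range)
    fix u assume "u \<in> tuple_coeffs k"
    then obtain i b where u: "u = (\<lambda>f. Poly_Mapping.lookup (f i) b)" "i \<in> {1..k}" by auto
    show "(\<lambda>x. u (\<Psi> (shifted_sin (\<lambda>_. 0) x))) \<in> poly_functions (trig (card ?A))"
    proof (cases "b \<in> monoms n d")
      case True
      then have "r (i, b) < card ?A" using bij_betwE[OF r] u(2) by auto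
      then show ?thesis using True u by (simp add: \<Psi>_def lookup_tuple_of shifted_sin_trig)
    qed (use u in \<open>simp add: \<Psi>_def lookup_tuple_of poly_functions.const\<close>)
  qed
  ultimately show ?thesis unfolding card using growth_le_subset by blast
qed

context power_slice
begin

text \<open>The elements of \<open>T\<close> together with \<open>card J\<close> functions of the
  sum of squares exceed the growth of the tuple space by one. In the resulting relation the
  coefficients are constant on each fibre, and wherever the coefficient \<open>q\<close> is nonzero
  the relation restricts to a nontrivial one among \<open>T\<close> alone.\<close>

lemma general_relation:
  assumes T: "T \<subseteq> {\<lambda>f. Poly_Mapping.lookup (f i) b | i b. i \<in> {1..k} \<and> b \<in> monoms n d}"
    and card_T: "card T = Suc (k choose 2)"
  shows "\<exists>q\<in>poly_functions coeffs. (\<exists>g\<in>SOS n d k. q g \<noteq> 0) \<and>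
    (\<forall>g Z. q g \<noteq> 0 \<longrightarrow> Z \<subseteq> {f \<in> Sym_tuples n d k. sum_squares k f = g} \<longrightarrow> \<not> algindep Z T (\<lambda>b. b))"
proof -
  have finT: "finite T" using card_T card.infinite by fastforce
  obtain w where w: "\<forall>i<card J. w i \<in> poly_functions coeffs"
    "algindep (range (\<lambda>\<tau>. sum_squares k (tri \<tau>))) {..<card J} w"
    using exists_algindep_coeffs by blast
  \<comment> \<open>Rebuilding the tuple from its coefficients of degree \<open>d\<close> makes this
    a polynomial map on all functions, while it agrees with \<open>sum_squares k\<close> on
    \<open>Sym_tuples\<close>.\<close>
  define \<phi> where "\<phi> = (\<lambda>f. sum_squares k (tuple_of n d k (\<lambda>(i, b). Poly_Mapping.lookup (f i) b)))"
  have \<phi>: "\<phi> f = sum_squares k f" if "f \<in> Sym_tuples n d k" for f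
    unfolding \<phi>_def tuple_of_lookup[OF that] ..
  define v where "v = (\<lambda>i f. w i (\<phi> f))"
  have vC: "v i \<in> poly_functions (tuple_coeffs k)" if "i < card J" for i
    unfolding v_def
  proof (rule poly_functions_compose[where u = "w i" and h = \<phi> and C = coeffs])
    show "w i \<in> poly_functions coeffs" using w(1) that by simp
    show "(\<lambda>f. u (\<phi> f)) \<in> poly_functions (tuple_coeffs k)" if "u \<in> coeffs" for u
    proof -
      from that obtain B where "u = (\<lambda>p. Poly_Mapping.lookup p B)" by blast
      moreover have "(\<lambda>f. (\<lambda>(i, b). Poly_Mapping.lookup (f i) b) (i, b)) \<in> poly_functions
        (tuple_coeffs k)"
        if "i \<in> {1..k}" for i b
        using that unfolding prod.case by (intro poly_functions.coord) blast
      ultimately show ?thesis unfolding \<phi>_def by (simp only:) (rule sum_squares_poly_functions)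
    qed
  qed
  have "range (\<lambda>\<tau>. sum_squares k (tri \<tau>)) \<subseteq> \<phi> ` Sym_tuples n d k"
    using \<phi>[OF tri_in] tri_in by (auto simp: image_iff) metis
  then have "algindep (\<phi> ` Sym_tuples n d k) {..<card J} w" by (rule algindep_mono[OF w(2)])
  then have alg: "algindep (Sym_tuples n d k) {..<card J} v" unfolding algindep_image v_def .
  have TC: "t \<in> poly_functions (tuple_coeffs k)" if "t \<in> T" for t
    using T that by (intro poly_functions.coord) blast
  have less: "k * ((n + d) choose n) < card {..<card J} + card T" using card_J card_T by simp
  obtain D p where p: "\<And>\<beta>. p \<beta> \<in> poly_functions (v ` {..<card J})"
    "\<exists>\<beta>\<in>PiE T (\<lambda>_. {..D}). \<exists>x\<in>Sym_tuples n d k. p \<beta> x \<noteq> 0"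
    "\<And>x. x \<in> Sym_tuples n d k \<Longrightarrow> (\<Sum>\<beta>\<in>PiE T (\<lambda>_. {..D}). p \<beta> x * mon T (\<lambda>b. b) \<beta> x) = 0"
    using algebraic_relation[OF growth_le_Sym_tuples _ finT less, of v "\<lambda>b. b"] vC alg TC
    by simp blast
  have "\<forall>\<beta>. \<exists>q\<in>poly_functions (w ` {..<card J}). \<forall>x. p \<beta> x = q (\<phi> x)"
    using p(1) poly_functions_lift unfolding v_def by blast
  then obtain q where q: "\<And>\<beta>. q \<beta> \<in> poly_functions (w ` {..<card J})" "\<And>\<beta> x. p \<beta> x = q \<beta> (\<phi> x)"
    by metis
  obtain \<beta>0 x0 where 0: "\<beta>0 \<in> PiE T (\<lambda>_. {..D})" "x0 \<in> Sym_tuples n d k" "p \<beta>0 x0 \<noteq> 0" using p(2)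
    by blast
  have "sum_squares k ` Sym_tuples n d k \<subseteq> SOS n d k"
    unfolding SOS_eq using sum_squares_in by (intro subset_zariski_closure) blast
  show ?thesis
  proof (intro bexI[of _ "q \<beta>0"] conjI allI impI)
    show "q \<beta>0 \<in> poly_functions coeffs"
      using poly_functions_trans[OF q(1)] w(1) by blast
    show "\<exists>g\<in>SOS n d k. q \<beta>0 g \<noteq> 0"
      using 0 \<open>_ \<subseteq> SOS n d k\<close> unfolding q(2) by (auto simp: \<phi>)
    fix g Z assume g: "q \<beta>0 g \<noteq> 0" and Z: "Z \<subseteq> {f \<in> Sym_tuples n d k. sum_squares k f = g}"
    show "\<not> algindep Z T (\<lambda>b. b)"
    proof
      assume a: "algindep Z T (\<lambda>b. b)"
      have "(\<Sum>\<beta>\<in>PiE T (\<lambda>_. {..D}). q \<beta> g * mon T (\<lambda>b. b) \<beta> x) = 0" if "x \<in> Z" for x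
      proof -
        have "x \<in> Sym_tuples n d k" "\<phi> x = g" using that Z \<phi> by auto
        with p(3)[of x] show ?thesis by (simp add: q(2))
      qed
      from algindepD[OF a this 0(1)] g show False by blast
    qed
  qed
qed

text \<open>A single open condition must rule out every independent set of
  \<open>(k choose 2) + 1\<close> coefficients. Only finitely many sets \<open>T\<close> are
  involved, so the product of their conditions will do, and it is nonzero since \<open>SOS\<close>
  is irreducible.\<close>

lemma general_krull_dim_le:
  "\<exists>q\<in>poly_functions coeffs. (\<exists>g\<in>SOS n d k. q g \<noteq> 0) \<and>
    (\<forall>g. q g \<noteq> 0 \<longrightarrow> krull_dim (SOS_decompositions_top n d k g) \<le> ereal (real (k choose 2)))"
proof -
  let ?c = "k choose 2"
  \<comment> \<open>Coefficients of monomials outside \<open>monoms n d\<close> vanish on tuples of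
    forms; the remaining ones are finite in number.\<close>
  define C0 :: "((nat \<Rightarrow> cpoly) \<Rightarrow> complex) set" where
    "C0 = {\<lambda>f. Poly_Mapping.lookup (f i) b | i b. i \<in> {1..k} \<and> b \<in> monoms n d}"
  have finC0: "finite C0"
  proof (rule finite_surj)
    show "finite ({1..k} \<times> monoms n d)" by (simp add: finite_monoms)
    show "C0 \<subseteq> (\<lambda>x f. Poly_Mapping.lookup (f (fst x)) (snd x)) ` ({1..k} \<times> monoms n d)"
      unfolding C0_def by force
  qed
  have C0: "C0 \<subseteq> tuple_coeffs k" by (auto simp: C0_def)
  define \<T> where "\<T> = {T. T \<subseteq> C0 \<and> card T = Suc ?c}"
  have fin\<T>: "finite \<T>" unfolding \<T>_def using finC0 by simp
  define R where "R = (\<lambda>T q. q \<in> poly_functions coeffs \<and> (\<exists>g\<in>SOS n d k. q g \<noteq> 0) \<and>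
    (\<forall>g Z. q g \<noteq> 0 \<longrightarrow> Z \<subseteq> {f \<in> Sym_tuples n d k. sum_squares k f = g} \<longrightarrow> \<not> algindep Z T (\<lambda>b. b)))"
  have "\<exists>q. R T q" if "T \<in> \<T>" for T
    using general_relation[of T] that unfolding \<T>_def C0_def R_def Bex_def mem_Collect_eq by simp
  then obtain q where qR: "\<And>T. T \<in> \<T> \<Longrightarrow> R T (q T)" by metis
  have q: "q T \<in> poly_functions coeffs" "\<exists>g\<in>SOS n d k. q T g \<noteq> 0"
    "\<And>g Z. q T g \<noteq> 0 \<Longrightarrow> Z \<subseteq> {f \<in> Sym_tuples n d k. sum_squares k f = g} \<Longrightarrow> \<not> algindep Z T (\<lambda>b. b)"
    if "T \<in> \<T>" for T
    using qR[OF that] unfolding R_def by simp_all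
  show ?thesis
  proof (intro bexI[of _ "\<lambda>g. \<Prod>T\<in>\<T>. q T g"] conjI allI impI)
    show "\<exists>g\<in>SOS n d k. (\<Prod>T\<in>\<T>. q T g) \<noteq> 0"
      by (rule prime_on_prod[OF prime_on_SOS fin\<T> q(1,2)])
    fix g assume g: "(\<Prod>T\<in>\<T>. q T g) \<noteq> 0"
    let ?F = "{f \<in> Sym_tuples n d k. sum_squares k f = g}"
    show "krull_dim (SOS_decompositions_top n d k g) \<le> ereal (real ?c)"
      unfolding SOS_decompositions_top_eq
    proof (rule krull_dim_leI)
      fix r Z assume Z: "\<And>i. i \<le> r \<Longrightarrow> irreducible_closed (zariski (tuple_coeffs k) ?F) (Z i)"
        "\<And>i. i < r \<Longrightarrow> Z i \<subset> Z (Suc i)"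
      have ZF: "Z r \<subseteq> ?F" by (rule irreducible_closed_subset[OF Z(1)]) simp
      have "growth_le ?c (Z r) (tuple_coeffs k)"
      proof (rule growth_le_if_dependent[OF _ finC0 C0])
        show "prime_on (poly_functions (tuple_coeffs k)) (Z r)"
          by (rule irreducible_closed_imp_prime_on[OF Z(1)]) simp
        show "y x = 0" if y: "y \<in> tuple_coeffs k - C0" and "x \<in> Z r" for y x
        proof -
          from y obtain i b where ib: "y = (\<lambda>f. Poly_Mapping.lookup (f i) b)" "i \<in> {1..k}" by auto
          with y have "b \<notin> monoms n d" by (auto simp: C0_def)
          moreover have "x \<in> {1..k} \<rightarrow>\<^sub>E Sym n d" using ZF \<open>x \<in> Z r\<close> by (auto simp: Sym_tuples_def)
          then have "x i \<in> Sym n d" using ib(2) by (rule PiE_mem)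
          ultimately show ?thesis by (simp add: ib(1) Sym_iff)
        qed
        show "\<not> algindep (Z r) T (\<lambda>b. b)" if "T \<subseteq> C0" "card T = Suc ?c" for T
        proof -
          have T: "T \<in> \<T>" using that by (simp add: \<T>_def)
          then have "q T g \<noteq> 0" using g fin\<T> by (meson prod_zero)
          from q(3)[OF T this ZF] show ?thesis .
        qed
      qed
      with irreducible_chain_length_le[of r "tuple_coeffs k" ?F Z ?c] Z show "r \<le> ?c" by simp
    qed
  qed (intro poly_functions_prod q(1))
qed

text \<open>The upper bound holds where \<open>q\<close> is nonzero and the orbit bound where
  \<open>b\<close> is. The common open set is dense because a function vanishing on it vanishes on
  the irreducible \<open>SOS\<close> after cancelling \<open>q * b\<close>.\<close>

lemma holds_generally_krull_dim:
  "holds_generally (SOS_top n d k)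
    (\<lambda>g. krull_dim (SOS_decompositions_top n d k g) = ereal (real (k choose 2)))"
proof -
  obtain q where q: "q \<in> poly_functions coeffs" "\<exists>g\<in>SOS n d k. q g \<noteq> 0"
    "\<And>g. q g \<noteq> 0 \<Longrightarrow> krull_dim (SOS_decompositions_top n d k g) \<le> ereal (real (k choose 2))"
    using general_krull_dim_le by blast
  obtain b where b: "b \<in> poly_functions coeffs" "\<exists>g\<in>SOS n d k. b g \<noteq> 0"
    and dec: "\<And>g. g \<in> SOS n d k \<Longrightarrow> b g \<noteq> 0 \<Longrightarrow> \<exists>\<tau>. sum_squares k (tri \<tau>) = g \<and>
      (\<forall>j. 1 \<le> j \<longrightarrow> j < k \<longrightarrow> Poly_Mapping.lookup (tri \<tau> j) (Poly_Mapping.single j d) \<noteq> 0)"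
    using general_triangular_decomposition by blast
  define U where "U = {g \<in> SOS n d k. q g * b g \<noteq> 0}"
  have qb: "(\<lambda>g. q g * b g) \<in> poly_functions coeffs" by (intro poly_functions.mult q b)
  have "openin (SOS_top n d k) U"
    unfolding SOS_top_eq openin_zariski U_def
    by (intro exI[of _ "{\<lambda>g. q g * b g}"]) (use qb in auto)
  moreover have "SOS_top n d k closure_of U = topspace (SOS_top n d k)"
  proof -
    have nz: "\<exists>g\<in>SOS n d k. q g * b g \<noteq> 0"
    proof (rule ccontr)
      assume "\<not> ?thesis"
      then show False using prime_onD[OF prime_on_SOS q(1) b(1)] q(2) b(2) by blast
    qed
    have "g \<in> zariski_closure coeffs (SOS n d k) U" if g: "g \<in> SOS n d k" for g
      unfolding zariski_closure_def
    proof (intro CollectI conjI ballI impI g)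
      fix u assume u: "u \<in> poly_functions coeffs" "\<forall>x\<in>U. u x = 0"
      show "u g = 0"
        by (rule prime_onD[OF prime_on_SOS qb u(1) _ nz g]) (use u(2) in \<open>auto simp: U_def\<close>)
    qed
    moreover have "zariski_closure coeffs (SOS n d k) U \<subseteq> SOS n d k" by (auto simp: zariski_closure_def)
    moreover have "U \<subseteq> SOS n d k" by (auto simp: U_def)
    ultimately show ?thesis unfolding SOS_top_eq by (simp add: closure_of_zariski) blast
  qed
  moreover have "krull_dim (SOS_decompositions_top n d k g) = ereal (real (k choose 2))" if g: "g \<in> U"
    for g
  proof (rule antisym)
    show "krull_dim (SOS_decompositions_top n d k g) \<le> ereal (real (k choose 2))"
      using g q(3) by (auto simp: U_def)
    obtain \<tau> where \<tau>: "sum_squares k (tri \<tau>) = g"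
      "\<And>j. 1 \<le> j \<Longrightarrow> j < k \<Longrightarrow> Poly_Mapping.lookup (tri \<tau> j) (Poly_Mapping.single j d) \<noteq> 0"
      using dec[of g] g by (auto simp: U_def)
    have low: "Poly_Mapping.lookup (tri \<tau> i) (Poly_Mapping.single j d) = 0" if "1 \<le> j" "j < i" "i \<le> k"
      for i j
      using that by (auto simp: lookup_tri J_def)
    show "ereal (real (k choose 2)) \<le> krull_dim (SOS_decompositions_top n d k g)"
      using krull_dim_decompositions_ge[OF tri_in low \<tau>(2)] \<tau>(1) by simp
  qed
  ultimately show ?thesis unfolding holds_generally_def by blast
qed

end

theorem corollary1p7:
  fixes n d k :: nat
  assumes "k \<le> ((n + d) choose n) + 1"
  shows "krull_dim (SOS_top n d k) \<le>
           ereal (real k * real ((n + d) choose n) - real (k choose 2)) \<and>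
         (k \<le> n \<longrightarrow>
           krull_dim (SOS_top n d k) =
             ereal (real k * real ((n + d) choose n) - real (k choose 2)) \<and>
           holds_generally (SOS_top n d k)
             (\<lambda>g. krull_dim (SOS_decompositions_top n d k g) = ereal (real (k choose 2))))"
proof (intro conjI impI)
  \<comment> \<open>The bound on \<open>k\<close> provides \<open>k - 1\<close> distinct monomials;
    for the inequality any choice of them works.\<close>
  have "\<exists>a. a ` {1..<k} \<subseteq> monoms n d \<and> inj_on a {1..<k}"
    by (rule card_le_inj) (use assms in \<open>auto simp: card_monoms finite_monoms\<close>)
  then obtain a where a: "a ` {1..<k} \<subseteq> monoms n d" "inj_on a {1..<k}" by blast
  interpret slice n d k a by unfold_locales (use a in auto)
  show "krull_dim (SOS_top n d k) \<le> ereal (real k * real ((n + d) choose n) - real (k choose 2))"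
    using krull_dim_SOS_le unfolding real_card_J .
next
  assume "k \<le> n"
  then interpret power_slice n d k by unfold_locales (use assms in auto)
  show "krull_dim (SOS_top n d k) = ereal (real k * real ((n + d) choose n) - real (k choose 2))"
    using krull_dim_SOS unfolding real_card_J .
  show "holds_generally (SOS_top n d k)
      (\<lambda>g. krull_dim (SOS_decompositions_top n d k g) = ereal (real (k choose 2)))"
    by (rule holds_generally_krull_dim)
qed

end
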